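(* Let $(U_i)_{i\in\mathbb{N}}$ be an i.i.d. sequence of uniform random variables on $[0,1]$, with order statistics $U_{1:k}<\dots<U_{k:k}$ of $U_1,\dots,U_k$. For any $\gamma$-convergent sequence $(\mathtt{T}_n)_{n\in\mathbb{N}}$ of Schröder trees there exists a unique $K\in\mathrm{STree}(\infty)$ such that $$\lim_{n\to\infty}\gamma(\mathtt{T},\mathtt{T}_n)=\mathbb{P}\big(\phi^\infty_k(K,U_{1:k},\dots,U_{k:k})=\mathtt{T}\big)$$ holds for every $k\in\mathbb{N}$ and $\mathtt{T}\in\mathrm{STree}(k)$. The map $\mathrm{STree}(\infty)\to\partial(\mathtt{ErSTPr})$ sending $K$ to the law of the erased-Schröder tree process $(T_k,\eta_k)_{k\in\mathbb{N}}$ with $\mathbb{P}(T_k=\mathtt{T})=\mathbb{P}(\phi^\infty_k(K,U_{1:k},\dots,U_{k:k})=\mathtt{T})$ for all $k\in\mathbb{N}$, $\mathtt{T}\in\mathrm{STree}(k)$ (this law exists and is unique) is a homeomorphism onto the Martin boundary $\partial(\mathtt{ErSTPr})$ of Schröder trees with respect to $\gamma$.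
   Context: An interval system on $[n]=\{1,\dots,n\}$ is a set $\mathtt{I}$ of subsets of $[n]$ with $\emptyset\in\mathtt{I}$, $\{j\}\in\mathtt{I}$ for all $j\in[n]$, and such that every non-empty element is of the form $[a,b]:=\{i\in[n]:a\le i\le b\}$. $\mathrm{InSy}(n)$ is the finite set of these. A Schröder tree on $[n]$ is an interval system $\mathtt{T}$ on $[n]$ with $[n]\in\mathtt{T}$ and $e\cap f\in\{e,f,\emptyset\}$ for all $e,f\in\mathtt{T}$; $\mathrm{STree}(n)$ is the set of these. For $k\le n$ let $[k:n]$ be the set of strictly increasing vectors $\vec j=(j_1,\dots,j_k)\in[n]^k$; put $j_0:=-n$, $j_{k+1}:=2n$. For $\mathtt{I}\in\mathrm{InSy}(n)$ let $\phi^n_k(\mathtt{I},\vec j)\in\mathrm{InSy}(k)$ consist of $\emptyset$ and all $[a,b]$, $1\le a\le b\le k$, for which there is $[A,B]\in\mathtt{I}$ with $j_{a-1}<A\le j_a\le j_b\le B<j_{b+1}$. For $\mathtt{I}_k\in\mathrm{InSy}(k)$, $\mathtt{I}_n\in\mathrm{InSy}(n)$ let $$\gamma(\mathtt{I}_k,\mathtt{I}_n):=\binom nk^{-1}\#\{\vec j\in[k:n]:\phi^n_k(\mathtt{I}_n,\vec j)=\mathtt{I}_k\}\ \text{ if }k\le n,\qquad \gamma(\mathtt{I}_k,\mathtt{I}_n):=0\ \text{ if }k>n.$$ A sequence $(\mathtt{T}_n)_{n\in\mathbb{N}}$ of Schröder trees, $\mathtt{T}_n\in\mathrm{STree}(m_n)$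 with $m_n\to\infty$, is $\gamma$-convergent if $\gamma(\mathtt{T},\mathtt{T}_n)$ converges as $n\to\infty$ for every $k\in\mathbb{N}$ and $\mathtt{T}\in\mathrm{STree}(k)$ (densities of interval systems that are not Schröder trees in Schröder trees are $0$). For $[a,b]\subseteq[n+1]$ and $k\in[n+1]$ let $[a,b]-\{k\}\subseteq[n]$ be $[a-1,b-1]$ if $k<a$; $[a,b-1]$ if $a\le k\le b$ (empty if $a=b$); $[a,b]$ if $b<k$; and for $\mathtt{I}\in\mathrm{InSy}(n+1)$ let $\phi^{n+1}_n(\mathtt{I},k):=\{[a,b]-\{k\}:[a,b]\in\mathtt{I}\}\cup\{\emptyset\}$. An erased-Schröder tree process is a process $(T_n,\eta_n)_{n\in\mathbb{N}}$ such that for all $n$: (i) $(T_n,\eta_n)\in\mathrm{STree}(n)\times[n+1]$ a.s.; (ii) $\eta_n$ is uniform on $[n+1]$ and independent of $\sigma(T_m,\eta_m:m\ge n+1)$; (iii) $T_n=\phi^{n+1}_n(T_{n+1},\eta_n)$ a.s. Its law is determined by the laws of the $T_n$. The Martin boundary $\partial(\mathtt{ErSTPr})$ is the set of all laws of erased-Schröder tree processes $(T_n,\eta_n)_n$ for which there is a $\gamma$-convergent sequence $(\mathtt{T}_n)_n$ of Schröder trees with $\mathbb{P}(T_k=\mathtt{T})=\lim_n\gamma(\mathtt{T},\mathtt{T}_n)$ for all $k$, $\mathtt{T}\in\mathrm{STree}(k)$; it carries the topology of weak convergence of Borel probability measures on $\prod_n\mathrm{InSy}(n)\times[n+1]$.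 $\mathrm{STree}(\infty)$ is the set of compact $K\subseteq\{(x,y)\in\mathbb{R}^2:0\le x\le y\le1\}$ such that $(x,x)\in K$ for all $x\in[0,1]$, the point $(0,1)$ belongs to $K$, and for all $(x_1,y_1),(x_2,y_2)\in K$ with $x_1<x_2<y_1$ one has $y_2\le y_1$; it carries the Hausdorff distance induced by the $\ell^1$-metric. For such $K$ and $0\le u_1<\dots<u_k\le1$ put $u_0:=-1$, $u_{k+1}:=2$ and let $\phi^\infty_k(K,u_1,\dots,u_k)\in\mathrm{InSy}(k)$ consist of $\emptyset$, all singletons $\{j\}$, $j\in[k]$, and all $[a,b]$ with $1\le a<b\le k$ for which there is $(x,y)\in K$ with $u_{a-1}<x<u_a\le u_b<y<u_{b+1}$. *)

theory Defs
  imports "HOL-Probability.Probability"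
begin

section \<open>Interval systems, Schroeder trees and subtree densities\<close>

definition InSy :: "nat \<Rightarrow> nat set set set" where
  "InSy n = {I. I \<subseteq> Pow {1..n} \<and> {} \<in> I \<and> (\<forall>j\<in>{1..n}. {j} \<in> I)
              \<and> (\<forall>e\<in>I. e \<noteq> {} \<longrightarrow> (\<exists>a b. e = {a..b}))}"

definition STree :: "nat \<Rightarrow> nat set set set" where
  "STree n = {T \<in> InSy n. {1..n} \<in> T \<and> (\<forall>e\<in>T. \<forall>f\<in>T. e \<inter> f \<in> {e, f, {}})}"

definition incr_vecs :: "nat \<Rightarrow> nat \<Rightarrow> (nat \<Rightarrow> nat) set" where
  "incr_vecs k n = {j \<in> {1..k} \<rightarrow>\<^sub>E {1..n}. strict_mono_on {1..k} j}"

text \<open>A vector \<open>(v\<^sub>1, \<dots>, v\<^sub>k)\<close> together with the boundary values \<open>v\<^sub>0 = lo\<close> and \<open>v\<^sub>k\<^sub>+\<^sub>1 = hi\<close>.\<close>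

definition with_ends :: "'a \<Rightarrow> 'a \<Rightarrow> nat \<Rightarrow> (nat \<Rightarrow> 'a) \<Rightarrow> nat \<Rightarrow> 'a" where
  "with_ends lo hi k v i = (if i = 0 then lo else if i = k + 1 then hi else v i)"

definition phi_fin :: "nat \<Rightarrow> nat \<Rightarrow> nat set set \<Rightarrow> (nat \<Rightarrow> nat) \<Rightarrow> nat set set" where
  "phi_fin n k I j =
     (let v = with_ends (- int n) (2 * int n) k (\<lambda>i. int (j i)) in
      {{}} \<union> {{a..b} |a b. 1 \<le> a \<and> a \<le> b \<and> b \<le> k \<and>
         (\<exists>A B. {A..B} \<in> I \<and> v (a - 1) < int A \<and> int A \<le> v a \<and> v a \<le> v b
                \<and> v b \<le> int B \<and> int B < v (b + 1))})"

definition gamma_density :: "nat \<Rightarrow> nat set set \<Rightarrow> nat \<Rightarrow> nat set set \<Rightarrow> real" where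
  "gamma_density k Ik n In =
     (if k \<le> n
      then real (card {j \<in> incr_vecs k n. phi_fin n k In j = Ik}) / real (n choose k)
      else 0)"

definition gamma_convergent :: "(nat \<Rightarrow> nat) \<Rightarrow> (nat \<Rightarrow> nat set set) \<Rightarrow> bool" where
  "gamma_convergent m S \<longleftrightarrow>
     (\<forall>n. m n \<ge> 1 \<and> S n \<in> STree (m n)) \<and> filterlim m at_top sequentially
     \<and> (\<forall>k\<ge>1. \<forall>T\<in>STree k. convergent (\<lambda>n. gamma_density k T (m n) (S n)))"


section \<open>Erased-Schroeder tree processes and their laws\<close>

text \<open>The interval \<open>[a,b] - {k}\<close>: remove the point \<open>k\<close> and relabel increasingly.
  For \<open>a = b = k \<ge> 1\<close> the value \<open>{a..b-1}\<close> is empty.\<close>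

definition interval_remove :: "nat \<Rightarrow> nat \<Rightarrow> nat \<Rightarrow> nat set" where
  "interval_remove a b k =
     (if k < a then {a - 1..b - 1} else if k \<le> b then {a..b - 1} else {a..b})"

definition erase :: "nat set set \<Rightarrow> nat \<Rightarrow> nat set set" where
  "erase I k = {interval_remove a b k |a b. 1 \<le> a \<and> a \<le> b \<and> {a..b} \<in> I} \<union> {{}}"

text \<open>Processes are indexed by \<open>n \<ge> 1\<close>; the values at \<open>0\<close> are irrelevant.\<close>

definition erased_process ::
    "'w measure \<Rightarrow> (nat \<Rightarrow> 'w \<Rightarrow> nat set set) \<Rightarrow> (nat \<Rightarrow> 'w \<Rightarrow> nat) \<Rightarrow> bool" where
  "erased_process M T \<eta> \<longleftrightarrow> prob_space M \<and> (\<forall>n\<ge>1.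
     T n \<in> measurable M (count_space (InSy n)) \<and>
     \<eta> n \<in> measurable M (count_space {1..n + 1}) \<and>
     (AE \<omega> in M. T n \<omega> \<in> STree n \<and> \<eta> n \<omega> \<in> {1..n + 1}) \<and>
     distr M (count_space {1..n + 1}) (\<eta> n) = uniform_count_measure {1..n + 1} \<and>
     prob_space.indep_set M
       {\<eta> n -` A \<inter> space M |A. A \<subseteq> {1..n + 1}}
       (sigma_sets (space M)
         (\<Union>m\<in>{n + 1..}. {(\<lambda>\<omega>. (T m \<omega>, \<eta> m \<omega>)) -` A \<inter> space M |A. A \<subseteq> InSy m \<times> {1..m + 1}})) \<and>
     (AE \<omega> in M. T n \<omega> = erase (T (n + 1) \<omega>) (\<eta> n \<omega>)))"

type_synonym path = "nat \<Rightarrow> nat set set \<times> nat"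

definition path_topology :: "path topology" where
  "path_topology = product_topology (\<lambda>n. discrete_topology (InSy n \<times> {1..n + 1})) {1..}"

definition path_borel :: "path measure" where
  "path_borel = sigma (topspace path_topology) {V. openin path_topology V}"

definition path_probs :: "path measure set" where
  "path_probs = {\<mu>. prob_space \<mu> \<and> sets \<mu> = sets path_borel}"

text \<open>Coarsest topology making \<open>\<mu> \<mapsto> \<integral> f d\<mu>\<close> continuous for each bounded continuous \<open>f\<close>.\<close>

definition weak_topology :: "path measure topology" where
  "weak_topology = topology_generated_by
     {{\<mu> \<in> path_probs. (LINT \<omega>|\<mu>. f \<omega>) \<in> V} |f V.
        continuous_map path_topology euclideanreal f \<and>
        bounded (f ` topspace path_topology) \<and> open V}"

definition process_law ::
    "'w measure \<Rightarrow> (nat \<Rightarrow> 'w \<Rightarrow> nat set set) \<Rightarrow> (nat \<Rightarrow> 'w \<Rightarrow> nat) \<Rightarrow> path measure" where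
  "process_law M T \<eta> = distr M path_borel (\<lambda>\<omega>. \<lambda>n\<in>{1..}. (T n \<omega>, \<eta> n \<omega>))"

text \<open>In the next two definitions the sample spaces are taken of type \<^typ>\<open>path\<close>. This loses no
  law, since every process has a version with the same law on the canonical path space.\<close>

definition erased_laws :: "path measure set" where
  "erased_laws = {process_law M T \<eta> |(M :: path measure) T \<eta>. erased_process M T \<eta>}"

definition martin_boundary :: "path measure set" where
  "martin_boundary = {process_law M T \<eta> |(M :: path measure) T \<eta>.
     erased_process M T \<eta> \<and>
     (\<exists>m S. gamma_convergent m S \<and>
        (\<forall>k\<ge>1. \<forall>t\<in>STree k.
           (\<lambda>n. gamma_density k t (m n) (S n)) \<longlonglongrightarrow> measure M {\<omega> \<in> space M. T k \<omega> = t}))}"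

definition martin_boundary_topology :: "path measure topology" where
  "martin_boundary_topology = subtopology weak_topology martin_boundary"


section \<open>Continuum Schroeder trees\<close>

definition STree_inf :: "(real \<times> real) set set" where
  "STree_inf = {K. compact K \<and> K \<subseteq> {(x, y). 0 \<le> x \<and> x \<le> y \<and> y \<le> 1}
     \<and> (\<forall>x\<in>{0..1}. (x, x) \<in> K) \<and> (0, 1) \<in> K
     \<and> (\<forall>x1 y1 x2 y2. (x1, y1) \<in> K \<and> (x2, y2) \<in> K \<and> x1 < x2 \<and> x2 < y1 \<longrightarrow> y2 \<le> y1)}"

definition l1_dist :: "real \<times> real \<Rightarrow> real \<times> real \<Rightarrow> real" where
  "l1_dist p q = \<bar>fst p - fst q\<bar> + \<bar>snd p - snd q\<bar>"

text \<open>Outside \<open>STree_inf\<close> (where suprema and infima may be unspecified) the value is set to \<open>0\<close>,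
  because \<^locale>\<open>Metric_space\<close> requires nonnegativity everywhere.\<close>

definition hausdorff_dist :: "(real \<times> real) set \<Rightarrow> (real \<times> real) set \<Rightarrow> real" where
  "hausdorff_dist A B =
     (if A \<in> STree_inf \<and> B \<in> STree_inf
      then max (SUP a\<in>A. INF b\<in>B. l1_dist a b) (SUP b\<in>B. INF a\<in>A. l1_dist a b)
      else 0)"

definition STree_inf_topology :: "(real \<times> real) set topology" where
  "STree_inf_topology = Metric_space.mtopology STree_inf hausdorff_dist"

definition phi_inf :: "nat \<Rightarrow> (real \<times> real) set \<Rightarrow> (nat \<Rightarrow> real) \<Rightarrow> nat set set" where
  "phi_inf k K u =
     (let v = with_ends (- 1) 2 k u in
      {{}} \<union> {{j} |j. j \<in> {1..k}} \<union>
      {{a..b} |a b. 1 \<le> a \<and> a < b \<and> b \<le> k \<and>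
         (\<exists>(x, y)\<in>K. v (a - 1) < x \<and> x < v a \<and> v a \<le> v b \<and> v b < y \<and> y < v (b + 1))})"

definition order_stat :: "(nat \<Rightarrow> 'w \<Rightarrow> real) \<Rightarrow> nat \<Rightarrow> 'w \<Rightarrow> nat \<Rightarrow> real" where
  "order_stat U k \<omega> i = sort (map (\<lambda>l. U l \<omega>) [1..<k + 1]) ! (i - 1)"

definition sample_prob ::
    "'w measure \<Rightarrow> (nat \<Rightarrow> 'w \<Rightarrow> real) \<Rightarrow> (real \<times> real) set \<Rightarrow> nat \<Rightarrow> nat set set \<Rightarrow> real" where
  "sample_prob M U K k T = measure M {\<omega> \<in> space M. phi_inf k K (order_stat U k \<omega>) = T}"

definition is_tree_law ::
    "'w measure \<Rightarrow> (nat \<Rightarrow> 'w \<Rightarrow> real) \<Rightarrow> (real \<times> real) set \<Rightarrow> path measure \<Rightarrow> bool" where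
  "is_tree_law M U K \<mu> \<longleftrightarrow> \<mu> \<in> erased_laws \<and>
     (\<forall>k\<ge>1. \<forall>T\<in>STree k.
        measure \<mu> {\<omega> \<in> space \<mu>. fst (\<omega> k) = T} = sample_prob M U K k T)"

text \<open>\<^const>\<open>Metric_space.mtopology\<close> is only meaningful for a metric, which is the case here.\<close>

lemma l1_dist_triangle: "l1_dist a c \<le> l1_dist a b + l1_dist b c"
  by (auto simp: l1_dist_def)

lemma STree_inf_l1_dist_le:
  assumes "A \<in> STree_inf" "B \<in> STree_inf" "a \<in> A" "b \<in> B"
  shows "l1_dist a b \<le> 2"
  using assms unfolding STree_inf_def l1_dist_def by (auto simp: abs_if subset_eq) fastforce+

lemma STree_inf_near:
  assumes A: "A \<in> STree_inf" and B: "B \<in> STree_inf" and a: "a \<in> A"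
  shows "\<exists>b\<in>B. l1_dist a b \<le> (SUP a\<in>A. INF b\<in>B. l1_dist a b)"
proof -
  have "compact B" "B \<noteq> {}" using B by (auto simp: STree_inf_def)
  moreover have "continuous_on B (l1_dist a)"
    unfolding l1_dist_def by (intro continuous_intros)
  ultimately obtain b where b: "b \<in> B" "\<forall>c\<in>B. l1_dist a b \<le> l1_dist a c"
    using continuous_attains_inf by blast
  have "l1_dist a b \<le> (INF b\<in>B. l1_dist a b)"
    using b by (intro cINF_greatest) auto
  also have "\<dots> \<le> (SUP a\<in>A. INF b\<in>B. l1_dist a b)"
  proof (rule cSUP_upper[OF a], rule bdd_aboveI2)
    fix x assume x: "x \<in> A"
    have "(INF b\<in>B. l1_dist x b) \<le> l1_dist x b"
      using b(1) by (intro cINF_lower bdd_belowI2[where m=0]) (auto simp: l1_dist_def)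
    also have "\<dots> \<le> 2" using STree_inf_l1_dist_le[OF A B x b(1)] .
    finally show "(INF b\<in>B. l1_dist x b) \<le> 2" .
  qed
  finally show ?thesis using b(1) by blast
qed

lemma STree_inf_SUP_le:
  assumes "A \<in> STree_inf" "\<And>a. a \<in> A \<Longrightarrow> \<exists>b\<in>B. l1_dist a b \<le> r"
  shows "(SUP a\<in>A. INF b\<in>B. l1_dist a b) \<le> r"
proof (rule cSUP_least)
  show "A \<noteq> {}" using assms(1) by (auto simp: STree_inf_def)
  fix a assume "a \<in> A"
  then obtain b where b: "b \<in> B" "l1_dist a b \<le> r" using assms(2) by blast
  have "(INF b\<in>B. l1_dist a b) \<le> l1_dist a b"
    using b(1) by (intro cINF_lower bdd_belowI2[where m=0]) (auto simp: l1_dist_def)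
  with b(2) show "(INF b\<in>B. l1_dist a b) \<le> r" by simp
qed

lemma l1_dist_commute: "l1_dist a b = l1_dist b a"
  by (auto simp: l1_dist_def)

lemma hausdorff_dist_commute: "hausdorff_dist A B = hausdorff_dist B A"
  unfolding hausdorff_dist_def by (simp add: l1_dist_commute max.commute)

lemma hausdorff_dist_near:
  assumes "A \<in> STree_inf" "B \<in> STree_inf" "a \<in> A"
  shows "\<exists>b\<in>B. l1_dist a b \<le> hausdorff_dist A B"
  using STree_inf_near[OF assms] assms(1,2) unfolding hausdorff_dist_def
  by (auto intro: max.coboundedI1)

lemma hausdorff_dist_le:
  assumes "A \<in> STree_inf" "B \<in> STree_inf"
    and "\<And>a. a \<in> A \<Longrightarrow> \<exists>b\<in>B. l1_dist a b \<le> r" "\<And>b. b \<in> B \<Longrightarrow> \<exists>a\<in>A. l1_dist b a \<le> r"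
  shows "hausdorff_dist A B \<le> r"
  unfolding hausdorff_dist_def
  using STree_inf_SUP_le[OF assms(1,3)] STree_inf_SUP_le[OF assms(2,4)] assms(1,2)
  by (simp add: l1_dist_commute)

lemma hausdorff_dist_nonneg: "0 \<le> hausdorff_dist A B"
proof (cases "A \<in> STree_inf \<and> B \<in> STree_inf")
  case True
  then obtain a where "a \<in> A" by (auto simp: STree_inf_def)
  then obtain b where "l1_dist a b \<le> hausdorff_dist A B"
    using hausdorff_dist_near True by blast
  moreover have "0 \<le> l1_dist a b" by (simp add: l1_dist_def)
  ultimately show ?thesis by simp
qed (auto simp: hausdorff_dist_def)

lemma hausdorff_dist_zero_subset:
  assumes "A \<in> STree_inf" "B \<in> STree_inf" "hausdorff_dist A B = 0"
  shows "A \<subseteq> B"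
proof
  fix a assume "a \<in> A"
  then obtain b where b: "b \<in> B" "l1_dist a b \<le> 0"
    using hausdorff_dist_near[OF assms(1,2)] assms(3) by metis
  then have "a = b" by (auto simp: l1_dist_def prod_eq_iff)
  with b show "a \<in> B" by simp
qed

lemma Metric_space_STree_inf: "Metric_space STree_inf hausdorff_dist"
proof -
  have tri: "hausdorff_dist A C \<le> hausdorff_dist A B + hausdorff_dist B C"
    if A: "A \<in> STree_inf" and B: "B \<in> STree_inf" and C: "C \<in> STree_inf" for A B C
  proof (rule hausdorff_dist_le[OF A C])
    show "\<exists>c\<in>C. l1_dist a c \<le> hausdorff_dist A B + hausdorff_dist B C" if a: "a \<in> A" for a
    proof -
      obtain b where "b \<in> B" "l1_dist a b \<le> hausdorff_dist A B"
        using hausdorff_dist_near[OF A B a] by blast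
      moreover obtain c where "c \<in> C" "l1_dist b c \<le> hausdorff_dist B C"
        using hausdorff_dist_near[OF B C \<open>b \<in> B\<close>] by blast
      ultimately show ?thesis using l1_dist_triangle[of a c b] by (intro bexI[of _ c]) auto
    qed
    show "\<exists>a\<in>A. l1_dist c a \<le> hausdorff_dist A B + hausdorff_dist B C" if c: "c \<in> C" for c
    proof -
      obtain b where "b \<in> B" "l1_dist c b \<le> hausdorff_dist B C"
        using hausdorff_dist_near[OF C B c] hausdorff_dist_commute by metis
      moreover obtain a where "a \<in> A" "l1_dist b a \<le> hausdorff_dist A B"
        using hausdorff_dist_near[OF B A \<open>b \<in> B\<close>] hausdorff_dist_commute by metis
      ultimately show ?thesis using l1_dist_triangle[of c a b] by (intro bexI[of _ a]) auto
    qed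
  qed
  have self: "hausdorff_dist A A = 0" if A: "A \<in> STree_inf" for A
  proof (rule antisym)
    show "hausdorff_dist A A \<le> 0"
      by (rule hausdorff_dist_le[OF A A]) (auto simp: l1_dist_def intro!: bexI)
  qed (rule hausdorff_dist_nonneg)
  show ?thesis
  proof
    show "0 \<le> hausdorff_dist A B" for A B by (rule hausdorff_dist_nonneg)
    show "hausdorff_dist A B = hausdorff_dist B A" for A B by (rule hausdorff_dist_commute)
    show "hausdorff_dist A B = 0 \<longleftrightarrow> A = B" if "A \<in> STree_inf" "B \<in> STree_inf" for A B
      using that self hausdorff_dist_zero_subset hausdorff_dist_commute
      by (metis subset_antisym)
    show "hausdorff_dist A C \<le> hausdorff_dist A B + hausdorff_dist B C"
      if "A \<in> STree_inf" "B \<in> STree_inf" "C \<in> STree_inf" for A B C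
      by (rule tri[OF that])
  qed
qed

end

theory Submission
  imports Defs "HOL-Library.Diagonal_Subsequence"
begin

text \<open>
  Seen through sample points \<open>u\<^sub>1 < \<dots> < u\<^sub>k\<close>, a point \<open>(x, y)\<close> of a continuum tree \<open>K\<close> becomes the
  interval of the sample points between \<open>x\<close> and \<open>y\<close>; it is not seen if \<open>x\<close> or \<open>y\<close> is itself a sample
  point. Which interval is seen depends only on the numbers of sample points below \<open>x\<close> and below \<open>y\<close>,
  hence on the unordered sample. This symmetric form of the sampled tree, \<open>sample_tree\<close>, replaces
  the order statistics (\<open>phi_inf_order_stat\<close>). The theorem rests on the following facts.

  \<^emph>\<open>Continuity.\<close> If \<open>K\<^sub>n\<close> tends to \<open>K\<close>, the trees sampled from \<open>K\<^sub>n\<close> and from \<open>K\<close> at the same points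
  eventually agree, unless a sample point is a coordinate of a point of \<open>K\<close> that cannot be approached within
  \<open>K\<close> from both sides, or two sample points form an off-diagonal point of \<open>K\<close>
  (\<open>eventually_sample_tree_eq\<close>). Only countably many reals are coordinates of the first kind, for any
  planar set; and in a continuum tree only countably many \<open>x\<close> carry more than one point above the
  diagonal, so the off-diagonal part of \<open>K\<close> is null. Uniform samples are therefore almost
  surely good, and the sampling probabilities are continuous in \<open>K\<close>.

  \<^emph>\<open>Compactness.\<close> Every sequence of continuum trees has a Hausdorff convergent subsequence
  (\<open>compact_space_STree_inf\<close>).

  \<^emph>\<open>Finite trees.\<close> A Schroeder tree on \<open>m\<close> points becomes a continuum tree by drawing \<open>[a, b]\<close> at
  \<open>((a - 1) / m, b / m)\<close>. Cut the unit interval into \<open>m\<close> cells. If the sample points fall into the interiors of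
  different cells, sampling from the continuum tree is exactly sampling from the finite tree
  at the occupied cells, and each set of cells is equally likely. As \<open>m\<close> grows the cells are different
  with probability tending to one, so densities and sampling probabilities have the same limits
  (\<open>gamma_density_approx\<close>). With compactness and continuity this turns every convergent sequence
  of densities into the sampling law of some \<open>K\<close>; conversely \<open>K\<close> is a limit of discretised trees
  (\<open>hausdorff_dist_discretise\<close>), so every \<open>K\<close> occurs.

  \<^emph>\<open>Uniqueness.\<close> By the law of large numbers the counts below a point recover its position, so a point of
  \<open>K1\<close> outside \<open>K2\<close> very likely shows in a large sample of \<open>K1\<close> and very likely does not in one of \<open>K2\<close>
  (\<open>sample_prob_determines_subset\<close>).

  \<^emph>\<open>Processes.\<close> Let \<open>T\<^sub>n\<close> be sampled at the first \<open>n\<close> uniforms and let \<open>\<eta>\<^sub>n\<close> be the rank of the uniform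
  with index \<open>n + 1\<close> among the first \<open>n + 1\<close>. Erasing that rank removes this uniform, and exchangeability makes \<open>\<eta>\<^sub>n\<close>
  uniform and independent of the future, which is a symmetric function of the first \<open>n + 1\<close> uniforms
  and of the later ones (\<open>erased_process_tree_at\<close>). The law of any erased process is determined by its
  marginals, because the process is a Markov chain run backwards with a fixed transition rule
  (\<open>process_law_unique\<close>).

  Realising all these processes on the same uniforms, continuity above says that the whole path of trees
  converges almost surely when \<open>K\<^sub>n\<close> tends to \<open>K\<close>; so the law depends continuously on \<open>K\<close>. A continuous bijection from a
  compact space onto a Hausdorff space is a homeomorphism.
\<close>

section \<open>Trees sampled from a planar set\<close>

definition count_below :: "nat \<Rightarrow> (nat \<Rightarrow> real) \<Rightarrow> real \<Rightarrow> nat" where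
  "count_below k x z = card {i \<in> {1..k}. x i < z}"

text \<open>The pair \<open>(a, b)\<close> contributes the interval of the ranks of the sample points between \<open>a\<close> and \<open>b\<close>. If
  there is none the contribution is the empty set, which belongs to every interval system anyway.\<close>

definition sample_tree :: "nat \<Rightarrow> (real \<times> real) set \<Rightarrow> (nat \<Rightarrow> real) \<Rightarrow> nat set set" where
  "sample_tree k K x = insert {} ((\<lambda>j. {j}) ` {1..k}) \<union>
     {{count_below k x a + 1..count_below k x b} |a b.
        (a, b) \<in> K \<and> a \<notin> x ` {1..k} \<and> b \<notin> x ` {1..k}}"

lemma sample_tree_cases [consumes 1, case_names empty single interval]:
  assumes "e \<in> sample_tree k K x"
  obtains "e = {}" | j where "j \<in> {1..k}" "e = {j}"
    | a b where "(a, b) \<in> K" "a \<notin> x ` {1..k}" "b \<notin> x ` {1..k}"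
        "e = {count_below k x a + 1..count_below k x b}"
  using assms unfolding sample_tree_def by blast

text \<open>In a sorted list the entries below \<open>z\<close> form an initial segment.\<close>

lemma sorted_nth_less_iff:
  fixes xs :: "real list"
  assumes "sorted xs" "i < length xs"
  shows "xs ! i < z \<longleftrightarrow> i < length (filter (\<lambda>w. w < z) xs)"
  using assms
proof (induction xs arbitrary: i)
  case (Cons w xs)
  show ?case
  proof (cases "w < z")
    case True
    then show ?thesis using Cons by (cases i) auto
  next
    case False
    then have "filter (\<lambda>w. w < z) xs = []" "\<forall>v\<in>set (w # xs). \<not> v < z"
      using Cons.prems by (auto simp: filter_empty_conv)
    moreover have "(w # xs) ! i \<in> set (w # xs)" using Cons.prems by (intro nth_mem)
    ultimately have "\<not> (w # xs) ! i < z" "filter (\<lambda>w. w < z) (w # xs) = []"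
      using False by (blast, simp)
    then show ?thesis by simp
  qed
qed simp

lemma count_below_sort:
  "count_below k x z = length (filter (\<lambda>w. w < z) (sort (map x [1..<k + 1])))"
proof -
  have "length (filter (\<lambda>w. w < z) (sort (map x [1..<k + 1])))
      = length (filter (\<lambda>w. w < z) (map x [1..<k + 1]))"
    by (metis filter_sort length_sort)
  also have "\<dots> = card (set (filter (\<lambda>i. x i < z) [1..<k + 1]))"
    by (subst distinct_card) (auto simp: filter_map comp_def)
  also have "\<dots> = count_below k x z"
    unfolding count_below_def by (rule arg_cong[of _ _ card]) auto
  finally show ?thesis ..
qed

text \<open>The sentinels \<open>-1\<close> and \<open>2\<close> let the gaps before the first and after the last order
  statistic be treated like the others.\<close>

lemma between_order_stats_iff:
  fixes U :: "nat \<Rightarrow> 'w \<Rightarrow> real"  and \<omega> :: "'w"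
  assumes a: "1 \<le> a" "a \<le> k + 1" and z: "-1 < z" "z < 2"
  defines "v \<equiv> with_ends (-1) 2 k (order_stat U k \<omega>)"
  shows "v (a - 1) < z \<and> z < v a \<longleftrightarrow>
    count_below k (\<lambda>i. U i \<omega>) z = a - 1 \<and> z \<notin> (\<lambda>i. U i \<omega>) ` {1..k}"
proof -
  define xs where "xs = sort (map (\<lambda>i. U i \<omega>) [1..<k + 1])"
  define N where "N = count_below k (\<lambda>i. U i \<omega>) z"
  have len: "length xs = k" and srt: "sorted xs" by (simp_all add: xs_def)
  have st: "set xs = (\<lambda>i. U i \<omega>) ` {1..k}" unfolding xs_def by auto
  have NN: "xs ! i < z \<longleftrightarrow> i < N" if "i < k" for i
    using sorted_nth_less_iff[OF srt, of i z] that
    unfolding N_def count_below_sort xs_def by simp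
  have Nk: "N \<le> k" unfolding N_def count_below_sort
    by (metis length_filter_le len xs_def)
  have v: "v i = (if i = 0 then -1 else if i = k + 1 then 2 else xs ! (i - 1))" for i
    unfolding v_def with_ends_def order_stat_def xs_def by simp
  have 1: "v (a - 1) < z \<longleftrightarrow> a - 1 \<le> N"
  proof (cases "a = 1")
    case False
    then have "a - 1 - 1 < k" "a - 1 \<noteq> 0" "a - 1 \<noteq> k + 1" using a by auto
    then show ?thesis using NN[of "a - 1 - 1"] unfolding v by auto
  qed (use z v in auto)
  have 2: "z < v a \<longleftrightarrow> N < a \<and> (a \<le> k \<longrightarrow> xs ! (a - 1) \<noteq> z)"
  proof (cases "a = k + 1")
    case False
    then have "a - 1 < k" using a by auto
    then have "\<not> (xs ! (a - 1) < z) \<longleftrightarrow> N < a" using NN[of "a - 1"] a by auto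
    then show ?thesis using a False unfolding v by auto
  qed (use z v Nk in auto)
  have 3: "z \<in> set xs \<longleftrightarrow> a \<le> k \<and> xs ! (a - 1) = z" if "N = a - 1"
  proof
    assume "z \<in> set xs"
    then obtain i where i: "i < k" "xs ! i = z" using len by (auto simp: in_set_conv_nth)
    then have "a - 1 \<le> i" using NN[of i] that by auto
    then have "xs ! (a - 1) \<le> z" using sorted_nth_mono[OF srt, of "a - 1" i] i len by auto
    moreover have "\<not> xs ! (a - 1) < z" using NN[of "a - 1"] that \<open>a - 1 \<le> i\<close> i by auto
    ultimately show "a \<le> k \<and> xs ! (a - 1) = z" using \<open>a - 1 \<le> i\<close> i a by auto
  next
    assume "a \<le> k \<and> xs ! (a - 1) = z"
    then show "z \<in> set xs" using len a by (metis Suc_le_lessD Suc_pred' le_zero_eq less_numeral_extra(3) nth_mem not_one_le_zero zero_less_iff_neq_zero)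
  qed
  have "v (a - 1) < z \<and> z < v a \<longleftrightarrow> N = a - 1 \<and> (a \<le> k \<longrightarrow> xs ! (a - 1) \<noteq> z)"
    using 1 2 a by linarith
  then show ?thesis using 3 unfolding N_def[symmetric] st[symmetric] by blast
qed

lemma phi_inf_order_stat:
  assumes K: "K \<subseteq> {(x, y). 0 \<le> x \<and> x \<le> y \<and> y \<le> 1}"
  shows "phi_inf k K (order_stat U k \<omega>) = sample_tree k K (\<lambda>i. U i \<omega>)" (is "?L = ?R")
proof -
  define v where "v = with_ends (-1) 2 k (order_stat U k \<omega>)"
  define N where "N = count_below k (\<lambda>i. U i \<omega>)"
  define X where "X = (\<lambda>i. U i \<omega>) ` {1..k}"
  have btw: "v (a - 1) < z \<and> z < v a \<longleftrightarrow> N z = a - 1 \<and> z \<notin> X"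
    if "1 \<le> a" "a \<le> k + 1" "0 \<le> z" "z \<le> 1" for a z
    using between_order_stats_iff[of a k z U \<omega>] that unfolding v_def N_def X_def by simp
  have mono: "v a \<le> v b" if "1 \<le> a" "a \<le> b" "b \<le> k" for a b
    using that unfolding v_def with_ends_def order_stat_def
    by (auto intro!: sorted_nth_mono)
  have Nk: "N z \<le> k" for z unfolding N_def count_below_def
    by (metis (no_types, lifting) card_atLeastAtMost card_mono diff_Suc_1 finite_atLeastAtMost mem_Collect_eq subsetI)
  have L: "?L = {{}} \<union> {{j} |j. j \<in> {1..k}} \<union> {{a..b} |a b. 1 \<le> a \<and> a < b \<and> b \<le> k \<and>
         (\<exists>(x, y)\<in>K. v (a - 1) < x \<and> x < v a \<and> v a \<le> v b \<and> v b < y \<and> y < v (b + 1))}"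
    unfolding phi_inf_def v_def by (simp add: Let_def)
  have R: "?R = insert {} ((\<lambda>j. {j}) ` {1..k}) \<union>
     {{N a + 1..N b} |a b. (a, b) \<in> K \<and> a \<notin> X \<and> b \<notin> X}"
    unfolding sample_tree_def N_def X_def by simp
  show ?thesis
  proof (intro subset_antisym subsetI)
    fix e assume "e \<in> ?L"
    then consider "e \<in> {{}} \<union> {{j} |j. j \<in> {1..k}}"
      | a b x y where "e = {a..b}" "1 \<le> a" "a < b" "b \<le> k" "(x, y) \<in> K"
         "v (a - 1) < x" "x < v a" "v b < y" "y < v (b + 1)"
      unfolding L by blast
    then show "e \<in> ?R"
    proof cases
      case 2
      have xy: "0 \<le> x" "x \<le> 1" "0 \<le> y" "y \<le> 1" using K 2(5) by auto
      have "N x = a - 1" "x \<notin> X" using btw[of a x] 2 xy by auto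
      moreover have "N y = b" "y \<notin> X" using btw[of "b + 1" y] 2 xy by auto
      ultimately have "e = {N x + 1..N y}" using 2 by simp
      then show ?thesis unfolding R using 2(5) \<open>x \<notin> X\<close> \<open>y \<notin> X\<close> by blast
    qed (auto simp: R)
  next
    fix e assume "e \<in> ?R"
    then consider "e \<in> insert {} ((\<lambda>j. {j}) ` {1..k})"
      | a b where "e = {N a + 1..N b}" "(a, b) \<in> K" "a \<notin> X" "b \<notin> X"
      unfolding R by blast
    then show "e \<in> ?L"
    proof cases
      case (2 x y)
      have xy: "0 \<le> x" "x \<le> 1" "0 \<le> y" "y \<le> 1" using K 2(2) by auto
      consider "N y < N x + 1" | "N y = N x + 1" | "N x + 1 < N y" by linarith
      then show ?thesis
      proof cases
        case 3
        have "v (N x + 1 - 1) < x \<and> x < v (N x + 1)" using btw[of "N x + 1" x] xy 2 Nk[of x] by simp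
        moreover have "v (N y) < y \<and> y < v (N y + 1)" using btw[of "N y + 1" y] xy 2 Nk[of y] by simp
        moreover have "v (N x + 1) \<le> v (N y)" using mono 3 Nk[of y] by simp
        ultimately have ex: "\<exists>(p, q)\<in>K. v (N x + 1 - 1) < p \<and> p < v (N x + 1) \<and> v (N x + 1) \<le> v (N y)
            \<and> v (N y) < q \<and> q < v (N y + 1)"
          using 2(2) by blast
        have le: "1 \<le> N x + 1" by simp
        show ?thesis unfolding L \<open>e = _\<close>
          by (rule UnI2, rule CollectI, rule exI[of _ "N x + 1"], rule exI[of _ "N y"],
              intro conjI refl le 3 Nk ex)
      next
        case 2
        then have "e = {N y}" "N y \<in> {1..k}" using \<open>e = _\<close> Nk[of y] by auto
        then show ?thesis unfolding L by blast
      qed (simp add: L 2(1))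
    qed (auto simp: L)
  qed
qed

lemma count_below_mono: "a \<le> b \<Longrightarrow> count_below k x a \<le> count_below k x b"
  unfolding count_below_def by (rule card_mono) auto

lemma count_below_le: "count_below k x z \<le> k"
  unfolding count_below_def
  by (metis (no_types, lifting) card_atLeastAtMost card_mono diff_Suc_1 finite_atLeastAtMost mem_Collect_eq subsetI)

text \<open>Rounding the two coordinates by different monotone functions keeps intervals nested or
  disjoint, provided that right ends are rounded down at least as far as left ends: two points of \<open>K\<close> with
  \<open>x1 < x2 < y1\<close> stay nested by monotonicity, and those with \<open>y1 \<le> x2\<close> stay disjoint because
  \<open>g y1 \<le> f x2\<close>. Random sampling uses \<open>f = g\<close>, a count; discretisation rounds to a grid.\<close>

lemma laminar_image:
  fixes f g :: "real \<Rightarrow> nat"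
  assumes K: "K \<in> STree_inf" and f: "mono f" and g: "mono g" and gf: "\<And>z. g z \<le> f z"
    and "(x1, y1) \<in> K" "(x2, y2) \<in> K"
  shows "{f x1 + 1..g y1} \<inter> {f x2 + 1..g y2}
     \<in> {{f x1 + 1..g y1}, {f x2 + 1..g y2}, {}}"
proof -
  have *: "{f x1 + 1..g y1} \<inter> {f x2 + 1..g y2} \<in> {{f x1 + 1..g y1}, {f x2 + 1..g y2}, {}}"
    if le: "x1 \<le> x2" and m: "(x1, y1) \<in> K" "(x2, y2) \<in> K" for x1 y1 x2 y2
  proof -
    consider "x1 < x2" "x2 < y1" | "y1 \<le> x2" | "x1 = x2" using le by linarith
    then show ?thesis
    proof cases
      case 1
      then have "y2 \<le> y1" using K m unfolding STree_inf_def by blast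
      then show ?thesis using monoD[OF f le] monoD[OF g, of y2 y1] by auto
    next
      case 2
      then have "g y1 \<le> f x2" using monoD[OF g 2] gf[of x2] by simp
      then show ?thesis by auto
    next
      case 3
      then show ?thesis by (cases "g y1 \<le> g y2") auto
    qed
  qed
  show ?thesis
  proof (cases "x1 \<le> x2")
    case False
    then show ?thesis using *[of x2 x1 y2 y1] assms by (auto simp: Int_commute)
  qed (use * assms in blast)
qed

lemma sample_tree_InSy: "sample_tree k K x \<in> InSy k"
proof -
  have "e \<subseteq> {1..k} \<and> (\<exists>a b. e = {a..b})" if "e \<in> sample_tree k K x" for e
  proof -
    from that show ?thesis
    proof (cases rule: sample_tree_cases)
      case empty
      then show ?thesis by (intro conjI exI[of _ 1] exI[of _ 0]) simp_all
    next
      case (single j)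
      then have "e = {j..j}" by simp
      then show ?thesis using single(1) by (metis atLeastAtMost_iff singletonD single(2) subsetI)
    next
      case (interval a b)
      then show ?thesis using count_below_le[of k x b] by force
    qed
  qed
  moreover have "{} \<in> sample_tree k K x" "\<forall>j\<in>{1..k}. {j} \<in> sample_tree k K x"
    unfolding sample_tree_def by auto
  ultimately show ?thesis unfolding InSy_def by blast
qed

lemma sample_tree_STree:
  assumes K: "K \<in> STree_inf" and x: "x ` {1..k} \<subseteq> {0<..<1}"
  shows "sample_tree k K x \<in> STree k"
proof -
  let ?N = "count_below k x"
  have "(0,1) \<in> K" using K by (simp add: STree_inf_def)
  moreover have "{i \<in> {1..k}. x i < 0} = {}" "{i \<in> {1..k}. x i < 1} = {1..k}" using x by force+
  then have "?N 0 = 0" "?N 1 = k" unfolding count_below_def by (simp_all only: card_atLeastAtMost card.empty)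
  moreover have "0 \<notin> x ` {1..k}" "1 \<notin> x ` {1..k}" using x by auto
  ultimately have top: "{1..k} \<in> sample_tree k K x"
    unfolding sample_tree_def by (intro UnI2 CollectI exI[of _ 0] exI[of _ 1]) auto
  have "e \<inter> f \<in> {e, f, {}}" if "e \<in> sample_tree k K x" "f \<in> sample_tree k K x" for e f
  proof -
    from that(1) show ?thesis
    proof (cases rule: sample_tree_cases)
      case 1: (interval x1 y1)
      from that(2) show ?thesis
      proof (cases rule: sample_tree_cases)
        case 2: (interval x2 y2)
        have "mono ?N" by (simp add: mono_def count_below_mono)
        then show ?thesis unfolding 1(4) 2(4) using laminar_image[OF K _ _ _ 1(1) 2(1)] by blast
      qed auto
    qed auto
  qed
  then show ?thesis unfolding STree_def using top sample_tree_InSy by blast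
qed

section \<open>Generic sample points\<close>

text \<open>The sign \<open>s\<close> selects the side from which the first coordinate is approached.\<close>

definition fst_approachable :: "(real \<times> real) set \<Rightarrow> real \<Rightarrow> real \<Rightarrow> bool" where
  "fst_approachable A s x \<longleftrightarrow> (\<forall>y e. (x, y) \<in> A \<longrightarrow> 0 < e \<longrightarrow>
     (\<exists>x' y'. (x', y') \<in> A \<and> 0 < s * (x' - x) \<and> \<bar>x' - x\<bar> < e \<and> \<bar>y' - y\<bar> < e))"

text \<open>Countability in the form used here: each element has a countable code that determines it.\<close>

lemma countable_if_determined:
  assumes T: "countable T" and ex: "\<And>x. x \<in> B \<Longrightarrow> \<exists>t\<in>T. Q t x"
    and uniq: "\<And>t x x'. Q t x \<Longrightarrow> Q t x' \<Longrightarrow> x = x'"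
  shows "countable B"
proof -
  obtain g where g: "\<And>x. x \<in> B \<Longrightarrow> g x \<in> T" "\<And>x. x \<in> B \<Longrightarrow> Q (g x) x"
    using ex by metis
  have "countable (g ` B)" using T g(1) by (auto intro: countable_subset)
  moreover have "inj_on g B" using g(2) uniq by (intro inj_onI) metis
  ultimately show ?thesis by (rule countable_image_inj_on)
qed

text \<open>If \<open>(x, y)\<close> is not approached from the left, some rational box \<open>(p, \<infinity>) \<times> (r, s)\<close> contains it
  and no point of \<open>A\<close> further left. Then \<open>x\<close> is the least first coordinate in that box, hence is determined by
  the three rationals.\<close>

lemma countable_not_approachable_left: "countable {x. \<not> fst_approachable A (-1) x}"
proof -
  define B where "B = {x. \<not> fst_approachable A (-1) x}"
  define Q where "Q p r s x \<longleftrightarrow> p < x \<and> (\<exists>y. (x, y) \<in> A \<and> r < y \<and> y < s)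
     \<and> (\<forall>x' y'. (x', y') \<in> A \<longrightarrow> p < x' \<longrightarrow> x' < x \<longrightarrow> \<not> (r < y' \<and> y' < s))" for p r s x :: real
  have uniq: "x = x'" if "Q p r s x" "Q p r s x'" for p r s x x'
  proof (rule ccontr)
    assume "x \<noteq> x'"
    then consider "x < x'" | "x' < x" by linarith
    then show False
    proof cases
      case 1 then show False using that unfolding Q_def by blast
    next
      case 2 then show False using that unfolding Q_def by blast
    qed
  qed
  have ex: "\<exists>t\<in>\<rat> \<times> \<rat> \<times> \<rat>. Q (fst t) (fst (snd t)) (snd (snd t)) x" if "x \<in> B" for x
  proof -
    obtain y e where ye: "(x, y) \<in> A" "0 < e" and
      iso: "\<not> (\<exists>x' y'. (x', y') \<in> A \<and> 0 < -1 * (x' - x) \<and> \<bar>x' - x\<bar> < e \<and> \<bar>y' - y\<bar> < e)"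
      using \<open>x \<in> B\<close> unfolding B_def fst_approachable_def mem_Collect_eq by blast
    obtain p where p: "p \<in> \<rat>" "x - e < p" "p < x" using Rats_dense_in_real[of "x - e" x] ye by auto
    obtain r where r: "r \<in> \<rat>" "y - e < r" "r < y" using Rats_dense_in_real[of "y - e" y] ye by auto
    obtain s where s: "s \<in> \<rat>" "y < s" "s < y + e" using Rats_dense_in_real[of y "y + e"] ye by auto
    have "Q p r s x" unfolding Q_def
    proof (intro conjI allI impI)
      fix x' y' assume "(x', y') \<in> A" "p < x'" "x' < x"
      moreover have "0 < -1 * (x' - x)" "\<bar>x' - x\<bar> < e" using calculation p by auto
      ultimately have "\<not> \<bar>y' - y\<bar> < e" using iso by blast
      then show "\<not> (r < y' \<and> y' < s)" using r s by linarith
    qed (use p r s ye(1) in auto)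
    then show ?thesis using p r s by (intro bexI[of _ "(p, r, s)"]) auto
  qed
  show ?thesis unfolding B_def[symmetric]
  proof (rule countable_if_determined[where Q = "\<lambda>t. Q (fst t) (fst (snd t)) (snd (snd t))"])
    show "countable (\<rat> \<times> \<rat> \<times> \<rat> :: (real \<times> real \<times> real) set)" by (simp add: countable_rat)
  qed (use ex uniq in auto)
qed

lemma countable_not_approachable_right: "countable {x. \<not> fst_approachable A 1 x}"
proof -
  have "fst_approachable ((\<lambda>(x, y). (- x, y)) ` A) (-1) (- x) = fst_approachable A 1 x" for x
    unfolding fst_approachable_def
    apply (intro all_cong1)
    subgoal for y e
    proof -
      have "(- x, y) \<in> (\<lambda>(x, y). (- x, y)) ` A \<longleftrightarrow> (x, y) \<in> A" by force
      moreover have "(\<exists>x' y'. (x', y') \<in> (\<lambda>(x, y). (- x, y)) ` A \<and> 0 < - 1 * (x' - - x) \<and> \<bar>x' - - x\<bar> < e \<and> \<bar>y' - y\<bar> < e)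
        \<longleftrightarrow> (\<exists>x' y'. (x', y') \<in> A \<and> 0 < 1 * (x' - x) \<and> \<bar>x' - x\<bar> < e \<and> \<bar>y' - y\<bar> < e)" (is "?L \<longleftrightarrow> ?R")
      proof
        assume ?L
        then obtain x' y' where "(x', y') \<in> A" "0 < - 1 * (- x' - - x) \<and> \<bar>- x' - - x\<bar> < e \<and> \<bar>y' - y\<bar> < e" by auto
        then show ?R by (intro exI[of _ x'] exI[of _ y']) (auto simp: abs_minus_commute)
      next
        assume ?R
        then obtain x' y' where "(x', y') \<in> A" "0 < 1 * (x' - x) \<and> \<bar>x' - x\<bar> < e \<and> \<bar>y' - y\<bar> < e" by auto
        then show ?L by (intro exI[of _ "-x'"] exI[of _ y']) (force simp: abs_minus_commute)
      qed
      ultimately show ?thesis by simp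
    qed
    done
  then have "x \<in> uminus ` {x. \<not> fst_approachable ((\<lambda>(x, y). (- x, y)) ` A) (-1) x}"
    if "\<not> fst_approachable A 1 x" for x
    using that by (intro image_eqI[of _ _ "- x"]) simp_all
  then have "{x. \<not> fst_approachable A 1 x}
      \<subseteq> uminus ` {x. \<not> fst_approachable ((\<lambda>(x, y). (- x, y)) ` A) (-1) x}" by blast
  then show ?thesis using countable_not_approachable_left countable_image countable_subset by blast
qed

definition approachable :: "(real \<times> real) set \<Rightarrow> real \<Rightarrow> bool" where
  "approachable A x \<longleftrightarrow> (\<forall>s\<in>{-1, 1}. fst_approachable A s x \<and> fst_approachable (prod.swap ` A) s x)"

lemma countable_not_approachable: "countable {x. \<not> approachable A x}"
proof -
  have "{x. \<not> approachable A x} = {x. \<not> fst_approachable A (-1) x} \<union> {x. \<not> fst_approachable A 1 x}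
     \<union> {x. \<not> fst_approachable (prod.swap ` A) (-1) x} \<union> {x. \<not> fst_approachable (prod.swap ` A) 1 x}"
    unfolding approachable_def by auto
  then show ?thesis
    using countable_not_approachable_left countable_not_approachable_right by (simp add: countable_Un)
qed

lemma approachable_fst:
  assumes "approachable A a" "(a, b) \<in> A" "0 < e" "z \<noteq> a"
  shows "\<exists>a' b'. (a', b') \<in> A \<and> (a' < a \<longleftrightarrow> z < a) \<and> a' \<noteq> a \<and> \<bar>a' - a\<bar> < e \<and> \<bar>b' - b\<bar> < e"
proof -
  define s :: real where "s = (if z < a then -1 else 1)"
  have "fst_approachable A s a" using assms(1) unfolding approachable_def s_def by auto
  then obtain a' b' where "(a', b') \<in> A" "0 < s * (a' - a)" "\<bar>a' - a\<bar> < e" "\<bar>b' - b\<bar> < e"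
    using assms unfolding fst_approachable_def by blast
  then show ?thesis using assms(4) unfolding s_def by (intro exI[of _ a'] exI[of _ b']) (auto split: if_splits)
qed

lemma approachable_snd:
  assumes "approachable A b" "(a, b) \<in> A" "0 < e" "z \<noteq> b"
  shows "\<exists>a' b'. (a', b') \<in> A \<and> (b' < b \<longleftrightarrow> z < b) \<and> b' \<noteq> b \<and> \<bar>a' - a\<bar> < e \<and> \<bar>b' - b\<bar> < e"
proof -
  define s :: real where "s = (if z < b then -1 else 1)"
  have "fst_approachable (prod.swap ` A) s b" using assms(1) unfolding approachable_def s_def by auto
  moreover have "(b, a) \<in> prod.swap ` A" using assms(2) by force
  ultimately obtain b' a' where "(b', a') \<in> prod.swap ` A" "0 < s * (b' - b)" "\<bar>b' - b\<bar> < e" "\<bar>a' - a\<bar> < e"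
    using assms unfolding fst_approachable_def by blast
  moreover then have "(a', b') \<in> A" by auto
  ultimately show ?thesis using assms(4) unfolding s_def by (intro exI[of _ a'] exI[of _ b']) (auto split: if_splits)
qed

text \<open>Let \<open>c\<close> and \<open>q\<close> be rational with \<open>x < c < y1 < q < y2\<close>. A second such \<open>x'\<close> above \<open>x\<close> with the same \<open>c\<close> and
  \<open>q\<close> would satisfy \<open>x < x' < y1\<close>, and the tree condition would push its upper point below
  \<open>y1 < q\<close>. So \<open>(c, q)\<close> determines \<open>x\<close>.\<close>

lemma countable_multivalued:
  assumes K: "K \<in> STree_inf"
  shows "countable {x. \<exists>y1 y2. x < y1 \<and> y1 < y2 \<and> (x, y1) \<in> K \<and> (x, y2) \<in> K}" (is "countable ?B")
proof -
  define Q where "Q c q x \<longleftrightarrow> (\<exists>y1 y2. x < c \<and> c < y1 \<and> y1 < q \<and> q < y2 \<and> (x, y1) \<in> K \<and> (x, y2) \<in> K)" for c q x :: real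
  have *: "\<not> x < x'" if "Q c q x" "Q c q x'" for c q x x'
  proof
    assume lt: "x < x'"
    obtain y1 where y1: "(x, y1) \<in> K" "c < y1" "y1 < q" using \<open>Q c q x\<close> unfolding Q_def by blast
    obtain y2 where y2: "(x', y2) \<in> K" "x' < c" "q < y2" using \<open>Q c q x'\<close> unfolding Q_def by blast
    have "x < x' \<and> x' < y1" using lt y1 y2 by simp
    then have "y2 \<le> y1" using K y1(1) y2(1) unfolding STree_inf_def by blast
    then show False using y1 y2 by simp
  qed
  then have uniq: "x = x'" if "Q c q x" "Q c q x'" for c q x x' using that by (meson linorder_neqE)
  have ex: "\<exists>t\<in>\<rat> \<times> \<rat>. Q (fst t) (snd t) x" if "x \<in> ?B" for x
  proof -
    obtain y1 y2 where y: "x < y1" "y1 < y2" "(x, y1) \<in> K" "(x, y2) \<in> K" using \<open>x \<in> ?B\<close> by blast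
    obtain c where c: "c \<in> \<rat>" "x < c" "c < y1" using Rats_dense_in_real[of x y1] y by auto
    obtain q where q: "q \<in> \<rat>" "y1 < q" "q < y2" using Rats_dense_in_real[of y1 y2] y by auto
    have "Q c q x" unfolding Q_def using y c q by blast
    then show ?thesis using c q by (intro bexI[of _ "(c, q)"]) auto
  qed
  show ?thesis
  proof (rule countable_if_determined[where Q = "\<lambda>t. Q (fst t) (snd t)"])
    show "countable (\<rat> \<times> \<rat> :: (real \<times> real) set)" by (simp add: countable_rat)
  qed (use ex uniq in auto)
qed

text \<open>The samples at which the sampled tree depends continuously on the continuum tree and erasing the
  last point is compatible with sampling.\<close>

definition generic_sample :: "nat \<Rightarrow> (real \<times> real) set \<Rightarrow> (nat \<Rightarrow> real) \<Rightarrow> bool" where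
  "generic_sample k K x \<longleftrightarrow> inj_on x {1..k} \<and> (\<forall>i\<in>{1..k}. 0 < x i \<and> x i < 1 \<and> approachable K (x i))
     \<and> (\<forall>i\<in>{1..k}. \<forall>j\<in>{1..k}. x i < x j \<longrightarrow> (x i, x j) \<notin> K)"

lemma count_below_local:
  obtains e where "0 < e"
    "\<And>z. \<bar>z - a\<bar> < e \<Longrightarrow> z \<noteq> a \<Longrightarrow> z \<notin> x ` {1..k}"
    "\<And>z. \<bar>z - a\<bar> < e \<Longrightarrow> z \<le> a \<Longrightarrow> count_below k x z = count_below k x a"
    "\<And>z. \<bar>z - a\<bar> < e \<Longrightarrow> a < z \<Longrightarrow> count_below k x z = count_below k x a + card {i \<in> {1..k}. x i = a}"
proof -
  obtain e where e: "0 < e" "\<forall>w\<in>x ` {1..k}. w \<noteq> a \<longrightarrow> e \<le> dist a w"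
    using finite_set_avoid[of "x ` {1..k}" a] by auto
  then have far: "x i = a \<or> x i \<le> a - e \<or> a + e \<le> x i" if "i \<in> {1..k}" for i
    using that by (force simp: dist_real_def abs_if split: if_splits)
  show ?thesis
  proof (rule that[OF e(1)])
    fix z assume z: "\<bar>z - a\<bar> < e"
    { assume "z \<noteq> a"
      then show "z \<notin> x ` {1..k}" using far z by (force simp: abs_if split: if_splits) }
    { assume "z \<le> a"
      then have "{i \<in> {1..k}. x i < z} = {i \<in> {1..k}. x i < a}" using far z by (force simp: abs_if split: if_splits)
      then show "count_below k x z = count_below k x a" unfolding count_below_def by (rule arg_cong) }
    { assume "a < z"
      then have "{i \<in> {1..k}. x i < z} = {i \<in> {1..k}. x i < a} \<union> {i \<in> {1..k}. x i = a}"
        using far z by (force simp: abs_if split: if_splits)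
      then show "count_below k x z = count_below k x a + card {i \<in> {1..k}. x i = a}"
        unfolding count_below_def by (simp add: card_Un_disjoint disjoint_iff) }
  qed
qed

lemma count_below_locally_constant:
  assumes a: "a \<notin> x ` {1..k}"
  shows "\<exists>e>0. \<forall>z. \<bar>z - a\<bar> < e \<longrightarrow> z \<notin> x ` {1..k} \<and> count_below k x z = count_below k x a"
proof -
  obtain e where e: "0 < e" "\<And>z. \<bar>z - a\<bar> < e \<Longrightarrow> z \<noteq> a \<Longrightarrow> z \<notin> x ` {1..k}"
    "\<And>z. \<bar>z - a\<bar> < e \<Longrightarrow> z \<le> a \<Longrightarrow> count_below k x z = count_below k x a"
    "\<And>z. \<bar>z - a\<bar> < e \<Longrightarrow> a < z \<Longrightarrow> count_below k x z = count_below k x a + card {i \<in> {1..k}. x i = a}"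
    by (rule count_below_local[where a = a and x = x and k = k]) blast
  have c0: "card {i \<in> {1..k}. x i = a} = 0" using a by auto
  have "z \<notin> x ` {1..k} \<and> count_below k x z = count_below k x a" if z: "\<bar>z - a\<bar> < e" for z
  proof
    show "z \<notin> x ` {1..k}" using e(2)[OF z] a by (cases "z = a") blast+
    show "count_below k x z = count_below k x a" using e(3,4)[OF z] c0 by (cases "z \<le> a") auto
  qed
  then show ?thesis using e(1) by blast
qed

text \<open>Convergence of sets in the sense of Painleve and Kuratowski: the limit is reached from within the
  sets, and cluster points lie in the limit. For continuum trees it agrees with Hausdorff convergence.\<close>

definition kuratowski_lim :: "(nat \<Rightarrow> (real \<times> real) set) \<Rightarrow> (real \<times> real) set \<Rightarrow> bool" where
  "kuratowski_lim Kn K \<longleftrightarrow>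
     (\<forall>z\<in>K. \<forall>e>0. \<forall>\<^sub>F n in sequentially. \<exists>w\<in>Kn n. dist w z < e) \<and>
     (\<forall>r w z. strict_mono r \<longrightarrow> (\<forall>n. w n \<in> Kn (r n)) \<longrightarrow> w \<longlonglongrightarrow> z \<longrightarrow> z \<in> K)"

lemma kuratowski_lim_near:
  "kuratowski_lim Kn K \<Longrightarrow> z \<in> K \<Longrightarrow> 0 < e \<Longrightarrow> \<forall>\<^sub>F n in sequentially. \<exists>w\<in>Kn n. dist w z < e"
  unfolding kuratowski_lim_def by blast

lemma kuratowski_lim_closed:
  "kuratowski_lim Kn K \<Longrightarrow> strict_mono r \<Longrightarrow> (\<And>n. w n \<in> Kn (r n)) \<Longrightarrow> w \<longlonglongrightarrow> z \<Longrightarrow> z \<in> K"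
  unfolding kuratowski_lim_def by blast

lemma dist_pair_components:
  fixes a b a' b' :: real
  assumes "dist (a', b') (a, b) < e"
  shows "\<bar>a' - a\<bar> < e" "\<bar>b' - b\<bar> < e"
  using assms dist_fst_le[of "(a', b')" "(a, b)"] dist_snd_le[of "(a', b')" "(a, b)"]
  by (auto simp: dist_real_def)

lemma compact_subsequence:
  fixes f :: "nat \<Rightarrow> 'a :: metric_space"
  assumes "compact S" "\<And>n. f n \<in> S"
  shows "\<exists>l\<in>S. \<exists>s. strict_mono s \<and> (f \<circ> s) \<longlonglongrightarrow> l"
  using seq_compactE[OF compact_imp_seq_compact[OF assms(1)], of f] assms(2) by blast

text \<open>Singletons belong to every sampled tree, so only intervals with at least two elements
  reveal a point of \<open>K\<close>.\<close>

lemma sample_tree_interval_ge2: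
  assumes "e \<in> sample_tree k K x" "e = {\<alpha> + 1..\<beta>}" "\<alpha> + 1 < \<beta>"
  obtains a b where "(a, b) \<in> K" "a \<notin> x ` {1..k}" "b \<notin> x ` {1..k}"
    "count_below k x a = \<alpha>" "count_below k x b = \<beta>"
  using assms(1)
proof (cases rule: sample_tree_cases)
  case (single j)
  then have "{j..j} = {\<alpha> + 1..\<beta>}" using assms(2) by simp
  then show ?thesis using assms(3) by (metis Icc_eq_Icc less_irrefl order.strict_iff_order)
next
  case (interval a b)
  then have "{count_below k x a + 1..count_below k x b} = {\<alpha> + 1..\<beta>}" using assms by simp
  then show ?thesis using that[of a b] interval assms(3) by (auto simp: Icc_eq_Icc)
qed (use assms in auto)

text \<open>A point of \<open>K\<close> that is seen has both coordinates off the sample, and all points close to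
  it are seen as the same interval.\<close>

lemma eventually_sample_tree_superset:
  assumes lim: "kuratowski_lim Kn K" and e: "e \<in> sample_tree k K x"
  shows "\<forall>\<^sub>F n in sequentially. e \<in> sample_tree k (Kn n) x"
  using e
proof (cases rule: sample_tree_cases)
  case (interval a b)
  obtain d1 where d1: "0 < d1"
    "\<And>z. \<bar>z - a\<bar> < d1 \<Longrightarrow> z \<notin> x ` {1..k} \<and> count_below k x z = count_below k x a"
    using count_below_locally_constant[OF interval(2)] by blast
  obtain d2 where d2: "0 < d2"
    "\<And>z. \<bar>z - b\<bar> < d2 \<Longrightarrow> z \<notin> x ` {1..k} \<and> count_below k x z = count_below k x b"
    using count_below_locally_constant[OF interval(3)] by blast
  have "\<forall>\<^sub>F n in sequentially. \<exists>w\<in>Kn n. dist w (a, b) < min d1 d2"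
    using d1(1) d2(1) by (intro kuratowski_lim_near[OF lim interval(1)]) simp
  then show ?thesis
  proof (rule eventually_mono)
    fix n assume "\<exists>w\<in>Kn n. dist w (a, b) < min d1 d2"
    then obtain a' b' where w: "(a', b') \<in> Kn n" "dist (a', b') (a, b) < min d1 d2" by auto
    then have n: "\<bar>a' - a\<bar> < d1" "\<bar>b' - b\<bar> < d2" using dist_pair_components[OF w(2)] by auto
    show "e \<in> sample_tree k (Kn n) x"
      unfolding interval(4) sample_tree_def using w(1) d1(2)[OF n(1)] d2(2)[OF n(2)]
      by (intro UnI2 CollectI exI[of _ a'] exI[of _ b']) simp
  qed
qed (auto simp: sample_tree_def)

text \<open>If the interval were seen in infinitely many \<open>K\<^sub>n\<close>, the points responsible would cluster at a point
  of \<open>K\<close>. That point may have a coordinate in the sample and be invisible itself, but only one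
  coordinate, since no two sample points form a point of \<open>K\<close>; and it can be
  moved within \<open>K\<close> to the side from which the sequence came.\<close>

lemma eventually_sample_tree_subset:
  assumes lim: "kuratowski_lim Kn K" and K: "K \<subseteq> {(x, y). 0 \<le> x \<and> x \<le> y \<and> y \<le> 1}"
    and Kn: "\<And>n. Kn n \<subseteq> {(x, y). 0 \<le> x \<and> x \<le> y \<and> y \<le> 1}"
    and gen: "generic_sample k K x" and e: "e \<notin> sample_tree k K x"
  shows "\<forall>\<^sub>F n in sequentially. e \<notin> sample_tree k (Kn n) x"
proof (rule ccontr)
  let ?N = "count_below k x" and ?X = "x ` {1..k}"
  assume "\<not> ?thesis"
  from not_eventually_sequentiallyD[OF this]
  obtain r :: "nat \<Rightarrow> nat" where r: "strict_mono r" "\<forall>n. e \<in> sample_tree k (Kn (r n)) x" by auto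
  have ne: "e \<noteq> {}" "\<And>j. j \<in> {1..k} \<Longrightarrow> e \<noteq> {j}" using e unfolding sample_tree_def by auto
  have "\<exists>a b. (a, b) \<in> Kn (r n) \<and> a \<notin> ?X \<and> b \<notin> ?X \<and> e = {?N a + 1..?N b}" for n
    using r(2)[rule_format, of n] by (cases rule: sample_tree_cases) (use ne in blast)+
  then obtain a b where ab: "\<And>n. (a n, b n) \<in> Kn (r n)" "\<And>n. a n \<notin> ?X" "\<And>n. b n \<notin> ?X"
    "\<And>n. e = {?N (a n) + 1..?N (b n)}" by metis
  define \<alpha> \<beta> where "\<alpha> = ?N (a 0)" and "\<beta> = ?N (b 0)"
  have e_eq: "e = {\<alpha> + 1..\<beta>}" using ab(4)[of 0] by (simp add: \<alpha>_def \<beta>_def)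
  have gap: "\<alpha> + 1 < \<beta>"
  proof (rule ccontr)
    assume "\<not> ?thesis"
    then consider "\<beta> < \<alpha> + 1" | "\<beta> = \<alpha> + 1" by linarith
    then show False
      using e_eq ne ne(2)[of \<beta>] count_below_le[of k x "b 0"] unfolding \<beta>_def[symmetric] by cases auto
  qed
  have N: "?N (a n) = \<alpha>" "?N (b n) = \<beta>" for n
  proof -
    have "{?N (a n) + 1..?N (b n)} = {\<alpha> + 1..\<beta>}" using ab(4) e_eq by metis
    then show "?N (a n) = \<alpha>" "?N (b n) = \<beta>" using gap by (auto simp: Icc_eq_Icc)
  qed
  have "(a n, b n) \<in> cbox (0,0) (1,1)" for n using ab(1)[of n] Kn[of "r n"] by (auto simp: cbox_Pair_eq)
  from compact_subsequence[of "cbox (0, 0) (1, 1)" "\<lambda>n. (a n, b n)", OF compact_cbox this]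
  obtain l s where l: "strict_mono s" "((\<lambda>n. (a n, b n)) \<circ> s) \<longlonglongrightarrow> l" by blast
  obtain a0 b0 where l_eq: "l = (a0, b0)" by force
  have "l \<in> K"
  proof -
    have "strict_mono (r \<circ> s)" using r(1) l(1) by (rule strict_mono_o)
    moreover have "\<forall>n. ((\<lambda>n. (a n, b n)) \<circ> s) n \<in> Kn ((r \<circ> s) n)" using ab(1) by simp
    ultimately show ?thesis using kuratowski_lim_closed[OF lim _ _ l(2)] by blast
  qed
  then have inK: "(a0, b0) \<in> K" by (simp add: l_eq)
  obtain d1 where d1: "0 < d1" "\<And>z. \<bar>z - a0\<bar> < d1 \<Longrightarrow> z \<noteq> a0 \<Longrightarrow> z \<notin> x ` {1..k}"
    "\<And>z. \<bar>z - a0\<bar> < d1 \<Longrightarrow> z \<le> a0 \<Longrightarrow> ?N z = ?N a0"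
    "\<And>z. \<bar>z - a0\<bar> < d1 \<Longrightarrow> a0 < z \<Longrightarrow> ?N z = ?N a0 + card {i \<in> {1..k}. x i = a0}"
    by (rule count_below_local[where a = a0 and x = x and k = k]) blast
  obtain d2 where d2: "0 < d2" "\<And>z. \<bar>z - b0\<bar> < d2 \<Longrightarrow> z \<noteq> b0 \<Longrightarrow> z \<notin> x ` {1..k}"
    "\<And>z. \<bar>z - b0\<bar> < d2 \<Longrightarrow> z \<le> b0 \<Longrightarrow> ?N z = ?N b0"
    "\<And>z. \<bar>z - b0\<bar> < d2 \<Longrightarrow> b0 < z \<Longrightarrow> ?N z = ?N b0 + card {i \<in> {1..k}. x i = b0}"
    by (rule count_below_local[where a = b0 and x = x and k = k]) blast
  have mult: "card {i \<in> {1..k}. x i = c} \<le> 1" for c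
  proof -
    have "inj_on x {1..k}" using gen unfolding generic_sample_def by simp
    then have "\<forall>i\<in>{i \<in> {1..k}. x i = c}. \<forall>j\<in>{i \<in> {1..k}. x i = c}. i = j"
      by (metis (mono_tags, lifting) inj_onD mem_Collect_eq)
    then show ?thesis using card_le_Suc0_iff_eq[of "{i \<in> {1..k}. x i = c}"] by simp
  qed
  have "\<forall>\<^sub>F n in sequentially. dist (((\<lambda>n. (a n, b n)) \<circ> s) n) l < min d1 d2"
    using tendstoD[OF l(2), of "min d1 d2"] d1(1) d2(1) by simp
  from eventually_happens'[OF sequentially_bot this]
  obtain n0 where "dist (((\<lambda>n. (a n, b n)) \<circ> s) n0) l < min d1 d2" by blast
  define a1 b1 where "a1 = a (s n0)" and "b1 = b (s n0)"
  have "dist (a1, b1) (a0, b0) < min d1 d2"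
    using \<open>dist _ l < min d1 d2\<close> by (simp add: a1_def b1_def l_eq)
  from dist_pair_components[OF this] have near: "\<bar>a1 - a0\<bar> < d1" "\<bar>b1 - b0\<bar> < d2" by auto
  have a1: "a1 \<notin> ?X" "?N a1 = \<alpha>" and b1: "b1 \<notin> ?X" "?N b1 = \<beta>"
    using ab N by (auto simp: a1_def b1_def)
  \<comment> \<open>The interval has at least two elements, but at a point \<open>a0 = b0\<close> the count jumps by at most one.\<close>
  have lt: "a0 < b0"
  proof (rule ccontr)
    assume "\<not> a0 < b0"
    then have eq: "a0 = b0" using inK K by auto
    have "\<beta> \<le> ?N b0 + 1" using d2(3,4)[OF near(2)] b1(2) mult[of b0] by (cases "b1 \<le> b0") auto
    moreover have "?N a0 \<le> \<alpha>" using d1(3,4)[OF near(1)] a1(2) by (cases "a1 \<le> a0") auto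
    ultimately show False using eq gap by simp
  qed
  \<comment> \<open>\<open>a1\<close> and \<open>b1\<close> avoid the sample points; any other point close to the limit and on the same
    side of it has the same count, so a point of \<open>K\<close> on the right side may replace the limit.\<close>
  have sideA: "?N z = \<alpha>" if "\<bar>z - a0\<bar> < d1" "z < a0 \<longleftrightarrow> a1 < a0" "z \<noteq> a0" "a1 \<noteq> a0" for z
    using that d1(3,4)[OF near(1)] d1(3,4)[OF that(1)] a1(2) by (cases "a1 < a0") auto
  have sideB: "?N z = \<beta>" if "\<bar>z - b0\<bar> < d2" "z < b0 \<longleftrightarrow> b1 < b0" "z \<noteq> b0" "b1 \<noteq> b0" for z
    using that d2(3,4)[OF near(2)] d2(3,4)[OF that(1)] b1(2) by (cases "b1 < b0") auto
  have constA: "?N z = \<alpha> \<and> z \<notin> ?X" if "\<bar>z - a0\<bar> < d1" "a0 \<notin> ?X" for z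
  proof -
    have "card {i \<in> {1..k}. x i = a0} = 0" using that by auto
    then have "?N w = ?N a0" if "\<bar>w - a0\<bar> < d1" for w using d1(3,4)[OF that] by (cases "w \<le> a0") auto
    then show ?thesis using a1(2) near(1) d1(2) that by metis
  qed
  have constB: "?N z = \<beta> \<and> z \<notin> ?X" if "\<bar>z - b0\<bar> < d2" "b0 \<notin> ?X" for z
  proof -
    have "card {i \<in> {1..k}. x i = b0} = 0" using that by auto
    then have "?N w = ?N b0" if "\<bar>w - b0\<bar> < d2" for w using d2(3,4)[OF that] by (cases "w \<le> b0") auto
    then show ?thesis using b1(2) near(2) d2(2) that by metis
  qed
  have "\<exists>a b. (a, b) \<in> K \<and> a \<notin> ?X \<and> b \<notin> ?X \<and> ?N a = \<alpha> \<and> ?N b = \<beta>"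
  proof -
    consider "a0 \<notin> ?X" "b0 \<notin> ?X" | "a0 \<in> ?X" "b0 \<notin> ?X" | "a0 \<notin> ?X" "b0 \<in> ?X"
      using gen lt inK unfolding generic_sample_def by blast
    then show ?thesis
    proof cases
      case 1
      then show ?thesis using inK constA[of a0] constB[of b0] d1(1) d2(1) by auto
    next
      case 2
      then have "approachable K a0" "a1 \<noteq> a0" using gen a1(1) unfolding generic_sample_def by auto
      then obtain a' b' where "(a', b') \<in> K" "a' < a0 \<longleftrightarrow> a1 < a0" "a' \<noteq> a0"
        "\<bar>a' - a0\<bar> < min d1 d2" "\<bar>b' - b0\<bar> < min d1 d2"
        using approachable_fst[OF _ inK, of "min d1 d2" a1] d1(1) d2(1) by (metis min_less_iff_conj)
      then show ?thesis using sideA[of a'] constB[of b'] d1(2)[of a'] 2 \<open>a1 \<noteq> a0\<close> by auto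
    next
      case 3
      then have "approachable K b0" "b1 \<noteq> b0" using gen b1(1) unfolding generic_sample_def by auto
      then obtain a' b' where "(a', b') \<in> K" "b' < b0 \<longleftrightarrow> b1 < b0" "b' \<noteq> b0"
        "\<bar>a' - a0\<bar> < min d1 d2" "\<bar>b' - b0\<bar> < min d1 d2"
        using approachable_snd[OF _ inK, of "min d1 d2" b1] d1(1) d2(1) by (metis min_less_iff_conj)
      then show ?thesis using sideB[of b'] constA[of a'] d2(2)[of b'] 3 \<open>b1 \<noteq> b0\<close> by auto
    qed
  qed
  then have "e \<in> sample_tree k K x" unfolding sample_tree_def e_eq by fast
  then show False using \<open>e \<notin> sample_tree k K x\<close> by simp
qed

lemma eventually_sample_tree_eq:
  assumes lim: "kuratowski_lim Kn K" and K: "K \<subseteq> {(x, y). 0 \<le> x \<and> x \<le> y \<and> y \<le> 1}"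
    and Kn: "\<And>n. Kn n \<subseteq> {(x, y). 0 \<le> x \<and> x \<le> y \<and> y \<le> 1}"
    and gen: "generic_sample k K x"
  shows "\<forall>\<^sub>F n in sequentially. sample_tree k (Kn n) x = sample_tree k K x"
proof -
  have "\<forall>\<^sub>F n in sequentially. \<forall>e\<in>Pow {1..k}. e \<in> sample_tree k (Kn n) x \<longleftrightarrow> e \<in> sample_tree k K x"
  proof (rule eventually_ball_finite)
    show "\<forall>e\<in>Pow {1..k}. \<forall>\<^sub>F n in sequentially. e \<in> sample_tree k (Kn n) x \<longleftrightarrow> e \<in> sample_tree k K x"
    proof
      fix e :: "nat set"
      show "\<forall>\<^sub>F n in sequentially. e \<in> sample_tree k (Kn n) x \<longleftrightarrow> e \<in> sample_tree k K x"
      proof (cases "e \<in> sample_tree k K x")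
        case True
        show ?thesis using eventually_sample_tree_superset[OF lim True] by (rule eventually_mono) (simp add: True)
      next
        case False
        show ?thesis using eventually_sample_tree_subset[OF lim K Kn gen False] by (rule eventually_mono) (simp add: False)
      qed
    qed
  qed simp
  moreover have "sample_tree k L x \<subseteq> Pow {1..k}" for L
    using sample_tree_InSy[of k L x] unfolding InSy_def by simp
  ultimately show ?thesis by (elim eventually_mono) blast
qed

definition rank_last :: "nat \<Rightarrow> (nat \<Rightarrow> real) \<Rightarrow> nat" where
  "rank_last n x = card {i \<in> {1..n + 1}. x i \<le> x (n + 1)}"

text \<open>Deleting the sample point \<open>x (n + 1)\<close> shifts exactly the counts at points above it. A point of \<open>K\<close>
  which only the smaller sample sees has \<open>x (n + 1)\<close> as a coordinate; approachability gives a nearby point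
  that both samples see.\<close>

lemma erase_sample_tree:
  assumes K: "K \<subseteq> {(x, y). 0 \<le> x \<and> x \<le> y \<and> y \<le> 1}"
    and inj: "inj_on x {1..n + 1}" and app: "approachable K (x (n + 1))"
  shows "sample_tree n K x = erase (sample_tree (n + 1) K x) (rank_last n x)"
proof -
  let ?X = "x ` {1..n}" and ?N = "count_below n x" and ?u = "x (n + 1)" and ?r = "rank_last n x"
  let ?X' = "x ` {1..n + 1}" and ?N' = "count_below (n + 1) x"
  have Ico: "{1..n + 1} = insert (n + 1) {1..n}" by auto
  have X': "?X' = insert ?u ?X" unfolding Ico by simp
  have u: "?u \<notin> ?X" using inj unfolding Ico by (auto simp: inj_on_def)
  have N': "?N' z = ?N z + (if ?u < z then 1 else 0)" for z
  proof (cases "?u < z")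
    case True
    then have "{i \<in> {1..n + 1}. x i < z} = insert (n + 1) {i \<in> {1..n}. x i < z}" unfolding Ico by auto
    then show ?thesis using True unfolding count_below_def by simp
  next
    case False
    then have "{i \<in> {1..n + 1}. x i < z} = {i \<in> {1..n}. x i < z}" unfolding Ico by auto
    then show ?thesis using False unfolding count_below_def by simp
  qed
  have r: "?r = ?N ?u + 1"
  proof -
    have "{i \<in> {1..n + 1}. x i \<le> ?u} = insert (n + 1) {i \<in> {1..n}. x i < ?u}"
      unfolding Ico using u by (auto simp: less_le) (metis image_eqI atLeastAtMost_iff One_nat_def)
    then show ?thesis unfolding rank_last_def count_below_def by simp
  qed
  have cmp: "?u < z \<longleftrightarrow> ?r \<le> ?N' z" if "z \<noteq> ?u" for z
  proof (cases "?u < z")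
    case True
    then have "?N ?u \<le> ?N z" by (intro count_below_mono) simp
    then show ?thesis using True r N'[of z] by simp
  next
    case False
    then have "?N z \<le> ?N ?u" by (intro count_below_mono) simp
    then show ?thesis using False r N'[of z] by simp
  qed
  have rem: "interval_remove (?N' a + 1) (?N' b) ?r = {?N a + 1..?N b}"
    if "a \<noteq> ?u" "b \<noteq> ?u" "a \<le> b" for a b
    using cmp[OF that(1)] cmp[OF that(2)] N'[of a] N'[of b] that(3) unfolding interval_remove_def
    by (cases "?u < a"; cases "?u < b") auto
  have single: "interval_remove j j ?r \<in> sample_tree n K x" if "j \<in> {1..n + 1}" for j
  proof -
    have "?r \<in> {1..n + 1}" using r count_below_le[of n x ?u] by simp
    then have "interval_remove j j ?r = {} \<or> (\<exists>i\<in>{1..n}. interval_remove j j ?r = {i})"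
      using that unfolding interval_remove_def by (cases j ?r rule: linorder_cases) auto
    then show ?thesis unfolding sample_tree_def by auto
  qed
  have single_ex: "\<exists>i\<in>{1..n + 1}. interval_remove i i ?r = {j}" if "j \<in> {1..n}" for j
    using that unfolding interval_remove_def
    by (intro bexI[of _ "if j < ?r then j else j + 1"]) auto
  show ?thesis
  proof (intro subset_antisym subsetI)
    fix e assume "e \<in> sample_tree n K x"
    then show "e \<in> erase (sample_tree (n + 1) K x) ?r"
    proof (cases rule: sample_tree_cases)
      case (single j)
      then obtain i where i: "i \<in> {1..n + 1}" "interval_remove i i ?r = {j}" using single_ex by blast
      then have "{i..i} \<in> sample_tree (n + 1) K x" unfolding sample_tree_def by auto
      then show ?thesis unfolding erase_def single(2) i(2)[symmetric] using i(1) by fastforce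
    next
      case (interval a b)
      show ?thesis
      proof (cases "?N a + 1 \<le> ?N b")
        case False
        then show ?thesis unfolding interval erase_def by simp
      next
        case True
        have lt: "a < b"
          using True count_below_mono[of b a n x] by (cases "a < b") auto
        have "\<exists>a' b'. (a', b') \<in> K \<and> a' \<notin> ?X' \<and> b' \<notin> ?X' \<and> ?N a' = ?N a \<and> ?N b' = ?N b"
        proof (cases "a = ?u \<or> b = ?u")
          case False
          then show ?thesis using interval unfolding X' by auto
        next
          case True
          obtain d1 where d1: "0 < d1" "\<And>z. \<bar>z - a\<bar> < d1 \<Longrightarrow> z \<notin> ?X \<and> ?N z = ?N a"
            using count_below_locally_constant[OF interval(2)] by blast
          obtain d2 where d2: "0 < d2" "\<And>z. \<bar>z - b\<bar> < d2 \<Longrightarrow> z \<notin> ?X \<and> ?N z = ?N b"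
            using count_below_locally_constant[OF interval(3)] by blast
          define d where "d = min (min d1 d2) (b - a)"
          have d: "0 < d" using d1(1) d2(1) lt by (simp add: d_def)
          have "\<exists>a' b'. (a', b') \<in> K \<and> \<bar>a' - a\<bar> < d \<and> \<bar>b' - b\<bar> < d \<and> a' \<noteq> ?u \<and> b' \<noteq> ?u"
          proof (cases "a = ?u")
            case True
            have "approachable K a" using app True by simp
            from approachable_fst[OF this interval(1) d, of "a - 1"] lt
            obtain a' b' where n: "(a', b') \<in> K" "a' \<noteq> a" "\<bar>a' - a\<bar> < d" "\<bar>b' - b\<bar> < d" by auto
            have "\<bar>b' - b\<bar> < b - a" using n(4) by (simp add: d_def)
            then have "b' \<noteq> ?u" using True by auto
            then show ?thesis using n True by blast
          next
            case False
            then have bu: "b = ?u" using True by simp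
            have "approachable K b" using app bu by simp
            from approachable_snd[OF this interval(1) d, of "b - 1"] lt
            obtain a' b' where n: "(a', b') \<in> K" "b' \<noteq> b" "\<bar>a' - a\<bar> < d" "\<bar>b' - b\<bar> < d" by auto
            have "\<bar>a' - a\<bar> < b - a" using n(3) by (simp add: d_def)
            then have "a' \<noteq> ?u" using bu by auto
            then show ?thesis using n bu by blast
          qed
          then obtain a' b' where n: "(a', b') \<in> K" "\<bar>a' - a\<bar> < d" "\<bar>b' - b\<bar> < d" "a' \<noteq> ?u" "b' \<noteq> ?u" by blast
          then have n': "\<bar>a' - a\<bar> < d1" "\<bar>b' - b\<bar> < d2" unfolding d_def by auto
          show ?thesis unfolding X' using n d1(2)[OF n'(1)] d2(2)[OF n'(2)] by auto
        qed
        then obtain a' b' where ab: "(a', b') \<in> K" "a' \<notin> ?X'" "b' \<notin> ?X'" "?N a' = ?N a" "?N b' = ?N b" by blast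
        have "a' \<le> b'" using ab(1) K by auto
        then have eq: "interval_remove (?N' a' + 1) (?N' b') ?r = e"
          using rem[of a' b'] ab interval(4) unfolding X' by auto
        have "{?N' a' + 1..?N' b'} \<in> sample_tree (n + 1) K x"
          unfolding sample_tree_def using ab by blast
        moreover have "?N' a' + 1 \<le> ?N' b'" using True ab(4,5) N' \<open>a' \<le> b'\<close> by auto
        ultimately have "interval_remove (?N' a' + 1) (?N' b') ?r \<in> erase (sample_tree (n + 1) K x) ?r"
          unfolding erase_def by (intro UnI1 CollectI exI[of _ "?N' a' + 1"] exI[of _ "?N' b'"]) simp
        then show ?thesis using eq by simp
      qed
    qed (simp add: erase_def)
  next
    fix e assume "e \<in> erase (sample_tree (n + 1) K x) ?r"
    then consider "e = {}" | a b where "e = interval_remove a b ?r" "1 \<le> a" "a \<le> b" "{a..b} \<in> sample_tree (n + 1) K x"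
      unfolding erase_def by blast
    then show "e \<in> sample_tree n K x"
    proof cases
      case (2 a b)
      from 2(4) show ?thesis
      proof (cases rule: sample_tree_cases)
        case (single j)
        then have "{a..b} = {j..j}" by simp
        then have "a = j" "b = j" using 2(3) by (auto simp: Icc_eq_Icc)
        then show ?thesis using single(1) single 2(1) \<open>\<And>j. j \<in> {1..n + 1} \<Longrightarrow> _\<close> by blast
      next
        case (interval a' b')
        then have "a = ?N' a' + 1" "b = ?N' b'" using 2(3) by (auto simp: Icc_eq_Icc)
        moreover have "a' \<le> b'" using interval(1) K by auto
        ultimately have "e = {?N a' + 1..?N b'}" using rem[of a' b'] 2(1) interval unfolding X' by auto
        then show ?thesis unfolding sample_tree_def using interval X' by blast
      qed (use 2 in auto)
    qed (simp add: sample_tree_def)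
  qed
qed

section \<open>Hausdorff limits of continuum trees\<close>

interpretation continuum_trees: Metric_space STree_inf hausdorff_dist
  by (rule Metric_space_STree_inf)

lemma dist_le_l1_dist: "dist p q \<le> l1_dist p q"
  unfolding dist_prod_def l1_dist_def dist_real_def by (rule sqrt_sum_squares_le_sum_abs[of "fst p - fst q" "snd p - snd q", simplified] | simp)+

lemma l1_dist_le_dist: "l1_dist p q \<le> 2 * dist p q"
  using dist_fst_le[of p q] dist_snd_le[of p q] unfolding l1_dist_def dist_real_def by linarith

lemma STree_inf_subset: "K \<in> STree_inf \<Longrightarrow> K \<subseteq> {(x, y). 0 \<le> x \<and> x \<le> y \<and> y \<le> 1}"
  by (simp add: STree_inf_def)

lemma STree_inf_subset_cbox: "K \<in> STree_inf \<Longrightarrow> K \<subseteq> cbox (0, 0) (1, 1)"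
  using STree_inf_subset[of K] by (auto simp: cbox_Pair_eq)

lemma limitin_imp_kuratowski_lim:
  assumes Kn: "\<And>n. Kn n \<in> STree_inf"
    and lim: "limitin continuum_trees.mtopology Kn K sequentially"
  shows "kuratowski_lim Kn K"
proof -
  have K: "K \<in> STree_inf" using lim by (rule continuum_trees.limitin_mspace)
  have ev: "\<forall>\<^sub>F n in sequentially. hausdorff_dist (Kn n) K < e" if "0 < e" for e
    using lim that unfolding continuum_trees.limitin_metric by (auto elim: eventually_mono)
  show ?thesis unfolding kuratowski_lim_def
  proof (intro conjI ballI allI impI)
    fix z e assume z: "z \<in> K" "0 < (e :: real)"
    show "\<forall>\<^sub>F n in sequentially. \<exists>w\<in>Kn n. dist w z < e"
      using ev[OF z(2)]
    proof (rule eventually_mono)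
      fix n assume h: "hausdorff_dist (Kn n) K < e"
      obtain w where "w \<in> Kn n" "l1_dist z w \<le> hausdorff_dist K (Kn n)"
        using hausdorff_dist_near[OF K Kn z(1)] by blast
      then show "\<exists>w\<in>Kn n. dist w z < e"
        using h hausdorff_dist_commute dist_le_l1_dist[of z w] dist_commute by (metis le_less_trans)
    qed
  next
    fix r w z assume r: "strict_mono r" and w: "\<forall>n. w n \<in> Kn (r n)" "w \<longlonglongrightarrow> z"
    have "\<exists>p\<in>K. dist p z < e" if "0 < e" for e
    proof -
      have "\<forall>\<^sub>F n in sequentially. hausdorff_dist (Kn (r n)) K < e / 2"
        using eventually_subseq[OF r ev[of "e / 2"]] that by simp
      moreover have "\<forall>\<^sub>F n in sequentially. dist (w n) z < e / 2"
        using w(2) that by (intro tendstoD) auto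
      ultimately have "\<forall>\<^sub>F n in sequentially. hausdorff_dist (Kn (r n)) K < e / 2 \<and> dist (w n) z < e / 2"
        by (rule eventually_conj)
      from eventually_happens'[OF sequentially_bot this]
      obtain n where n: "hausdorff_dist (Kn (r n)) K < e / 2" "dist (w n) z < e / 2" by blast
      obtain p where "p \<in> K" "l1_dist (w n) p \<le> hausdorff_dist (Kn (r n)) K"
        using hausdorff_dist_near[OF Kn K] w(1) by metis
      then have "dist p z < e" using n dist_le_l1_dist[of "w n" p] dist_triangle[of p z "w n"]
        by (simp add: dist_commute)
      then show ?thesis using \<open>p \<in> K\<close> by blast
    qed
    then have "z \<in> closure K" by (simp add: closure_approachable)
    moreover have "closed K" using K by (simp add: STree_inf_def compact_imp_closed)
    ultimately show "z \<in> K" by simp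
  qed
qed

text \<open>Compactness makes both halves of the set convergence uniform.\<close>

lemma kuratowski_lim_imp_limitin:
  assumes Kn: "\<And>n. Kn n \<in> STree_inf" and K: "K \<in> STree_inf" and lim: "kuratowski_lim Kn K"
  shows "limitin continuum_trees.mtopology Kn K sequentially"
proof -
  have low: "\<forall>\<^sub>F n in sequentially. \<forall>z\<in>K. \<exists>w\<in>Kn n. l1_dist z w \<le> e" if e: "0 < e" for e
  proof (rule ccontr)
    assume "\<not> ?thesis"
    from not_eventually_sequentiallyD[OF this] obtain r :: "nat \<Rightarrow> nat" where
      r: "strict_mono r" "\<forall>n. \<exists>z\<in>K. \<forall>w\<in>Kn (r n). e < l1_dist z w" by (auto simp: not_le)
    then obtain z where z: "\<And>n. z n \<in> K" "\<And>n w. w \<in> Kn (r n) \<Longrightarrow> e < l1_dist (z n) w" by metis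
    have "compact K" using K by (simp add: STree_inf_def)
    from compact_subsequence[of K z, OF this z(1)]
    obtain l s where l: "l \<in> K" "strict_mono s" "(z \<circ> s) \<longlonglongrightarrow> l" by blast
    have "\<forall>\<^sub>F n in sequentially. \<exists>w\<in>Kn n. dist w l < e / 4"
      using e by (intro kuratowski_lim_near[OF lim l(1)]) simp
    from eventually_subseq[OF strict_mono_o[OF r(1) l(2)] this]
    have "\<forall>\<^sub>F n in sequentially. (\<exists>w\<in>Kn (r (s n)). dist w l < e / 4) \<and> dist ((z \<circ> s) n) l < e / 4"
      using tendstoD[OF l(3), of "e / 4"] e by (intro eventually_conj) auto
    from eventually_happens'[OF sequentially_bot this]
    obtain n where n: "\<exists>w\<in>Kn (r (s n)). dist w l < e / 4" "dist ((z \<circ> s) n) l < e / 4" by blast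
    then obtain w where w: "w \<in> Kn (r (s n))" "dist w l < e / 4" by blast
    have "dist (z (s n)) w < e / 2" using w(2) n(2) dist_triangle[of "z (s n)" w l] by (simp add: dist_commute)
    then show False using z(2)[OF w(1)] l1_dist_le_dist[of "z (s n)" w] by simp
  qed
  have up: "\<forall>\<^sub>F n in sequentially. \<forall>w\<in>Kn n. \<exists>z\<in>K. l1_dist w z \<le> e" if e: "0 < e" for e
  proof (rule ccontr)
    assume "\<not> ?thesis"
    from not_eventually_sequentiallyD[OF this] obtain r :: "nat \<Rightarrow> nat" where
      r: "strict_mono r" "\<forall>n. \<exists>w\<in>Kn (r n). \<forall>z\<in>K. e < l1_dist w z" by (auto simp: not_le)
    then obtain w where w: "\<And>n. w n \<in> Kn (r n)" "\<And>n z. z \<in> K \<Longrightarrow> e < l1_dist (w n) z" by metis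
    have wn: "w n \<in> cbox (0, 0) (1, 1)" for n using w(1)[of n] STree_inf_subset_cbox[OF Kn] by blast
    from compact_subsequence[of "cbox (0, 0) (1, 1)" w, OF compact_cbox wn]
    obtain l s where l: "strict_mono s" "(w \<circ> s) \<longlonglongrightarrow> l" by blast
    have "l \<in> K"
      using w(1) by (intro kuratowski_lim_closed[OF lim strict_mono_o[OF r(1) l(1)] _ l(2)]) simp
    moreover obtain n where "dist ((w \<circ> s) n) l < e / 2"
      using eventually_happens'[OF sequentially_bot tendstoD[OF l(2), of "e / 2"]] e by auto
    ultimately show False using w(2)[of l "s n"] l1_dist_le_dist[of "w (s n)" l] by simp
  qed
  show ?thesis unfolding continuum_trees.limitin_metric
  proof (intro conjI K allI impI)
    fix e :: real assume "0 < e"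
    then have "0 < e / 2" by simp
    show "\<forall>\<^sub>F n in sequentially. Kn n \<in> STree_inf \<and> hausdorff_dist (Kn n) K < e"
      using low[OF \<open>0 < e / 2\<close>] up[OF \<open>0 < e / 2\<close>]
    proof eventually_elim
      case (elim n)
      then have "hausdorff_dist (Kn n) K \<le> e / 2" by (intro hausdorff_dist_le Kn K) blast+
      then show ?case using \<open>0 < e\<close> Kn by simp
    qed
  qed
qed

text \<open>Pass to a subsequence along which, for each set of a countable base, either eventually all sets meet it
  or eventually none does. The limit consists of the points all of whose basic neighbourhoods are eventually
  met.\<close>

lemma kuratowski_subsequence:
  fixes \<sigma> :: "nat \<Rightarrow> (real \<times> real) set"
  shows "\<exists>K r. strict_mono r \<and> kuratowski_lim (\<sigma> \<circ> r) K \<and> closed K"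
proof -
  obtain B :: "(real \<times> real) set set" where B: "countable B" "topological_basis B"
    using ex_countable_basis by blast
  have Bne: "B \<noteq> {}" using B(2) unfolding topological_basis_def
    by (metis Sup_empty Sup_le_iff UNIV_not_empty open_UNIV subset_empty)
  define b where "b = from_nat_into B"
  have b: "V \<in> B \<Longrightarrow> \<exists>i. V = b i" for V unfolding b_def using from_nat_into_surj[OF B(1)] by metis
  define P where "P n s \<longleftrightarrow> (\<forall>m. \<sigma> (s m) \<inter> b n \<noteq> {}) \<or> (\<forall>m. \<sigma> (s m) \<inter> b n = {})" for n and s :: "nat \<Rightarrow> nat"
  interpret subseqs P
  proof
    fix n and s :: "nat \<Rightarrow> nat" assume s: "strict_mono s"
    define S where "S = {m. \<sigma> (s m) \<inter> b n \<noteq> {}}"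
    consider "infinite S" | "infinite (- S)" by (metis Compl_eq_Diff_UNIV Diff_infinite_finite infinite_UNIV_nat)
    then show "\<exists>r'. strict_mono r' \<and> P n (s \<circ> r')"
    proof cases
      case 1
      then have "P n (s \<circ> enumerate S)" using enumerate_in_set[OF 1] unfolding P_def S_def by auto
      then show ?thesis using strict_mono_enumerate[OF 1] by blast
    next
      case 2
      then have "P n (s \<circ> enumerate (- S))" using enumerate_in_set[OF 2] unfolding P_def S_def by auto
      then show ?thesis using strict_mono_enumerate[OF 2] by blast
    qed
  qed
  define d where "d = diagseq"
  have d: "strict_mono d" unfolding d_def by (rule subseq_diagseq)
  have "P i (d \<circ> ((+) (Suc i)))" for i
    unfolding d_def by (rule diagseq_holds) (auto simp: P_def)
  then have dich: "(\<forall>\<^sub>F m in sequentially. \<sigma> (d m) \<inter> V \<noteq> {}) \<or> (\<forall>\<^sub>F m in sequentially. \<sigma> (d m) \<inter> V = {})"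
    if "V \<in> B" for V
  proof -
    obtain i where i: "V = b i" using b \<open>V \<in> B\<close> by blast
    have tail: "\<exists>j. m = Suc i + j" if "m \<ge> Suc i" for m using that by (rule le_Suc_ex)
    from \<open>P i (d \<circ> ((+) (Suc i)))\<close> show ?thesis unfolding P_def i eventually_sequentially comp_def
      using tail by metis
  qed
  define K where "K = {z. \<forall>V\<in>B. z \<in> V \<longrightarrow> (\<forall>\<^sub>F m in sequentially. \<sigma> (d m) \<inter> V \<noteq> {})}"
  have "closed K"
  proof -
    have "z \<in> K" if z: "z \<in> closure K" for z
      unfolding K_def
    proof (intro CollectI ballI impI)
      fix V assume V: "V \<in> B" "z \<in> V"
      then have "open V" using B(2) topological_basis_open by blast
      then obtain z' where "z' \<in> K" "z' \<in> V" using z V(2) by (metis Int_emptyI IntI disjoint_iff open_Int_closure_eq_empty)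
      then show "\<forall>\<^sub>F m in sequentially. \<sigma> (d m) \<inter> V \<noteq> {}" using V(1) unfolding K_def by blast
    qed
    then show ?thesis using closure_subset_eq[of K] by blast
  qed
  moreover have "kuratowski_lim (\<sigma> \<circ> d) K"
    unfolding kuratowski_lim_def
  proof (intro conjI ballI allI impI)
    fix z and e :: real assume z: "z \<in> K" "0 < e"
    obtain V where V: "V \<in> B" "z \<in> V" "V \<subseteq> ball z e"
      using topological_basisE[OF B(2), of "ball z e" z] z by auto
    have "\<forall>\<^sub>F m in sequentially. \<sigma> (d m) \<inter> V \<noteq> {}" using z(1) V unfolding K_def by blast
    then show "\<forall>\<^sub>F n in sequentially. \<exists>w\<in>(\<sigma> \<circ> d) n. dist w z < e"
    proof (rule eventually_mono)
      fix n assume "\<sigma> (d n) \<inter> V \<noteq> {}"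
      then obtain w where "w \<in> \<sigma> (d n)" "w \<in> V" by blast
      moreover have "dist w z < e" using \<open>w \<in> V\<close> V(3) by (metis dist_commute mem_ball subsetD)
      ultimately show "\<exists>w\<in>(\<sigma> \<circ> d) n. dist w z < e" by auto
    qed
  next
    fix r w z assume r: "strict_mono r" and w: "\<forall>n. w n \<in> (\<sigma> \<circ> d) (r n)" "w \<longlonglongrightarrow> z"
    show "z \<in> K" unfolding K_def
    proof (intro CollectI ballI impI)
      fix V assume V: "V \<in> B" "z \<in> V"
      have "\<not> (\<forall>\<^sub>F m in sequentially. \<sigma> (d m) \<inter> V = {})"
      proof
        assume "\<forall>\<^sub>F m in sequentially. \<sigma> (d m) \<inter> V = {}"
        then have "\<forall>\<^sub>F n in sequentially. \<sigma> (d (r n)) \<inter> V = {}" by (rule eventually_subseq[OF r])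
        moreover have "\<forall>\<^sub>F n in sequentially. w n \<in> V"
          using w(2) V B(2) topological_basis_open by (metis topological_tendstoD)
        ultimately have "\<forall>\<^sub>F n in sequentially. False" by eventually_elim (use w(1) in auto)
        then show False by simp
      qed
      then show "\<forall>\<^sub>F m in sequentially. \<sigma> (d m) \<inter> V \<noteq> {}" using dich[OF V(1)] by blast
    qed
  qed
  ultimately show ?thesis using d by blast
qed

text \<open>The tree condition has strict inequalities in its premise and a weak one in its conclusion, so
  it passes to limits.\<close>

lemma kuratowski_lim_STree_inf:
  assumes Kn: "\<And>n. Kn n \<in> STree_inf" and lim: "kuratowski_lim Kn K" and K: "closed K"
  shows "K \<in> STree_inf"
proof -
  have near: "\<forall>\<^sub>F n in sequentially. \<exists>w\<in>Kn n. dist w z < e" if "z \<in> K" "0 < e" for z and e :: real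
    using kuratowski_lim_near[OF lim that] .
  have const: "z \<in> K" if "\<And>n. z \<in> Kn n" for z
  proof -
    have "strict_mono (id :: nat \<Rightarrow> nat)" by (simp add: strict_mono_id)
    moreover have "(\<lambda>n. z) \<longlonglongrightarrow> z" by simp
    ultimately show ?thesis using that by (intro kuratowski_lim_closed[OF lim]) auto
  qed
  let ?T = "{(x, y). 0 \<le> x \<and> x \<le> y \<and> y \<le> (1 :: real)}"
  have "?T = {p. 0 \<le> fst p} \<inter> {p. fst p \<le> snd p} \<inter> {p. snd p \<le> 1}" by auto
  then have clT: "closed ?T"
    by (simp only:) (intro closed_Int closed_Collect_le continuous_intros)
  have sub: "K \<subseteq> ?T"
  proof
    fix z assume z: "z \<in> K"
    have "\<exists>w\<in>?T. dist w z < e" if "0 < e" for e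
    proof -
      obtain n where "\<exists>w\<in>Kn n. dist w z < e"
        using eventually_happens'[OF sequentially_bot near[OF z \<open>0 < e\<close>]] by blast
      then show ?thesis using STree_inf_subset[OF Kn] by blast
    qed
    then have "z \<in> closure ?T" unfolding closure_approachable by blast
    then show "z \<in> ?T" using clT by simp
  qed
  have "bounded K"
  proof (rule bounded_subset[OF bounded_cbox])
    show "K \<subseteq> cbox (0, 0) (1, 1)" using sub by (auto simp: cbox_Pair_eq)
  qed
  then have "compact K" using K by (simp add: compact_eq_bounded_closed)
  moreover have "(x, x) \<in> K" if "x \<in> {0..1}" for x
    using const Kn that unfolding STree_inf_def by blast
  moreover have "(0, 1) \<in> K" using const Kn unfolding STree_inf_def by blast
  moreover have "y2 \<le> y1" if K12: "(x1, y1) \<in> K" "(x2, y2) \<in> K" and lt: "x1 < x2" "x2 < y1" for x1 y1 x2 y2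
  proof (rule ccontr)
    assume "\<not> y2 \<le> y1"
    define e where "e = min (x2 - x1) (min (y1 - x2) (y2 - y1)) / 2"
    have e: "0 < e" "2 * e \<le> x2 - x1" "2 * e \<le> y1 - x2" "2 * e \<le> y2 - y1"
      using lt \<open>\<not> y2 \<le> y1\<close> unfolding e_def by auto
    have "\<forall>\<^sub>F n in sequentially. (\<exists>w\<in>Kn n. dist w (x1, y1) < e) \<and> (\<exists>w\<in>Kn n. dist w (x2, y2) < e)"
      using near[OF K12(1) e(1)] near[OF K12(2) e(1)] by (rule eventually_conj)
    from eventually_happens'[OF sequentially_bot this] obtain n w1 w2 where
      "w1 \<in> Kn n" "dist w1 (x1, y1) < e" "w2 \<in> Kn n" "dist w2 (x2, y2) < e" by blast
    then obtain p1 q1 p2 q2 where w: "(p1, q1) \<in> Kn n" "dist (p1, q1) (x1, y1) < e"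
        "(p2, q2) \<in> Kn n" "dist (p2, q2) (x2, y2) < e"
      by (metis surj_pair)
    note c = dist_pair_components[OF w(2)] dist_pair_components[OF w(4)]
    have "p1 < p2 \<and> p2 < q1" using c e by linarith
    then have "q2 \<le> q1" using Kn[of n] w(1,3) unfolding STree_inf_def by blast
    then show False using c e by linarith
  qed
  ultimately show ?thesis using sub unfolding STree_inf_def by blast
qed

lemma STree_inf_subsequence:
  fixes \<sigma> :: "nat \<Rightarrow> (real \<times> real) set"
  assumes "\<And>n. \<sigma> n \<in> STree_inf"
  obtains K r where "strict_mono (r :: nat \<Rightarrow> nat)" "K \<in> STree_inf" "kuratowski_lim (\<sigma> \<circ> r) K"
proof -
  obtain K r where K: "strict_mono r" "kuratowski_lim (\<sigma> \<circ> r) K" "closed K"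
    using kuratowski_subsequence[of \<sigma>] by blast
  have "K \<in> STree_inf" by (rule kuratowski_lim_STree_inf[OF _ K(2,3)]) (simp add: assms)
  then show ?thesis using that K(1,2) by blast
qed

lemma compact_space_STree_inf: "compact_space STree_inf_topology"
  unfolding STree_inf_topology_def continuum_trees.compact_space_sequentially
proof (intro allI impI)
  fix \<sigma> :: "nat \<Rightarrow> (real \<times> real) set" assume "range \<sigma> \<subseteq> STree_inf"
  then have \<sigma>: "\<sigma> n \<in> STree_inf" for n by blast
  obtain K r where "strict_mono r" "K \<in> STree_inf" "kuratowski_lim (\<sigma> \<circ> r) K"
    using STree_inf_subsequence[OF \<sigma>] .
  moreover then have "limitin continuum_trees.mtopology (\<sigma> \<circ> r) K sequentially"
    by (intro kuratowski_lim_imp_limitin) (simp_all add: \<sigma>)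
  ultimately show "\<exists>l r. l \<in> STree_inf \<and> strict_mono r \<and>
      limitin continuum_trees.mtopology (\<sigma> \<circ> r) l sequentially" by blast
qed

section \<open>Finite trees as continuum trees\<close>

lemma InSy_interval_bounds:
  assumes "T \<in> InSy m" "{a..b} \<in> T" "a \<le> b"
  shows "1 \<le> a" "b \<le> m"
proof -
  have "{a..b} \<subseteq> {1..m}" using assms unfolding InSy_def by blast
  then show "1 \<le> a" "b \<le> m" using assms(3) by auto
qed

text \<open>The interval \<open>[a, b]\<close> is drawn at the end points of the union of the cells
  \<open>[(i - 1) / m, i / m]\<close> with \<open>a \<le> i \<le> b\<close>.\<close>

definition tree_points :: "nat \<Rightarrow> nat set set \<Rightarrow> (real \<times> real) set" where
  "tree_points m T = (\<lambda>x. (x, x)) ` {0..1} \<union>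
     {((real a - 1) / real m, real b / real m) |a b. 1 \<le> a \<and> a \<le> b \<and> {a..b} \<in> T}"

lemma tree_points_cases [consumes 1, case_names diagonal interval]:
  assumes "(x, y) \<in> tree_points m T"
  obtains "x = y" "0 \<le> x" "x \<le> 1"
    | a b where "1 \<le> a" "a \<le> b" "{a..b} \<in> T" "x = (real a - 1) / real m" "y = real b / real m"
  using assms unfolding tree_points_def by auto

lemma tree_points_STree_inf:
  assumes m: "1 \<le> m" and T: "T \<in> STree m"
  shows "tree_points m T \<in> STree_inf"
proof -
  have I: "T \<in> InSy m" and top: "{1..m} \<in> T" and lam: "\<And>e f. e \<in> T \<Longrightarrow> f \<in> T \<Longrightarrow> e \<inter> f \<in> {e, f, {}}"
    using T unfolding STree_def by auto
  let ?P = "{((real a - 1) / real m, real b / real m) |a b. 1 \<le> a \<and> a \<le> b \<and> {a..b} \<in> T}"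
  have "?P \<subseteq> (\<lambda>(a, b). ((real a - 1) / real m, real b / real m)) ` ({1..m} \<times> {1..m})"
    using InSy_interval_bounds[OF I] by (force intro!: image_eqI)
  then have "finite ?P" by (rule finite_subset) simp
  moreover have "compact ((\<lambda>x :: real. (x, x)) ` {0..1})"
    by (intro compact_continuous_image continuous_intros) simp
  ultimately have "compact (tree_points m T)"
    unfolding tree_points_def by (intro compact_Un[OF _ finite_imp_compact])
  moreover have "tree_points m T \<subseteq> {(x, y). 0 \<le> x \<and> x \<le> y \<and> y \<le> 1}"
  proof clarify
    fix x y assume "(x, y) \<in> tree_points m T"
    then show "0 \<le> x \<and> x \<le> y \<and> y \<le> 1"
    proof (cases rule: tree_points_cases)
      case (interval a b)
      then show ?thesis using InSy_interval_bounds[OF I interval(3,2)] m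
        by (simp add: divide_right_mono)
    qed simp
  qed
  moreover have "(x, x) \<in> tree_points m T" if "x \<in> {0..1}" for x
    using that unfolding tree_points_def by auto
  moreover have "(0, 1) \<in> tree_points m T"
    unfolding tree_points_def using top m by (intro UnI2 CollectI exI[of _ 1] exI[of _ m]) auto
  moreover have "y2 \<le> y1"
    if "(x1, y1) \<in> tree_points m T" "(x2, y2) \<in> tree_points m T" "x1 < x2" "x2 < y1" for x1 y1 x2 y2
    using that(2)
  proof (cases rule: tree_points_cases)
    case 2: (interval c d)
    from that(1) show ?thesis
    proof (cases rule: tree_points_cases)
      case 1: (interval a b)
      have "a < c" using that(3) m 1 2 by (simp add: divide_less_cancel)
      moreover have "real c - 1 < real b" using that(4) m 1 2 by (simp add: divide_less_cancel)
      then have "c \<le> b" by simp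
      ultimately have "c \<in> {a..b} \<inter> {c..d}" "a \<in> {a..b} - {c..d}" using 1 2 by auto
      then have "{a..b} \<inter> {c..d} = {c..d}" using lam[OF 1(3) 2(3)] by blast
      then have "d \<in> {a..b}" using 2(2) by (metis IntD1 atLeastAtMost_iff order_refl)
      then show ?thesis using 1 2 m by (simp add: divide_right_mono)
    qed (use that in auto)
  qed (use that in auto)
  ultimately show ?thesis unfolding STree_inf_def by blast
qed

text \<open>The points \<open>i / (m + 1)\<close> take the role of the sample, except that a coordinate equal to a grid point
  is not discarded: \<open>x\<close> is counted as lying just above it and \<open>y\<close> as lying just below. This keeps
  intervals that only share a grid point disjoint.\<close>

definition discretise :: "nat \<Rightarrow> (real \<times> real) set \<Rightarrow> nat set set" where
  "discretise m K = insert {} ((\<lambda>j. {j}) ` {1..m}) \<union>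
     {{nat \<lfloor>(real m + 1) * x\<rfloor> + 1..nat (\<lceil>(real m + 1) * y\<rceil> - 1)} |x y. (x, y) \<in> K}"

lemma discretise_cases [consumes 1, case_names empty single interval]:
  assumes "e \<in> discretise m K"
  obtains "e = {}" | j where "j \<in> {1..m}" "e = {j}"
    | x y where "(x, y) \<in> K" "e = {nat \<lfloor>(real m + 1) * x\<rfloor> + 1..nat (\<lceil>(real m + 1) * y\<rceil> - 1)}"
  using assms unfolding discretise_def by blast

lemma discretise_STree:
  assumes K: "K \<in> STree_inf" and m: "1 \<le> m"
  shows "discretise m K \<in> STree m"
proof -
  define f where "f x = nat \<lfloor>(real m + 1) * x\<rfloor>" for x
  define g where "g y = nat (\<lceil>(real m + 1) * y\<rceil> - 1)" for y
  have gm: "g y \<le> m" if "y \<le> 1" for y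
  proof -
    have "(real m + 1) * y \<le> real m + 1" using mult_left_mono[OF that, of "real m + 1"] by simp
    then have "\<lceil>(real m + 1) * y\<rceil> \<le> int m + 1" by (simp add: ceiling_le_iff)
    then show ?thesis unfolding g_def by simp
  qed
  have mono_f: "mono f" unfolding f_def
    by (intro monoI nat_mono floor_mono mult_left_mono) auto
  have mono_g: "mono g" unfolding g_def
    by (intro monoI nat_mono diff_right_mono ceiling_mono mult_left_mono) auto
  have gf: "g z \<le> f z" for z unfolding f_def g_def
    by (intro nat_mono) linarith
  have "{1..m} \<in> discretise m K"
  proof -
    have "(0, 1) \<in> K" using K unfolding STree_inf_def by blast
    moreover have "nat \<lfloor>(real m + 1) * 0\<rfloor> = 0" by simp
    moreover have "\<lceil>(real m + 1) * 1\<rceil> = int m + 1" by (simp add: ceiling_eq_iff)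
    ultimately show ?thesis unfolding discretise_def
      by (intro UnI2 CollectI exI[of _ 0] exI[of _ 1]) simp
  qed
  moreover have "discretise m K \<in> InSy m"
  proof -
    have "e \<subseteq> {1..m} \<and> (\<exists>a b. e = {a..b})" if "e \<in> discretise m K" for e
      using that
    proof (cases rule: discretise_cases)
      case empty
      then show ?thesis by (intro conjI exI[of _ 1] exI[of _ 0]) simp_all
    next
      case (single j)
      then show ?thesis by (intro conjI exI[of _ j]) auto
    next
      case (interval x y)
      have "y \<le> 1" using K interval(1) unfolding STree_inf_def by blast
      from gm[OF this] have "e \<subseteq> {1..m}" unfolding interval(2) g_def by auto
      then show ?thesis using interval(2) by blast
    qed
    moreover have "{} \<in> discretise m K" "\<forall>j\<in>{1..m}. {j} \<in> discretise m K"
      unfolding discretise_def by auto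
    ultimately show ?thesis unfolding InSy_def by blast
  qed
  moreover have "e \<inter> e' \<in> {e, e', {}}" if "e \<in> discretise m K" "e' \<in> discretise m K" for e e'
    using that(1)
  proof (cases rule: discretise_cases)
    case 1: (interval x1 y1)
    from that(2) show ?thesis
    proof (cases rule: discretise_cases)
      case 2: (interval x2 y2)
      show ?thesis using laminar_image[OF K mono_f mono_g gf 1(1) 2(1)]
        unfolding 1(2) 2(2) f_def g_def .
    qed auto
  qed auto
  ultimately show ?thesis unfolding STree_def by blast
qed

lemma abs_scaled_diff_le:
  fixes c :: real
  assumes "1 \<le> m" "0 \<le> x" "x \<le> 1" "(real m + 1) * x - 1 \<le> c" "c \<le> (real m + 1) * x"
  shows "\<bar>c / real m - x\<bar> \<le> 1 / real m"
proof -
  have "-1 \<le> c - real m * x \<and> c - real m * x \<le> 1" using assms by (simp add: algebra_simps)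
  then have "\<bar>c - real m * x\<bar> \<le> 1" by linarith
  then have "\<bar>c - real m * x\<bar> / real m \<le> 1 / real m" by (intro divide_right_mono) auto
  also have "\<bar>c - real m * x\<bar> / real m = \<bar>c / real m - x\<bar>"
  proof -
    have "c / real m - x = (c - real m * x) / real m" using assms(1) by (simp add: diff_divide_distrib)
    then show ?thesis by simp
  qed
  finally show ?thesis .
qed

lemma hausdorff_dist_discretise:
  assumes K: "K \<in> STree_inf" and m: "1 \<le> m"
  shows "hausdorff_dist (tree_points m (discretise m K)) K \<le> 2 / real m"
proof (rule hausdorff_dist_le[OF tree_points_STree_inf[OF m discretise_STree[OF K m]] K])
  let ?P = "tree_points m (discretise m K)"
  define f where "f x = nat \<lfloor>(real m + 1) * x\<rfloor>" for x
  define g where "g y = nat (\<lceil>(real m + 1) * y\<rceil> - 1)" for y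
  have f: "(real m + 1) * x - 1 \<le> real (f x) \<and> real (f x) \<le> (real m + 1) * x" if "0 \<le> x" for x
    unfolding f_def using that by (simp add: of_nat_nat)
  have g: "(real m + 1) * y - 1 \<le> real (g y)" for y
    unfolding g_def by linarith
  have g': "real (g y) \<le> (real m + 1) * y" if "0 \<le> y" for y
  proof (cases "\<lceil>(real m + 1) * y\<rceil> \<ge> 1")
    case True
    then show ?thesis unfolding g_def by (simp add: of_nat_nat)
  next
    case False
    then show ?thesis unfolding g_def using that by simp
  qed
  have close: "l1_dist (real (f x) / real m, real (g y) / real m) (x, y) \<le> 2 / real m"
    if "0 \<le> x" "x \<le> y" "y \<le> 1" for x y
  proof -
    have "\<bar>real (f x) / real m - x\<bar> \<le> 1 / real m"
      using abs_scaled_diff_le[OF m, of x "real (f x)"] f[of x] that by simp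
    moreover have "\<bar>real (g y) / real m - y\<bar> \<le> 1 / real m"
      using abs_scaled_diff_le[OF m, of y "real (g y)"] g[of y] g'[of y] that by simp
    ultimately show ?thesis unfolding l1_dist_def by simp
  qed
  have Kb: "0 \<le> x \<and> x \<le> y \<and> y \<le> 1" if "(x, y) \<in> K" for x y
    using K that unfolding STree_inf_def by blast
  have diag: "(x, x) \<in> K \<and> (x, x) \<in> ?P" if "0 \<le> x" "x \<le> 1" for x
    using K that unfolding STree_inf_def tree_points_def by auto
  show "\<exists>q\<in>K. l1_dist p q \<le> 2 / real m" if "p \<in> ?P" for p
  proof -
    obtain x y where p: "p = (x, y)" by force
    from that have "(x, y) \<in> ?P" by (simp add: p)
    then show ?thesis
    proof (cases rule: tree_points_cases)
      case diagonal
      then show ?thesis using diag[of x] p by (intro bexI[of _ "(x, x)"]) (auto simp: l1_dist_def)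
    next
      case (interval a b)
      from interval(3) show ?thesis
      proof (cases rule: discretise_cases)
        case (single j)
        then have "{a..b} = {j..j}" by simp
        then have "a = j" "b = j" using interval(2) by (auto simp: Icc_eq_Icc)
        then have "l1_dist p (y, y) \<le> 2 / real m"
          unfolding p l1_dist_def interval(4,5) using m by (simp add: diff_divide_distrib divide_right_mono)
        moreover have "0 \<le> y \<and> y \<le> 1" using \<open>b = j\<close> single(1) interval(5) m by simp
        ultimately show ?thesis using diag[of y] by blast
      next
        case 2: (interval x' y')
        then have "{a..b} = {f x' + 1..g y'}" by (simp add: f_def g_def)
        then have "a = f x' + 1" "b = g y'" using interval(2) by (auto simp: Icc_eq_Icc)
        then have "l1_dist p (x', y') \<le> 2 / real m"
          using close[of x' y'] Kb[OF 2(1)] unfolding p interval(4,5) by simp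
        then show ?thesis using 2(1) by blast
      qed (use interval(2) in simp)
    qed
  qed
  show "\<exists>p\<in>?P. l1_dist q p \<le> 2 / real m" if "q \<in> K" for q
  proof -
    obtain x y where q: "q = (x, y)" by force
    have xy: "(x, y) \<in> K" "0 \<le> x" "x \<le> y" "y \<le> 1" using that Kb unfolding q by auto
    show ?thesis
    proof (cases "f x + 1 \<le> g y")
      case True
      have "{f x + 1..g y} \<in> discretise m K"
        unfolding discretise_def f_def g_def using xy(1) by blast
      then have "((real (f x + 1) - 1) / real m, real (g y) / real m) \<in> ?P"
        unfolding tree_points_def using True by (intro UnI2 CollectI exI[of _ "f x + 1"] exI[of _ "g y"]) simp
      moreover have "l1_dist q ((real (f x + 1) - 1) / real m, real (g y) / real m) \<le> 2 / real m"
        unfolding q using close[OF xy(2-4)] l1_dist_commute by simp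
      ultimately show ?thesis by blast
    next
      case False
      then have "real (g y) \<le> real (f x)" by simp
      then have "(real m + 1) * (y - x) \<le> 1" using g[of y] f[of x] xy by (simp add: algebra_simps)
      moreover have "real m * (y - x) \<le> (real m + 1) * (y - x)" using xy by (intro mult_right_mono) auto
      ultimately have "y - x \<le> 1 / real m" using m by (simp add: field_simps)
      also have "\<dots> \<le> 2 / real m" by (simp add: divide_right_mono)
      finally have "l1_dist q (x, x) \<le> 2 / real m" using xy unfolding q l1_dist_def by simp
      then show ?thesis using diag[of x] xy by force
    qed
  qed
qed

definition in_cells :: "nat \<Rightarrow> nat \<Rightarrow> (nat \<Rightarrow> nat) \<Rightarrow> (nat \<Rightarrow> real) \<Rightarrow> bool" where
  "in_cells m k f x \<longleftrightarrow> (\<forall>i\<in>{1..k}. (real (f i) - 1) / real m < x i \<and> x i < real (f i) / real m)"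

lemma in_cells_count:
  assumes m: "1 \<le> m" and x: "in_cells m k f x" and f: "inj_on f {1..k}"
  shows "count_below k x (real c / real m) = card {r \<in> f ` {1..k}. r \<le> c}"
    "real c / real m \<notin> x ` {1..k}"
proof -
  have *: "(x i < real c / real m \<longleftrightarrow> f i \<le> c) \<and> x i \<noteq> real c / real m" if "i \<in> {1..k}" for i
  proof -
    have i: "real (f i) - 1 < real m * x i" "real m * x i < real (f i)"
      using x that m unfolding in_cells_def by (auto simp: field_simps)
    have "x i < real c / real m \<longleftrightarrow> real m * x i < real c" "x i = real c / real m \<longleftrightarrow> real m * x i = real c"
      using m by (auto simp: field_simps)
    moreover have "real m * x i < real c \<longleftrightarrow> f i \<le> c" "real m * x i \<noteq> real c"
    proof -
      show "real m * x i < real c \<longleftrightarrow> f i \<le> c"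
      proof
        assume "real m * x i < real c"
        then have "real (f i) < real c + 1" using i by simp
        then show "f i \<le> c" by linarith
      next
        assume "f i \<le> c"
        then show "real m * x i < real c" using i by linarith
      qed
      show "real m * x i \<noteq> real c"
      proof
        assume "real m * x i = real c"
        then have "f i < c + 1" "c < f i" using i by linarith+
        then show False by simp
      qed
    qed
    ultimately show ?thesis by blast
  qed
  have "count_below k x (real c / real m) = card {i \<in> {1..k}. f i \<le> c}"
    unfolding count_below_def by (rule arg_cong[of _ _ card]) (use * in auto)
  also have "\<dots> = card (f ` {i \<in> {1..k}. f i \<le> c})"
    by (rule card_image[symmetric], rule inj_on_subset[OF f]) auto
  also have "f ` {i \<in> {1..k}. f i \<le> c} = {r \<in> f ` {1..k}. r \<le> c}" by auto
  finally show "count_below k x (real c / real m) = card {r \<in> f ` {1..k}. r \<le> c}" .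
  show "real c / real m \<notin> x ` {1..k}" using * by (metis imageE)
qed

text \<open>The tree that \<open>T\<close> induces on the set \<open>A\<close> after relabelling \<open>A\<close> by ranks.\<close>

definition trace_tree :: "nat \<Rightarrow> nat set set \<Rightarrow> nat set \<Rightarrow> nat set set" where
  "trace_tree k T A = insert {} ((\<lambda>j. {j}) ` {1..k}) \<union>
    {{card {r \<in> A. r < a} + 1..card {r \<in> A. r \<le> b}} |a b. 1 \<le> a \<and> a \<le> b \<and> {a..b} \<in> T}"

lemma trace_tree_cases [consumes 1, case_names empty single interval]:
  assumes "e \<in> trace_tree k T A"
  obtains "e = {}" | i where "i \<in> {1..k}" "e = {i}"
    | a b where "1 \<le> a" "a \<le> b" "{a..b} \<in> T"
        "e = {card {r \<in> A. r < a} + 1..card {r \<in> A. r \<le> b}}"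
  using assms unfolding trace_tree_def by blast

text \<open>Sampling one point in each of \<open>k\<close> different cells is the same as selecting these cells,
  because the sample points below \<open>c / m\<close> are exactly those in cells with number at most \<open>c\<close>.\<close>

lemma sample_tree_tree_points:
  assumes m: "1 \<le> m" and x: "in_cells m k f x" and f: "inj_on f {1..k}"
  shows "sample_tree k (tree_points m T) x = trace_tree k T (f ` {1..k})" (is "?L = ?R")
proof -
  have lo: "count_below k x ((real a - 1) / real m) = card {r \<in> f ` {1..k}. r < a} \<and>
      (real a - 1) / real m \<notin> x ` {1..k}" if "1 \<le> a" for a
  proof -
    have "r < a \<longleftrightarrow> r \<le> a - 1" for r using that by auto
    then show ?thesis using in_cells_count[OF m x f, of "a - 1"] that by (simp add: of_nat_diff)
  qed
  show ?thesis
  proof (intro subset_antisym subsetI)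
    fix e assume "e \<in> ?L"
    then show "e \<in> ?R"
    proof (cases rule: sample_tree_cases)
      case 1: (interval x1 y1)
      from 1(1) show ?thesis
      proof (cases rule: tree_points_cases)
        case 2: (interval a b)
        have "e = {card {r \<in> f ` {1..k}. r < a} + 1..card {r \<in> f ` {1..k}. r \<le> b}}"
          using 1(4) lo[OF 2(1)] in_cells_count(1)[OF m x f, of b] unfolding 2(4,5) by simp
        then show ?thesis unfolding trace_tree_def using 2 by blast
      qed (use 1 in \<open>simp add: trace_tree_def\<close>)
    qed (auto simp: trace_tree_def)
  next
    fix e assume "e \<in> ?R"
    then show "e \<in> ?L"
    proof (cases rule: trace_tree_cases)
      case 2: (interval a b)
      then have "((real a - 1) / real m, real b / real m) \<in> tree_points m T"
        unfolding tree_points_def by blast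
      moreover have "e = {count_below k x ((real a - 1) / real m) + 1..count_below k x (real b / real m)}"
        using 2(4) lo[OF 2(1)] in_cells_count(1)[OF m x f, of b] by simp
      ultimately show ?thesis
        unfolding sample_tree_def using lo[OF 2(1)] in_cells_count(2)[OF m x f, of b] by blast
    qed (auto simp: sample_tree_def)
  qed
qed

text \<open>The vector \<open>j\<close> is compared with the sample of cell midpoints, for which the order statistics were
  already translated into counts.\<close>

lemma phi_fin_eq_trace_tree:
  assumes m: "1 \<le> m" and T: "T \<in> STree m" and j: "j \<in> incr_vecs k m"
  shows "phi_fin m k T j = trace_tree k T (j ` {1..k})"
proof -
  have I: "T \<in> InSy m" using T unfolding STree_def by simp
  have jm: "j i \<in> {1..m}" if "i \<in> {1..k}" for i using j that unfolding incr_vecs_def by blast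
  have smon: "strict_mono_on {1..k} j" using j unfolding incr_vecs_def by simp
  have injj: "inj_on j {1..k}" using smon strict_mono_on_imp_inj_on by blast
  define y where "y i = (real (j i) - 1/2) / real m" for i
  define U where "U = (\<lambda>i (_ :: unit). y i)"
  have y_cells: "in_cells m k j y"
    unfolding in_cells_def y_def using m by (auto simp: field_simps)
  have "mono_on {1..k} y"
    unfolding y_def using strict_mono_on_leD[OF smon] m
    by (intro mono_onI divide_right_mono) auto
  then have srt: "sorted (map y [1..<k + 1])"
    by (auto simp: sorted_iff_nth_mono mono_on_def simp del: upt_Suc)
  have os: "order_stat U k () i = y i" if "i \<in> {1..k}" for i
  proof -
    have lt: "i - 1 < (k + 1) - 1" using that by auto
    have "map y [1..<k + 1] ! (i - 1) = y (1 + (i - 1))" by (rule nth_map_upt[OF lt])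
    then show ?thesis
      using that unfolding order_stat_def U_def sorted_sort_id[OF srt] by (simp del: upt_Suc)
  qed
  define v where "v = with_ends (- int m) (2 * int m) k (\<lambda>i. int (j i))"
  define w where "w = with_ends (-1) 2 k (order_stat U k ())"
  have vw: "w i = (if i = 0 then -1 else if i = k + 1 then 2 else (real_of_int (v i) - 1/2) / real m)"
    if "i \<le> k + 1" for i
    using that os[of i] unfolding v_def w_def with_ends_def y_def by auto
  have v0: "v 0 = - int m" "v (k + 1) = 2 * int m" unfolding v_def with_ends_def by auto
  have cmpB: "(v i \<le> int B \<longleftrightarrow> w i < real B / real m) \<and> (int B < v i \<longleftrightarrow> real B / real m < w i)"
    if "i \<le> k + 1" "B \<le> m" for i B
  proof -
    consider "i = 0" | "i = k + 1" | "i \<noteq> 0" "i \<noteq> k + 1" by blast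
    then show ?thesis
    proof cases
      case 1
      then have "w i = -1" using vw[OF that(1)] by simp
      moreover have "-1 < real B / real m" by (rule less_le_trans[of _ 0]) (use that in auto)
      ultimately show ?thesis using 1 v0 that m by (simp add: not_le not_less)
    next
      case 2
      then have "w i = 2" using vw[OF that(1)] by simp
      moreover have "real B / real m < 2" using that m by (simp add: field_simps)
      ultimately show ?thesis using 2 v0 that m by auto
    next
      case 3
      then have w: "w i = (real_of_int (v i) - 1/2) / real m" using vw[OF that(1)] by simp
      show ?thesis unfolding w using m by (simp add: divide_less_cancel) linarith
    qed
  qed
  have cmpA: "(v i < int A \<longleftrightarrow> w i < (real A - 1) / real m) \<and> (int A \<le> v i \<longleftrightarrow> (real A - 1) / real m < w i)"
    if "i \<le> k + 1" "1 \<le> A" "A \<le> m" for i A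
  proof -
    have "A - 1 \<le> m" using that by simp
    from cmpB[OF that(1) this] show ?thesis using that by (auto simp: of_nat_diff)
  qed
  have vmono: "v a \<le> v b" if "1 \<le> a" "a \<le> b" "b \<le> k" for a b
    using strict_mono_on_leD[OF smon, of a b] that unfolding v_def with_ends_def by auto
  have N: "w (a - 1) < z \<and> z < w a \<longleftrightarrow> count_below k y z = a - 1 \<and> z \<notin> y ` {1..k}"
    if "1 \<le> a" "a \<le> k + 1" "0 \<le> z" "z \<le> 1" for a z
    using between_order_stats_iff[of a k z U "()"] that unfolding w_def U_def by simp
  have idx: "(v (a - 1) < int A \<and> int A \<le> v a \<longleftrightarrow> card {r \<in> j ` {1..k}. r < A} = a - 1) \<and>
     (v b \<le> int B \<and> int B < v (b + 1) \<longleftrightarrow> card {r \<in> j ` {1..k}. r \<le> B} = b)"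
    if ab: "1 \<le> a" "a \<le> b" "b \<le> k" and AB: "{A..B} \<in> T" "A \<le> B" for a b A B
  proof -
    have bd: "1 \<le> A" "B \<le> m" using InSy_interval_bounds[OF I AB] by auto
    have "r < A \<longleftrightarrow> r \<le> A - 1" for r using bd by auto
    then have cA: "count_below k y ((real A - 1) / real m) = card {r \<in> j ` {1..k}. r < A}"
        "(real A - 1) / real m \<notin> y ` {1..k}"
      using in_cells_count[OF m y_cells injj, of "A - 1"] bd by (simp_all add: of_nat_diff)
    have cB: "count_below k y (real B / real m) = card {r \<in> j ` {1..k}. r \<le> B}"
        "real B / real m \<notin> y ` {1..k}"
      using in_cells_count[OF m y_cells injj, of B] by simp_all
    have "0 \<le> (real A - 1) / real m" "(real A - 1) / real m \<le> 1" "0 \<le> real B / real m" "real B / real m \<le> 1"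
      using bd AB m by (auto simp: field_simps)
    then have "w (a - 1) < (real A - 1) / real m \<and> (real A - 1) / real m < w a \<longleftrightarrow> card {r \<in> j ` {1..k}. r < A} = a - 1"
      "w b < real B / real m \<and> real B / real m < w (b + 1) \<longleftrightarrow> card {r \<in> j ` {1..k}. r \<le> B} = b"
      using N[of a "(real A - 1) / real m"] N[of "b + 1" "real B / real m"] ab cA cB by auto
    then show ?thesis
      using cmpA[of "a - 1" A] cmpA[of a A] cmpB[of b B] cmpB[of "b + 1" B] ab bd AB by auto
  qed
  have cle: "card {r \<in> j ` {1..k}. P r} \<le> k" for P
  proof -
    have "card {r \<in> j ` {1..k}. P r} \<le> card (j ` {1..k})" by (rule card_mono) auto
    also have "\<dots> \<le> k" using card_image_le[of "{1..k}" j] by simp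
    finally show ?thesis .
  qed
  have phi: "phi_fin m k T j = {{}} \<union> {{a..b} |a b. 1 \<le> a \<and> a \<le> b \<and> b \<le> k \<and>
         (\<exists>A B. {A..B} \<in> T \<and> v (a - 1) < int A \<and> int A \<le> v a \<and> v a \<le> v b
                \<and> v b \<le> int B \<and> int B < v (b + 1))}"
    unfolding phi_fin_def v_def by (simp add: Let_def)
  show ?thesis
  proof (intro subset_antisym subsetI)
    fix e assume "e \<in> phi_fin m k T j"
    then consider "e = {}" | a b A B where "e = {a..b}" "1 \<le> a" "a \<le> b" "b \<le> k" "{A..B} \<in> T"
       "v (a - 1) < int A" "int A \<le> v a" "v a \<le> v b" "v b \<le> int B" "int B < v (b + 1)"
      unfolding phi by blast
    then show "e \<in> trace_tree k T (j ` {1..k})"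
    proof cases
      case (2 a b A B)
      have AB: "A \<le> B" using 2 by linarith
      have "1 \<le> A" using InSy_interval_bounds[OF I 2(5) AB] by simp
      moreover have "card {r \<in> j ` {1..k}. r < A} = a - 1" "card {r \<in> j ` {1..k}. r \<le> B} = b"
        using idx[OF 2(2-5) AB] 2 by auto
      ultimately have "e = {card {r \<in> j ` {1..k}. r < A} + 1..card {r \<in> j ` {1..k}. r \<le> B}}"
        using 2 by simp
      then show ?thesis unfolding trace_tree_def using \<open>1 \<le> A\<close> AB 2(5) by blast
    qed (simp add: trace_tree_def)
  next
    fix e assume "e \<in> trace_tree k T (j ` {1..k})"
    then show "e \<in> phi_fin m k T j"
    proof (cases rule: trace_tree_cases)
      case 2: (single i)
      have "{j i..j i} \<in> T" using jm[OF 2(1)] I unfolding InSy_def by simp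
      moreover have "v i = int (j i)" using 2(1) unfolding v_def with_ends_def by auto
      moreover have "v (i - 1) < int (j i)"
        using strict_mono_onD[OF smon, of "i - 1" i] jm[OF 2(1)] 2(1) m unfolding v_def with_ends_def by auto
      moreover have "int (j i) < v (i + 1)"
        using strict_mono_onD[OF smon, of i "i + 1"] jm[OF 2(1)] 2(1) m unfolding v_def with_ends_def by auto
      ultimately have ex: "\<exists>A B. {A..B} \<in> T \<and> v (i - 1) < int A \<and> int A \<le> v i \<and> v i \<le> v i
                \<and> v i \<le> int B \<and> int B < v (i + 1)"
        by (intro exI[of _ "j i"]) simp
      have "1 \<le> i \<and> i \<le> i \<and> i \<le> k" using 2(1) by simp
      then have "{i..i} \<in> phi_fin m k T j" unfolding phi using ex by blast
      then show ?thesis using 2(2) by simp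
    next
      case 3: (interval A B)
      define a b where "a = card {r \<in> j ` {1..k}. r < A} + 1" and "b = card {r \<in> j ` {1..k}. r \<le> B}"
      have bk: "b \<le> k" using cle unfolding b_def by simp
      show ?thesis
      proof (cases "a \<le> b")
        case True
        then have "v (a - 1) < int A \<and> int A \<le> v a \<and> v b \<le> int B \<and> int B < v (b + 1)"
          using idx[of a b A B] 3 bk unfolding a_def b_def by auto
        moreover have "v a \<le> v b" using vmono[of a b] True bk unfolding a_def by simp
        moreover have "1 \<le> a" unfolding a_def by simp
        ultimately have "{a..b} \<in> phi_fin m k T j" unfolding phi using True bk 3(3) by blast
        then show ?thesis using 3(4) by (simp add: a_def b_def)
      qed (use 3 in \<open>simp add: a_def b_def phi\<close>)
    qed (simp add: phi)
  qed
qed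

lemma incr_vecs_bij: "bij_betw (\<lambda>j. j ` {1..k}) (incr_vecs k m) {A. A \<subseteq> {1..m} \<and> card A = k}"
proof (rule bij_betw_imageI)
  have srt: "sorted_wrt (<) (map j [1..<k + 1])" if "j \<in> incr_vecs k m" for j
    using that unfolding incr_vecs_def sorted_wrt_iff_nth_less
    by (auto simp: strict_mono_on_def simp del: upt_Suc)
  show "inj_on (\<lambda>j. j ` {1..k}) (incr_vecs k m)"
  proof (rule inj_onI)
    fix j j' assume j: "j \<in> incr_vecs k m" "j' \<in> incr_vecs k m" and eq: "j ` {1..k} = j' ` {1..k}"
    have "set (map j [1..<k + 1]) = set (map j' [1..<k + 1])" using eq by (simp add: atLeastLessThanSuc_atLeastAtMost del: upt_Suc)
    then have "map j [1..<k + 1] = map j' [1..<k + 1]"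
      using srt[OF j(1)] srt[OF j(2)] strict_sorted_equal by blast
    then have "\<forall>i\<in>{1..k}. j i = j' i" by (auto simp: map_eq_conv simp del: upt_Suc)
    then show "j = j'" using j unfolding incr_vecs_def by (intro PiE_ext[of j "{1..k}" "\<lambda>_. {1..m}"]) auto
  qed
  show "(\<lambda>j. j ` {1..k}) ` incr_vecs k m = {A. A \<subseteq> {1..m} \<and> card A = k}"
  proof (intro subset_antisym subsetI)
    fix A assume "A \<in> (\<lambda>j. j ` {1..k}) ` incr_vecs k m"
    then obtain j where j: "j \<in> incr_vecs k m" "A = j ` {1..k}" by blast
    then have "inj_on j {1..k}" unfolding incr_vecs_def using strict_mono_on_imp_inj_on by blast
    then show "A \<in> {A. A \<subseteq> {1..m} \<and> card A = k}" using j unfolding incr_vecs_def by (auto simp: card_image)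
  next
    fix A assume A: "A \<in> {A. A \<subseteq> {1..m} \<and> card A = k}"
    then have fin: "finite A" by (auto intro: finite_subset)
    define l where "l = sorted_list_of_set A"
    have l: "length l = k" "sorted_wrt (<) l" "set l = A" using A fin by (auto simp: l_def)
    define j where "j = restrict (\<lambda>i. l ! (i - 1)) {1..k}"
    have img: "j ` {1..k} = A"
    proof -
      have "A = (\<lambda>i. l ! i) ` {..<k}" using l nth_image[of k l] by (auto simp: set_conv_nth)
      also have "{..<k} = (\<lambda>i. i - 1) ` {1..k}" by (force simp: image_iff)
      finally show ?thesis unfolding j_def by (simp add: image_image)
    qed
    moreover have "strict_mono_on {1..k} j"
      unfolding j_def strict_mono_on_def using sorted_wrt_nth_less[OF l(2)] l(1) by auto
    moreover have "j \<in> {1..k} \<rightarrow>\<^sub>E {1..m}"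
      using img A unfolding j_def by (intro restrict_PiE_iff[THEN iffD2]) (auto simp: image_subset_iff)
    ultimately have "j \<in> incr_vecs k m" unfolding incr_vecs_def by blast
    then show "A \<in> (\<lambda>j. j ` {1..k}) ` incr_vecs k m" using img by blast
  qed
qed

text \<open>Each \<open>k\<close>-subset is the image of one increasing vector and of \<open>k!\<close> injections.\<close>

lemma card_injections_by_image:
  "card {f \<in> {1..k} \<rightarrow>\<^sub>E {1..m}. inj_on f {1..k} \<and> Q (f ` {1..k})}
     = fact k * card {j \<in> incr_vecs k m. Q (j ` {1..k})}"
proof -
  let ?S = "{A. A \<subseteq> {1..m} \<and> card A = k \<and> Q A}"
  have fin: "finite ?S" by (rule finite_subset[of _ "Pow {1..m}"]) auto
  have "card {j \<in> incr_vecs k m. Q (j ` {1..k})} = card ?S"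
  proof (rule bij_betw_same_card[of "\<lambda>j. j ` {1..k}"], rule bij_betw_imageI)
    show "inj_on (\<lambda>j. j ` {1..k}) {j \<in> incr_vecs k m. Q (j ` {1..k})}"
      using bij_betw_imp_inj_on[OF incr_vecs_bij[of k m]] by (rule inj_on_subset) auto
    have "(\<lambda>j. j ` {1..k}) ` {j \<in> incr_vecs k m. Q (j ` {1..k})}
        = {A \<in> (\<lambda>j. j ` {1..k}) ` incr_vecs k m. Q A}" by blast
    also have "\<dots> = ?S" unfolding bij_betw_imp_surj_on[OF incr_vecs_bij] by simp
    finally show "(\<lambda>j. j ` {1..k}) ` {j \<in> incr_vecs k m. Q (j ` {1..k})} = ?S" .
  qed
  moreover have "{f \<in> {1..k} \<rightarrow>\<^sub>E {1..m}. inj_on f {1..k} \<and> Q (f ` {1..k})}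
      = (\<Union>A\<in>?S. {f \<in> {1..k} \<rightarrow>\<^sub>E A. inj_on f {1..k}})" (is "?F = ?G")
  proof (intro subset_antisym subsetI)
    fix f assume f: "f \<in> ?F"
    then have "f ` {1..k} \<in> ?S" by (auto simp: card_image)
    moreover have "f \<in> {f \<in> {1..k} \<rightarrow>\<^sub>E f ` {1..k}. inj_on f {1..k}}" using f by (auto simp: PiE_def)
    ultimately show "f \<in> ?G" by blast
  next
    fix f assume "f \<in> ?G"
    then obtain A where A: "A \<in> ?S" "f \<in> {1..k} \<rightarrow>\<^sub>E A" "inj_on f {1..k}" by blast
    have "finite A" using A(1) by (auto intro: finite_subset)
    moreover have "f ` {1..k} \<subseteq> A" using A(2) by blast
    moreover have "card (f ` {1..k}) = card A" using A(1,3) by (simp add: card_image)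
    ultimately have "f ` {1..k} = A" by (metis card_subset_eq)
    then show "f \<in> ?F" using A by (auto simp: PiE_iff)
  qed
  moreover have "card ?G = (\<Sum>A\<in>?S. card {f \<in> {1..k} \<rightarrow>\<^sub>E A. inj_on f {1..k}})"
  proof (rule card_UN_disjoint[OF fin])
    show "\<forall>A\<in>?S. finite {f \<in> {1..k} \<rightarrow>\<^sub>E A. inj_on f {1..k}}"
    proof
      fix A assume "A \<in> ?S"
      then have "finite A" by (auto intro: finite_subset)
      then show "finite {f \<in> {1..k} \<rightarrow>\<^sub>E A. inj_on f {1..k}}"
        using finite_PiE[of "{1..k}" "\<lambda>_. A"] by (simp add: finite_subset)
    qed
    show "\<forall>A\<in>?S. \<forall>A'\<in>?S. A \<noteq> A' \<longrightarrow> {f \<in> {1..k} \<rightarrow>\<^sub>E A. inj_on f {1..k}} \<inter> {f \<in> {1..k} \<rightarrow>\<^sub>E A'. inj_on f {1..k}} = {}"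
    proof (intro ballI impI, rule ccontr)
      fix A A' assume A: "A \<in> ?S" "A' \<in> ?S" "A \<noteq> A'"
        and "{f \<in> {1..k} \<rightarrow>\<^sub>E A. inj_on f {1..k}} \<inter> {f \<in> {1..k} \<rightarrow>\<^sub>E A'. inj_on f {1..k}} \<noteq> {}"
      then obtain f where f: "f ` {1..k} \<subseteq> A" "f ` {1..k} \<subseteq> A'" "inj_on f {1..k}" by blast
      have "finite A" "finite A'" using A by (auto intro: finite_subset)
      moreover have "card (f ` {1..k}) = k" using f(3) by (simp add: card_image)
      ultimately have "f ` {1..k} = A" "f ` {1..k} = A'" using f A by (metis (mono_tags, lifting) card_subset_eq mem_Collect_eq)+
      then show False using A(3) by simp
    qed
  qed
  moreover have "card {f \<in> {1..k} \<rightarrow>\<^sub>E A. inj_on f {1..k}} = fact k" if "A \<in> ?S" for A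
  proof -
    have "finite A" "card A = k" using that by (auto intro: finite_subset)
    then show ?thesis using card_inj_on_subset_funcset[of "{1..k}" A "{1..k}"]
      by (simp add: fact_prod_rev)
  qed
  ultimately show ?thesis by simp
qed

lemma card_incr_vecs: "card (incr_vecs k m) = m choose k"
proof -
  have "card (incr_vecs k m) = card {A. A \<subseteq> {1..m} \<and> card A = k}"
    by (rule bij_betw_same_card[OF incr_vecs_bij])
  also have "\<dots> = m choose k" using n_subsets[of "{1..m}" k] by simp
  finally show ?thesis .
qed

section \<open>Sampling at independent uniform points\<close>

lemma measurable_count_below_eq:
  fixes X :: "nat \<Rightarrow> 'x \<Rightarrow> real"
  assumes X: "\<And>i. i \<in> {1..k} \<Longrightarrow> X i \<in> borel_measurable N"
  shows "{\<omega> \<in> space N. count_below k (\<lambda>i. X i \<omega>) p = \<alpha>} \<in> sets N"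
proof -
  have "{\<omega> \<in> space N. count_below k (\<lambda>i. X i \<omega>) p = \<alpha>}
      = {\<omega> \<in> space N. (\<Sum>i\<in>{1..k}. indicat_real {..<p} (X i \<omega>)) = real \<alpha>}"
  proof -
    have "(\<Sum>i\<in>{1..k}. indicat_real {..<p} (X i \<omega>)) = real (count_below k (\<lambda>i. X i \<omega>) p)" for \<omega>
    proof -
      have "(\<Sum>i\<in>{1..k}. indicat_real {..<p} (X i \<omega>)) = (\<Sum>i\<in>{i \<in> {1..k}. X i \<omega> < p}. 1)"
        by (rule sum.mono_neutral_cong_right) (auto simp: indicator_def)
      then show ?thesis by (simp add: count_below_def)
    qed
    then show ?thesis by simp
  qed
  moreover have "(\<lambda>\<omega>. \<Sum>i\<in>{1..k}. indicat_real {..<p} (X i \<omega>)) \<in> borel_measurable N"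
    by (intro borel_measurable_sum measurable_compose[OF X]) auto
  then have "{\<omega> \<in> space N. (\<Sum>i\<in>{1..k}. indicat_real {..<p} (X i \<omega>)) = real \<alpha>} \<in> sets N"
    by measurable
  ultimately show ?thesis by simp
qed

lemma finite_InSy: "finite (InSy n)"
  by (rule finite_subset[of _ "Pow (Pow {1..n})"]) (auto simp: InSy_def)

text \<open>The quantification over the uncountable set \<open>K\<close> is replaced by one over rational boxes, which
  makes the event measurable.\<close>

lemma sample_interval_iff_rational_box:
  "(\<exists>a b. (a, b) \<in> K \<and> a \<notin> x ` {1..k} \<and> b \<notin> x ` {1..k} \<and> count_below k x a = \<alpha> \<and> count_below k x b = \<beta>)
   \<longleftrightarrow> (\<exists>t\<in>{t \<in> (\<rat> \<times> \<rat>) \<times> (\<rat> \<times> \<rat>). K \<inter> {fst (fst t)..snd (fst t)} \<times> {fst (snd t)..snd (snd t)} \<noteq> {}}.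
        (\<forall>i\<in>{1..k}. x i \<notin> {fst (fst t)..snd (fst t)}) \<and> (\<forall>i\<in>{1..k}. x i \<notin> {fst (snd t)..snd (snd t)}) \<and>
        count_below k x (fst (fst t)) = \<alpha> \<and> count_below k x (fst (snd t)) = \<beta>)" (is "?L \<longleftrightarrow> ?R")
proof
  have box: "\<exists>p\<in>\<rat>. \<exists>q\<in>\<rat>. p \<le> a \<and> a \<le> q \<and> (\<forall>i\<in>{1..k}. x i \<notin> {p..q}) \<and> count_below k x p = count_below k x a"
    if a: "a \<notin> x ` {1..k}" for a
  proof -
    obtain e where e: "0 < e"
      "\<And>z. \<bar>z - a\<bar> < e \<Longrightarrow> z \<notin> x ` {1..k} \<and> count_below k x z = count_below k x a"
      using count_below_locally_constant[OF a] by blast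
    obtain p where p: "p \<in> \<rat>" "a - e < p" "p < a" using Rats_dense_in_real[of "a - e" a] e(1) by auto
    obtain q where q: "q \<in> \<rat>" "a < q" "q < a + e" using Rats_dense_in_real[of a "a + e"] e(1) by auto
    have "x i \<notin> {p..q}" if "i \<in> {1..k}" for i
    proof
      assume "x i \<in> {p..q}"
      then have "\<bar>x i - a\<bar> < e" using p q by auto
      then show False using e(2) that by blast
    qed
    moreover have "count_below k x p = count_below k x a" using e(2)[of p] p by simp
    ultimately show ?thesis using p q by (intro bexI[of _ p] bexI[of _ q]) auto
  qed
  assume ?L
  then obtain a b where ab: "(a, b) \<in> K" "a \<notin> x ` {1..k}" "b \<notin> x ` {1..k}"
    "count_below k x a = \<alpha>" "count_below k x b = \<beta>" by blast
  obtain p q where pq: "p \<in> \<rat>" "q \<in> \<rat>" "p \<le> a" "a \<le> q" "\<forall>i\<in>{1..k}. x i \<notin> {p..q}" "count_below k x p = \<alpha>"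
    using box[OF ab(2)] ab(4) by auto
  obtain r s where rs: "r \<in> \<rat>" "s \<in> \<rat>" "r \<le> b" "b \<le> s" "\<forall>i\<in>{1..k}. x i \<notin> {r..s}" "count_below k x r = \<beta>"
    using box[OF ab(3)] ab(5) by auto
  have "(a, b) \<in> K \<inter> {p..q} \<times> {r..s}" using ab pq rs by simp
  then show ?R using pq rs by (intro bexI[of _ "((p, q), (r, s))"]) auto
next
  have same: "count_below k x a = count_below k x p \<and> a \<notin> x ` {1..k}"
    if "a \<in> {p..q}" "\<forall>i\<in>{1..k}. x i \<notin> {p..q}" for a p q
  proof -
    have "{i \<in> {1..k}. x i < a} = {i \<in> {1..k}. x i < p}" using that by force
    then show ?thesis using that unfolding count_below_def by auto
  qed
  assume ?R
  then obtain t where t: "K \<inter> {fst (fst t)..snd (fst t)} \<times> {fst (snd t)..snd (snd t)} \<noteq> {}"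
    "\<forall>i\<in>{1..k}. x i \<notin> {fst (fst t)..snd (fst t)}" "\<forall>i\<in>{1..k}. x i \<notin> {fst (snd t)..snd (snd t)}"
    "count_below k x (fst (fst t)) = \<alpha>" "count_below k x (fst (snd t)) = \<beta>" by blast
  obtain a b where "(a, b) \<in> K \<inter> {fst (fst t)..snd (fst t)} \<times> {fst (snd t)..snd (snd t)}"
    using t(1) by (metis ex_in_conv surj_pair)
  then have ab: "(a, b) \<in> K" "a \<in> {fst (fst t)..snd (fst t)}" "b \<in> {fst (snd t)..snd (snd t)}"
    by blast+
  show ?L using same[OF ab(2) t(2)] same[OF ab(3) t(3)] t(4,5) ab(1)
    by (intro exI[of _ a] exI[of _ b]) simp
qed

lemma measurable_sample_tree:
  fixes X :: "nat \<Rightarrow> 'x \<Rightarrow> real"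
  assumes X: "\<And>i. i \<in> {1..k} \<Longrightarrow> X i \<in> borel_measurable N"
  shows "(\<lambda>\<omega>. sample_tree k K (\<lambda>i. X i \<omega>)) \<in> measurable N (count_space (InSy k))"
proof -
  let ?c = "\<lambda>\<omega>. count_below k (\<lambda>i. X i \<omega>)"
  have box: "{\<omega> \<in> space N. X i \<omega> \<notin> {p..q}} \<in> sets N" if "i \<in> {1..k}" for i p q
    using measurable_sets[OF X[OF that], of "- {p..q}"] by (simp add: vimage_def Int_def conj_commute)
  have ev: "{\<omega> \<in> space N. \<exists>a b. (a, b) \<in> K \<and> a \<notin> (\<lambda>i. X i \<omega>) ` {1..k} \<and> b \<notin> (\<lambda>i. X i \<omega>) ` {1..k}
      \<and> ?c \<omega> a = \<alpha> \<and> ?c \<omega> b = \<beta>} \<in> sets N" for \<alpha> \<beta>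
    unfolding sample_interval_iff_rational_box
  proof (rule sets.sets_Collect_countable_Ex')
    show "countable {t \<in> (\<rat> \<times> \<rat>) \<times> (\<rat> \<times> \<rat>). K \<inter> {fst (fst t)..snd (fst t)} \<times> {fst (snd t)..snd (snd t)} \<noteq> {}}"
      by (rule countable_subset[of _ "(\<rat> \<times> \<rat>) \<times> (\<rat> \<times> \<rat>)"]) (auto simp: countable_rat)
  qed (intro sets.sets_Collect_conj sets.sets_Collect_finite_All box measurable_count_below_eq X; simp)
  have mem: "{\<omega> \<in> space N. e \<in> sample_tree k K (\<lambda>i. X i \<omega>)} \<in> sets N" for e
  proof (cases "e \<in> insert {} ((\<lambda>j. {j}) ` {1..k})")
    case True
    then have "{\<omega> \<in> space N. e \<in> sample_tree k K (\<lambda>i. X i \<omega>)} = space N" unfolding sample_tree_def by blast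
    then show ?thesis by simp
  next
    case False
    have "{\<omega> \<in> space N. e \<in> sample_tree k K (\<lambda>i. X i \<omega>)} =
      {\<omega> \<in> space N. \<exists>s\<in>{s :: nat \<times> nat. e = {fst s + 1..snd s}}.
         \<exists>a b. (a, b) \<in> K \<and> a \<notin> (\<lambda>i. X i \<omega>) ` {1..k} \<and> b \<notin> (\<lambda>i. X i \<omega>) ` {1..k}
           \<and> ?c \<omega> a = fst s \<and> ?c \<omega> b = snd s}" (is "?A = ?B")
    proof (intro subset_antisym subsetI)
      fix \<omega> assume "\<omega> \<in> ?A"
      then have w: "\<omega> \<in> space N" "e \<in> sample_tree k K (\<lambda>i. X i \<omega>)" by auto
      from w(2) show "\<omega> \<in> ?B"
      proof (cases rule: sample_tree_cases)
        case (interval a b)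
        then show ?thesis using w(1)
          by (intro CollectI conjI bexI[of _ "(?c \<omega> a, ?c \<omega> b)"] exI[of _ a] exI[of _ b]) simp_all
      qed (use False in auto)
    next
      fix \<omega> assume "\<omega> \<in> ?B"
      then show "\<omega> \<in> ?A" unfolding sample_tree_def by auto
    qed
    moreover have "?B \<in> sets N"
      by (rule sets.sets_Collect_countable_Ex'[OF ev]) (rule countableI_type)
    ultimately show ?thesis by simp
  qed
  show ?thesis unfolding measurable_count_space_eq2[OF finite_InSy]
  proof (intro conjI ballI)
    fix T assume T: "T \<in> InSy k"
    have "(\<lambda>\<omega>. sample_tree k K (\<lambda>i. X i \<omega>)) -` {T} \<inter> space N
        = {\<omega> \<in> space N. \<forall>e\<in>Pow {1..k}. (e \<in> sample_tree k K (\<lambda>i. X i \<omega>)) = (e \<in> T)}"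
    proof -
      have sub: "sample_tree k K x \<subseteq> Pow {1..k}" for x using sample_tree_InSy[of k K x] unfolding InSy_def by blast
      have "T \<subseteq> Pow {1..k}" using T unfolding InSy_def by blast
      then have "sample_tree k K x = T \<longleftrightarrow> (\<forall>e\<in>Pow {1..k}. (e \<in> sample_tree k K x) = (e \<in> T))" for x
        using sub[of x] by blast
      then show ?thesis by (auto simp: vimage_def)
    qed
    also have "\<dots> \<in> sets N"
    proof (intro sets.sets_Collect_finite_All)
      fix e show "{\<omega> \<in> space N. (e \<in> sample_tree k K (\<lambda>i. X i \<omega>)) = (e \<in> T)} \<in> sets N"
      proof (cases "e \<in> T")
        case True then show ?thesis using mem[of e] by simp
      next
        case False
        then have "{\<omega> \<in> space N. (e \<in> sample_tree k K (\<lambda>i. X i \<omega>)) = (e \<in> T)}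
            = space N - {\<omega> \<in> space N. e \<in> sample_tree k K (\<lambda>i. X i \<omega>)}" by auto
        then show ?thesis using mem[of e] by auto
      qed
    qed simp
    finally show "(\<lambda>\<omega>. sample_tree k K (\<lambda>i. X i \<omega>)) -` {T} \<inter> space N \<in> sets N" .
  qed (use sample_tree_InSy in auto)
qed

locale iid_uniform = prob_space M for M :: "'w measure" +
  fixes U :: "nat \<Rightarrow> 'w \<Rightarrow> real"
  assumes indep: "indep_vars (\<lambda>_. borel) U {1..}"
    and unif: "\<And>i. i \<ge> 1 \<Longrightarrow> distr M borel (U i) = uniform_measure lborel {0..1}"
begin

lemma U_measurable [measurable]: "i \<ge> 1 \<Longrightarrow> U i \<in> borel_measurable M"
  using indep unfolding indep_vars_def by simp

lemma prob_U:
  assumes "i \<ge> 1" "A \<in> sets borel"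
  shows "prob (U i -` A \<inter> space M) = measure lborel ({0..1} \<inter> A)"
proof -
  have "prob (U i -` A \<inter> space M) = measure (uniform_measure lborel {0..1}) A"
    using measure_distr[OF U_measurable[OF assms(1)] assms(2)] unif[OF assms(1)] by simp
  then show ?thesis using assms(2) by simp
qed

lemma AE_U_notin_countable:
  assumes "countable C" "i \<ge> 1"
  shows "AE \<omega> in M. U i \<omega> \<notin> C"
proof -
  have "AE x in lborel. x \<notin> C" using assms(1) by (intro AE_not_in countable_imp_null_set_lborel)
  then have "AE x in uniform_measure lborel {0..1}. x \<notin> C" by (intro AE_uniform_measureI) auto
  then have "AE x in distr M borel (U i). x \<notin> C" unfolding unif[OF assms(2)] .
  then show ?thesis by (rule AE_distrD[OF U_measurable[OF assms(2)]])
qed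

lemma AE_U_01:
  assumes "i \<ge> 1" shows "AE \<omega> in M. 0 < U i \<omega> \<and> U i \<omega> < 1"
proof -
  have "AE x in uniform_measure lborel {0..1::real}. x \<in> {0..1}" by (intro AE_uniform_measureI) auto
  then have "AE x in distr M borel (U i). x \<in> {0..1}" unfolding unif[OF assms] .
  then have "AE \<omega> in M. U i \<omega> \<in> {0..1}" by (rule AE_distrD[OF U_measurable[OF assms]])
  moreover have "AE \<omega> in M. U i \<omega> \<notin> {0, 1}" by (rule AE_U_notin_countable[OF _ assms]) simp
  ultimately show ?thesis by eventually_elim auto
qed

text \<open>Fubini for the joint law of two of the variables.\<close>

lemma AE_U_pair:
  assumes ij: "i \<ge> 1" "j \<ge> 1" "i \<noteq> j" and N: "N \<in> sets borel"
    and null: "countable {x. \<not> countable {y. (x, y) \<in> N}}"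
  shows "AE \<omega> in M. (U i \<omega>, U j \<omega>) \<notin> N"
proof -
  let ?D = "uniform_measure lborel {0..1::real}"
  interpret D: prob_space ?D by (rule prob_space_uniform_measure) auto
  interpret DD: pair_prob_space ?D ?D ..
  have "indep_var (PiM {i} (\<lambda>_. borel)) (\<lambda>\<omega>. restrict (\<lambda>i. U i \<omega>) {i})
          (PiM {j} (\<lambda>_. borel)) (\<lambda>\<omega>. restrict (\<lambda>i. U i \<omega>) {j})"
    using ij by (intro indep_var_restrict[OF indep]) auto
  then have "indep_var borel ((\<lambda>x. x i) \<circ> (\<lambda>\<omega>. restrict (\<lambda>i. U i \<omega>) {i}))
      borel ((\<lambda>x. x j) \<circ> (\<lambda>\<omega>. restrict (\<lambda>i. U i \<omega>) {j}))"
    by (rule indep_var_compose) (auto intro: measurable_component_singleton)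
  then have "indep_var borel (U i) borel (U j)" by (simp add: comp_def)
  then have D: "?D \<Otimes>\<^sub>M ?D = distr M (borel \<Otimes>\<^sub>M borel) (\<lambda>\<omega>. (U i \<omega>, U j \<omega>))"
    using ij by (simp add: indep_var_distribution_eq unif)
  have ctble: "AE x in ?D. x \<notin> C" if "countable C" for C
    using AE_not_in[OF countable_imp_null_set_lborel[OF that]] by (intro AE_uniform_measureI) auto
  have "AE z in ?D \<Otimes>\<^sub>M ?D. z \<notin> N"
  proof (rule DD.AE_pair_measure)
    have "sets (?D \<Otimes>\<^sub>M ?D) = sets (borel :: (real \<times> real) measure)"
      by (subst borel_prod[symmetric]) (intro sets_pair_measure_cong; simp)
    moreover have "{z \<in> space (?D \<Otimes>\<^sub>M ?D). z \<notin> N} = - N" by (auto simp: space_pair_measure)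
    ultimately show "{z \<in> space (?D \<Otimes>\<^sub>M ?D). z \<notin> N} \<in> sets (?D \<Otimes>\<^sub>M ?D)" using N by auto
    show "AE x in ?D. AE y in ?D. (x, y) \<notin> N"
      using ctble[OF null]
    proof eventually_elim
      case (elim x)
      then have "AE y in ?D. y \<notin> {y. (x, y) \<in> N}" by (intro ctble) simp
      then show ?case by simp
    qed
  qed
  then have ae: "AE z in distr M (borel \<Otimes>\<^sub>M borel) (\<lambda>\<omega>. (U i \<omega>, U j \<omega>)). z \<notin> N" unfolding D .
  have "(\<lambda>\<omega>. (U i \<omega>, U j \<omega>)) \<in> measurable M (borel \<Otimes>\<^sub>M borel)"
    using ij by measurable
  from AE_distrD[OF this ae] show ?thesis .
qed

lemma AE_distinct:
  assumes "i \<ge> 1" "j \<ge> 1" "i \<noteq> j"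
  shows "AE \<omega> in M. U i \<omega> \<noteq> U j \<omega>"
proof -
  let ?N = "{p :: real \<times> real. fst p = snd p}"
  have "closed ?N" by (intro closed_Collect_eq continuous_intros)
  then have "?N \<in> sets borel" by simp
  moreover have "{y. (x, y) \<in> ?N} = {x}" for x by auto
  then have "countable {x. \<not> countable {y. (x, y) \<in> ?N}}" by simp
  ultimately have "AE \<omega> in M. (U i \<omega>, U j \<omega>) \<notin> ?N" by (rule AE_U_pair[OF assms])
  then show ?thesis by simp
qed

lemma AE_inj: "AE \<omega> in M. inj_on (\<lambda>i. U i \<omega>) {1..k}"
proof -
  have "AE \<omega> in M. \<forall>i\<in>{1..k}. \<forall>j\<in>{1..k}. i \<noteq> j \<longrightarrow> U i \<omega> \<noteq> U j \<omega>"
    using AE_distinct by (intro AE_finite_allI) (auto simp: AE_impI)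
  then show ?thesis by eventually_elim (auto simp: inj_on_def)
qed

lemma AE_generic_sample:
  assumes K: "K \<in> STree_inf"
  shows "AE \<omega> in M. generic_sample k K (\<lambda>i. U i \<omega>)"
proof -
  let ?N = "K \<inter> {p. fst p < snd p}"
  have "closed K" using K by (simp add: STree_inf_def compact_imp_closed)
  moreover have "open {p :: real \<times> real. fst p < snd p}" by (intro open_Collect_less continuous_intros)
  ultimately have N: "?N \<in> sets borel" by simp
  have "{x. \<not> countable {y. (x, y) \<in> ?N}} \<subseteq> {x. \<exists>y1 y2. x < y1 \<and> y1 < y2 \<and> (x, y1) \<in> K \<and> (x, y2) \<in> K}"
  proof clarify
    fix x assume unc: "\<not> countable {y. (x, y) \<in> ?N}"
    then obtain y where y: "(x, y) \<in> ?N" by (metis countable_empty empty_Collect_eq)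
    have "\<not> {y. (x, y) \<in> ?N} \<subseteq> {y}" using unc countable_subset[of _ "{y}"] by auto
    then obtain y' where y': "(x, y') \<in> ?N" "y' \<noteq> y" by blast
    show "\<exists>y1 y2. x < y1 \<and> y1 < y2 \<and> (x, y1) \<in> K \<and> (x, y2) \<in> K"
    proof (cases "y < y'")
      case True then show ?thesis using y y' by auto
    next
      case False then show ?thesis using y y' by (intro exI[of _ y'] exI[of _ y]) auto
    qed
  qed
  then have cN: "countable {x. \<not> countable {y. (x, y) \<in> ?N}}"
    using countable_multivalued[OF K] countable_subset by blast
  have "AE \<omega> in M. U i \<omega> < U j \<omega> \<longrightarrow> (U i \<omega>, U j \<omega>) \<notin> K" if "i \<ge> 1" "j \<ge> 1" for i j
  proof (cases "i = j")
    case False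
    have "AE \<omega> in M. (U i \<omega>, U j \<omega>) \<notin> ?N" by (rule AE_U_pair[OF that False N cN])
    then show ?thesis by eventually_elim auto
  qed simp
  then have 1: "AE \<omega> in M. \<forall>i\<in>{1..k}. \<forall>j\<in>{1..k}. U i \<omega> < U j \<omega> \<longrightarrow> (U i \<omega>, U j \<omega>) \<notin> K"
    by (intro AE_finite_allI) auto
  have "AE \<omega> in M. 0 < U i \<omega> \<and> U i \<omega> < 1 \<and> approachable K (U i \<omega>)" if "i \<ge> 1" for i
    using AE_U_01[OF that] AE_U_notin_countable[OF countable_not_approachable that, of K]
    by eventually_elim auto
  then have 2: "AE \<omega> in M. \<forall>i\<in>{1..k}. 0 < U i \<omega> \<and> U i \<omega> < 1 \<and> approachable K (U i \<omega>)"
    by (intro AE_finite_allI) auto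
  show ?thesis using AE_inj 1 2 unfolding generic_sample_def by eventually_elim auto
qed

definition tree_at :: "(real \<times> real) set \<Rightarrow> nat \<Rightarrow> 'w \<Rightarrow> nat set set" where
  "tree_at K k \<omega> = sample_tree k K (\<lambda>i. U i \<omega>)"

lemma tree_at_measurable [measurable]: "tree_at K k \<in> measurable M (count_space (InSy k))"
  unfolding tree_at_def by (intro measurable_sample_tree U_measurable) simp

lemma AE_tree_at_STree:
  assumes K: "K \<in> STree_inf"
  shows "AE \<omega> in M. tree_at K k \<omega> \<in> STree k"
  using AE_generic_sample[OF K, of k]
  by eventually_elim (auto simp: generic_sample_def tree_at_def intro!: sample_tree_STree[OF K])

lemma sample_prob_eq:
  assumes K: "K \<in> STree_inf"
  shows "sample_prob M U K k T = prob {\<omega> \<in> space M. tree_at K k \<omega> = T}"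
  unfolding sample_prob_def tree_at_def
  using phi_inf_order_stat[of K k U] K unfolding STree_inf_def by simp

lemma tree_at_sets: "{\<omega> \<in> space M. tree_at K k \<omega> \<in> A} \<in> sets M"
proof -
  have "{\<omega> \<in> space M. tree_at K k \<omega> \<in> A} = tree_at K k -` (A \<inter> InSy k) \<inter> space M"
    using sample_tree_InSy unfolding tree_at_def by auto
  then show ?thesis using measurable_sets[OF tree_at_measurable, of "A \<inter> InSy k"] by simp
qed

lemma finite_STree: "finite (STree k)"
  by (rule finite_subset[OF _ finite_InSy[of k]]) (auto simp: STree_def)

lemma prob_tree_at_in:
  assumes K: "K \<in> STree_inf"
  shows "prob {\<omega> \<in> space M. tree_at K k \<omega> \<in> A} = (\<Sum>T\<in>A \<inter> STree k. sample_prob M U K k T)"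
proof -
  have "prob {\<omega> \<in> space M. tree_at K k \<omega> \<in> A} = prob {\<omega> \<in> space M. tree_at K k \<omega> \<in> A \<inter> STree k}"
    using AE_tree_at_STree[OF K, of k] tree_at_sets by (intro finite_measure_eq_AE) auto
  also have "{\<omega> \<in> space M. tree_at K k \<omega> \<in> A \<inter> STree k}
     = (\<Union>T\<in>A \<inter> STree k. {\<omega> \<in> space M. tree_at K k \<omega> = T})" by auto
  also have "prob \<dots> = (\<Sum>T\<in>A \<inter> STree k. prob {\<omega> \<in> space M. tree_at K k \<omega> = T})"
    using tree_at_sets[of K k "{T}" for T] finite_STree
    by (intro finite_measure_finite_Union) (auto simp: disjoint_family_on_def)
  finally show ?thesis by (simp add: sample_prob_eq[OF K])
qed

text \<open>All trees use the same uniforms. Almost sure convergence on this common space is what later gives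
  convergence of the laws.\<close>

lemma AE_eventually_tree_at:
  assumes Kn: "\<And>n. Kn n \<in> STree_inf" and K: "K \<in> STree_inf" and lim: "kuratowski_lim Kn K"
  shows "AE \<omega> in M. \<forall>\<^sub>F n in sequentially. tree_at (Kn n) k \<omega> = tree_at K k \<omega>"
  using AE_generic_sample[OF K, of k]
proof eventually_elim
  case (elim \<omega>)
  have sub: "L \<subseteq> {(x, y). 0 \<le> x \<and> x \<le> y \<and> y \<le> 1}" if "L \<in> STree_inf" for L
    using that unfolding STree_inf_def by blast
  show ?case unfolding tree_at_def
    by (rule eventually_sample_tree_eq[OF lim sub[OF K] sub[OF Kn] elim])
qed

lemma sample_prob_tendsto:
  assumes Kn: "\<And>n. Kn n \<in> STree_inf" and K: "K \<in> STree_inf" and lim: "kuratowski_lim Kn K"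
  shows "(\<lambda>n. sample_prob M U (Kn n) k T) \<longlonglongrightarrow> sample_prob M U K k T"
proof -
  have S: "{\<omega> \<in> space M. tree_at L k \<omega> = T} \<in> sets M" for L using tree_at_sets[of L k "{T}"] by simp
  have int: "prob {\<omega> \<in> space M. tree_at L k \<omega> = T} = (\<integral>\<omega>. indicat_real {\<omega> \<in> space M. tree_at L k \<omega> = T} \<omega> \<partial>M)" for L
    using S by simp
  have "(\<lambda>n. \<integral>\<omega>. indicat_real {\<omega> \<in> space M. tree_at (Kn n) k \<omega> = T} \<omega> \<partial>M)
     \<longlonglongrightarrow> (\<integral>\<omega>. indicat_real {\<omega> \<in> space M. tree_at K k \<omega> = T} \<omega> \<partial>M)"
  proof (rule integral_dominated_convergence[where w = "\<lambda>_. 1"])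
    show "AE \<omega> in M. (\<lambda>n. indicat_real {\<omega> \<in> space M. tree_at (Kn n) k \<omega> = T} \<omega>)
        \<longlonglongrightarrow> indicat_real {\<omega> \<in> space M. tree_at K k \<omega> = T} \<omega>"
      using AE_eventually_tree_at[OF assms, of k]
    proof eventually_elim
      case (elim \<omega>)
      then show ?case
        by (intro tendsto_eventually) (auto elim!: eventually_mono simp: indicator_def)
    qed
  qed (use S in \<open>auto simp: indicator_def\<close>)
  then show ?thesis by (simp only: sample_prob_eq[OF Kn] sample_prob_eq[OF K] int)
qed

end

section \<open>Densities in finite trees and recovery of the continuum tree\<close>

text \<open>The probability that \<open>k\<close> uniform points fall into \<open>k\<close> different cells out of \<open>m\<close>.\<close>

lemma injection_density_tendsto:
  "(\<lambda>m. fact k * real (m choose k) / real m ^ k) \<longlonglongrightarrow> 1"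
proof -
  have eq: "fact k * real (m choose k) / real m ^ k = (\<Prod>i<k. (real m - real i) / real m)" for m
  proof -
    have "fact k * real (m choose k) = (\<Prod>i = 0..<k. real m - real i)"
      using gbinomial_mult_fact'[of "real m" k] by (simp add: binomial_gbinomial mult.commute)
    then show ?thesis by (simp add: prod_dividef lessThan_atLeast0)
  qed
  have one: "(\<lambda>m. (real m - real i) / real m) \<longlonglongrightarrow> 1" for i
  proof -
    have "(\<lambda>m. 1 - real i / real m) \<longlonglongrightarrow> 1 - 0"
      by (intro tendsto_diff tendsto_const lim_const_over_n)
    moreover have "\<forall>\<^sub>F m in sequentially. 1 - real i / real m = (real m - real i) / real m"
      using eventually_gt_at_top[of 0] by eventually_elim (simp add: field_simps)
    ultimately show ?thesis by (simp add: tendsto_cong)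
  qed
  have "(\<lambda>m. \<Prod>i<k. (real m - real i) / real m) \<longlonglongrightarrow> (\<Prod>i<k. 1)"
    by (intro tendsto_prod one)
  then show ?thesis unfolding eq by simp
qed

context iid_uniform
begin

definition cell_event :: "nat \<Rightarrow> nat \<Rightarrow> (nat \<Rightarrow> nat) \<Rightarrow> 'w set" where
  "cell_event m k f = {\<omega> \<in> space M. in_cells m k f (\<lambda>i. U i \<omega>)}"

lemma prob_cell_event:
  assumes "1 \<le> m" "1 \<le> k" "f \<in> {1..k} \<rightarrow>\<^sub>E {1..m}"
  shows "cell_event m k f \<in> sets M" "prob (cell_event m k f) = 1 / real m ^ k"
proof -
  define A where "A i = {(real (f i) - 1) / real m<..<real (f i) / real m}" for i
  have eq: "cell_event m k f = (\<Inter>i\<in>{1..k}. U i -` A i \<inter> space M)"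
    using assms(2) unfolding cell_event_def in_cells_def A_def by auto
  show "cell_event m k f \<in> sets M" unfolding eq
    using assms(2) U_measurable by (intro sets.finite_INT measurable_sets[of _ M borel]) (auto simp: A_def)
  have "prob (cell_event m k f) = (\<Prod>i\<in>{1..k}. prob (U i -` A i \<inter> space M))"
    unfolding eq using assms(2) by (intro indep_varsD[OF indep]) (auto simp: A_def)
  also have "\<dots> = (\<Prod>i\<in>{1..k}. 1 / real m)"
  proof (rule prod.cong[OF refl])
    fix i assume i: "i \<in> {1..k}"
    then have fi: "1 \<le> f i" "f i \<le> m" using assms(3) by auto
    have lo: "0 \<le> (real (f i) - 1) / real m" using fi by simp
    have hi: "real (f i) / real m \<le> 1" using fi assms(1) by simp
    have "{0..1} \<inter> A i = A i" unfolding A_def using lo hi by auto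
    then have "prob (U i -` A i \<inter> space M) = measure lborel (A i)"
      using prob_U[of i "A i"] i unfolding A_def by simp
    also have "\<dots> = 1 / real m"
      unfolding A_def using assms(1) by (simp add: diff_divide_distrib divide_right_mono)
    finally show "prob (U i -` A i \<inter> space M) = 1 / real m" .
  qed
  finally show "prob (cell_event m k f) = 1 / real m ^ k" by (simp add: power_one_over)
qed

lemma cell_events_disjoint:
  assumes m: "1 \<le> m"
  shows "disjoint_family_on (cell_event m k) ({1..k} \<rightarrow>\<^sub>E {1..m})"
  unfolding disjoint_family_on_def
proof (intro ballI impI, rule ccontr)
  fix f g assume fg: "f \<in> {1..k} \<rightarrow>\<^sub>E {1..m}" "g \<in> {1..k} \<rightarrow>\<^sub>E {1..m}" "f \<noteq> g"
    and "cell_event m k f \<inter> cell_event m k g \<noteq> {}"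
  then obtain \<omega> where w: "in_cells m k f (\<lambda>i. U i \<omega>)" "in_cells m k g (\<lambda>i. U i \<omega>)"
    unfolding cell_event_def by blast
  have "f i = g i" if "i \<in> {1..k}" for i
  proof -
    have "(real (f i) - 1) / real m < real (g i) / real m" "(real (g i) - 1) / real m < real (f i) / real m"
      using w that unfolding in_cells_def by (meson less_trans)+
    then have "real (f i) - 1 < real (g i)" "real (g i) - 1 < real (f i)"
      using m by (auto simp: divide_less_cancel)
    then show ?thesis by linarith
  qed
  then have "f = g" using fg(1,2) by (intro PiE_ext) auto
  then show False using fg(3) by simp
qed

text \<open>Let \<open>\<rho>\<close> be the probability that the cells are different. Given this event, the sampled tree equals \<open>t\<close>
  with probability \<open>\<gamma>\<close>, the density. Hence the sampling probability lies between
  \<open>\<rho> \<gamma>\<close> and \<open>\<rho> \<gamma> + 1 - \<rho>\<close>.\<close>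

lemma gamma_density_approx:
  assumes m: "1 \<le> m" and k: "1 \<le> k" "k \<le> m" and T: "T \<in> STree m"
  shows "\<bar>sample_prob M U (tree_points m T) k t - gamma_density k t m T\<bar>
    \<le> 1 - fact k * real (m choose k) / real m ^ k"
proof -
  let ?K = "tree_points m T"
  define F where "F P = {f \<in> {1..k} \<rightarrow>\<^sub>E {1..m}. inj_on f {1..k} \<and> P (trace_tree k T (f ` {1..k}))}" for P
  define \<rho> where "\<rho> = fact k * real (m choose k) / real m ^ k"
  define \<gamma> where "\<gamma> = gamma_density k t m T"
  have K: "?K \<in> STree_inf" by (rule tree_points_STree_inf[OF m T])
  have cardF: "real (card (F P)) = fact k * real (card {j \<in> incr_vecs k m. P (phi_fin m k T j)})" for P
  proof -
    have "{j \<in> incr_vecs k m. P (trace_tree k T (j ` {1..k}))} = {j \<in> incr_vecs k m. P (phi_fin m k T j)}"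
      using phi_fin_eq_trace_tree[OF m T] by auto
    then show ?thesis
      unfolding F_def using card_injections_by_image[of k m "\<lambda>A. P (trace_tree k T A)"] by simp
  qed
  have finF: "finite (F P)" for P unfolding F_def
    by (rule finite_subset[of _ "{1..k} \<rightarrow>\<^sub>E {1..m}"]) (auto intro: finite_PiE)
  have bound: "real (card (F P)) / real m ^ k \<le> prob {\<omega> \<in> space M. P (tree_at ?K k \<omega>)}" for P
  proof -
    have "(\<Sum>f\<in>F P. prob (cell_event m k f)) = prob (\<Union>f\<in>F P. cell_event m k f)"
    proof (rule finite_measure_finite_Union[symmetric, OF finF])
      show "cell_event m k ` F P \<subseteq> sets M" using prob_cell_event(1)[OF m k(1)] unfolding F_def by auto
      show "disjoint_family_on (cell_event m k) (F P)"
        by (rule disjoint_family_on_mono[OF _ cell_events_disjoint[OF m]]) (auto simp: F_def)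
    qed
    also have "\<dots> \<le> prob {\<omega> \<in> space M. P (tree_at ?K k \<omega>)}"
    proof (rule finite_measure_mono)
      show "(\<Union>f\<in>F P. cell_event m k f) \<subseteq> {\<omega> \<in> space M. P (tree_at ?K k \<omega>)}"
      proof
        fix \<omega> assume "\<omega> \<in> (\<Union>f\<in>F P. cell_event m k f)"
        then obtain f where f: "f \<in> F P" "\<omega> \<in> space M" "in_cells m k f (\<lambda>i. U i \<omega>)"
          unfolding cell_event_def by blast
        then have "tree_at ?K k \<omega> = trace_tree k T (f ` {1..k})"
          unfolding tree_at_def F_def by (intro sample_tree_tree_points[OF m]) auto
        then show "\<omega> \<in> {\<omega> \<in> space M. P (tree_at ?K k \<omega>)}" using f unfolding F_def by simp
      qed
      show "{\<omega> \<in> space M. P (tree_at ?K k \<omega>)} \<in> events"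
        using tree_at_sets[of ?K k "Collect P"] by simp
    qed
    finally show ?thesis
      using prob_cell_event(2)[OF m k(1)] unfolding F_def by (simp add: mult.commute)
  qed
  let ?A = "{\<omega> \<in> space M. tree_at ?K k \<omega> = t}"
  have A: "?A \<in> events" using tree_at_sets[of ?K k "{t}"] by simp
  have N: "real (m choose k) > 0" using k by simp
  have \<gamma>_eq: "\<gamma> * real (m choose k) = real (card {j \<in> incr_vecs k m. phi_fin m k T j = t})"
    unfolding \<gamma>_def gamma_density_def using k N by simp
  have lower: "\<rho> * \<gamma> \<le> prob ?A"
  proof -
    have "\<rho> * \<gamma> = fact k * (\<gamma> * real (m choose k)) / real m ^ k" unfolding \<rho>_def by simp
    then show ?thesis using bound[of "\<lambda>s. s = t"] unfolding \<gamma>_eq cardF by simp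
  qed
  have finI: "finite (incr_vecs k m)" unfolding incr_vecs_def
    by (rule finite_subset[of _ "{1..k} \<rightarrow>\<^sub>E {1..m}"]) (auto intro: finite_PiE)
  have "card {j \<in> incr_vecs k m. phi_fin m k T j = t} + card {j \<in> incr_vecs k m. phi_fin m k T j \<noteq> t} = m choose k"
  proof -
    have "card {j \<in> incr_vecs k m. phi_fin m k T j = t} + card {j \<in> incr_vecs k m. phi_fin m k T j \<noteq> t}
       = card ({j \<in> incr_vecs k m. phi_fin m k T j = t} \<union> {j \<in> incr_vecs k m. phi_fin m k T j \<noteq> t})"
      using finI by (intro card_Un_disjoint[symmetric]) auto
    also have "{j \<in> incr_vecs k m. phi_fin m k T j = t} \<union> {j \<in> incr_vecs k m. phi_fin m k T j \<noteq> t}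
       = incr_vecs k m" by blast
    finally show ?thesis by (simp add: card_incr_vecs)
  qed
  then have compl_eq: "real (card {j \<in> incr_vecs k m. phi_fin m k T j \<noteq> t}) = real (m choose k) - \<gamma> * real (m choose k)"
    unfolding \<gamma>_eq by linarith
  have "\<rho> - \<rho> * \<gamma> \<le> prob {\<omega> \<in> space M. tree_at ?K k \<omega> \<noteq> t}"
  proof -
    have "\<rho> - \<rho> * \<gamma> = fact k * (real (m choose k) - \<gamma> * real (m choose k)) / real m ^ k"
      unfolding \<rho>_def by (simp add: right_diff_distrib diff_divide_distrib mult_ac)
    then show ?thesis using bound[of "\<lambda>s. s \<noteq> t"] unfolding compl_eq[symmetric] cardF by simp
  qed
  also have "{\<omega> \<in> space M. tree_at ?K k \<omega> \<noteq> t} = space M - ?A" by auto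
  also have "prob (space M - ?A) = 1 - prob ?A" using A by (rule prob_compl)
  finally have upper: "prob ?A \<le> 1 - \<rho> + \<rho> * \<gamma>" by simp
  have "0 \<le> \<gamma>" unfolding \<gamma>_def gamma_density_def by simp
  have "\<gamma> * real (m choose k) \<le> 1 * real (m choose k)" using compl_eq by simp
  then have "\<gamma> \<le> 1" using N by (rule mult_right_le_imp_le)
  have "\<rho> \<le> 1"
  proof -
    have "real (fact k * (m choose k)) \<le> real (m ^ k)"
      using binomial_fact_pow[of m k] by (simp only: of_nat_le_iff mult.commute)
    then show ?thesis unfolding \<rho>_def using m by (simp add: divide_le_eq_1)
  qed
  have "(1 - \<rho>) * \<gamma> \<le> (1 - \<rho>) * 1"
    by (rule mult_left_mono) (use \<open>\<rho> \<le> 1\<close> \<open>\<gamma> \<le> 1\<close> in auto)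
  moreover have "0 \<le> (1 - \<rho>) * \<gamma>"
    by (rule mult_nonneg_nonneg) (use \<open>\<rho> \<le> 1\<close> \<open>0 \<le> \<gamma>\<close> in auto)
  ultimately have "\<bar>prob ?A - \<gamma>\<bar> \<le> 1 - \<rho>" using lower upper by (simp add: algebra_simps abs_le_iff)
  then show ?thesis unfolding sample_prob_eq[OF K] \<gamma>_def \<rho>_def .
qed

lemma sample_prob_minus_gamma_tendsto:
  assumes S: "\<And>n. m n \<ge> 1 \<and> S n \<in> STree (m n)" and m: "filterlim m at_top sequentially" and k: "1 \<le> k"
  shows "(\<lambda>n. sample_prob M U (tree_points (m n) (S n)) k t - gamma_density k t (m n) (S n)) \<longlonglongrightarrow> 0"
proof (rule Lim_null_comparison)
  have "\<forall>\<^sub>F n in sequentially. k \<le> m n" using m by (simp add: filterlim_at_top)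
  then show "\<forall>\<^sub>F n in sequentially. norm (sample_prob M U (tree_points (m n) (S n)) k t - gamma_density k t (m n) (S n))
      \<le> 1 - fact k * real (m n choose k) / real (m n) ^ k"
    by eventually_elim (use gamma_density_approx S k in auto)
  have "(\<lambda>n. fact k * real (m n choose k) / real (m n) ^ k) \<longlonglongrightarrow> 1"
    by (rule filterlim_compose[OF injection_density_tendsto m])
  from tendsto_diff[OF tendsto_const this, of 1]
  show "(\<lambda>n. 1 - fact k * real (m n choose k) / real (m n) ^ k) \<longlonglongrightarrow> 0" by simp
qed

text \<open>The truncation of \<open>z\<close> to the unit interval is the distribution function of the uniform law.\<close>

lemma count_below_concentration:
  assumes k: "1 \<le> k" and \<delta>: "0 \<le> \<delta>"
  shows "prob {\<omega> \<in> space M. \<bar>real (count_below k (\<lambda>i. U i \<omega>) z) - real k * max 0 (min 1 z)\<bar> \<ge> real k * \<delta>}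
    \<le> 2 * exp (- 2 * real k * \<delta>\<^sup>2)"
proof -
  define X where "X i \<omega> = indicat_real {..<z} (U i \<omega>)" for i \<omega>
  have X: "indep_vars (\<lambda>_. borel) X {1..k}"
    unfolding X_def using indep_vars_compose2[OF indep_vars_subset[OF indep, of "{1..k}"],
        of "\<lambda>_. indicat_real {..<z}" "\<lambda>_. borel"] by auto
  have Xm: "X i \<in> borel_measurable M" if "i \<ge> 1" for i
    unfolding X_def using that by measurable
  have dX: "distr M borel (X i) = distr M borel (X 1)" if "i \<ge> 1" for i
  proof -
    have *: "distr M borel (X i) = distr (distr M borel (U i)) borel (indicat_real {..<z})" if "i \<ge> 1" for i
      using that by (subst distr_distr) (auto simp: X_def[abs_def] comp_def)
    show ?thesis using *[OF that] *[of 1] unif[OF that] unif[of 1] by simp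
  qed
  interpret H: Hoeffding_ineq_iid M "{1..k}" X "X 1" 0 1 "expectation (X 1)"
  proof unfold_locales
    show "indep_vars (\<lambda>_. borel) X {1..k}" by (rule X)
    show "AE x in M. X 1 x \<in> {0..1}" by (simp add: X_def indicator_def)
    show "random_variable borel (X 1)" by (rule Xm) simp
    show "distr M borel (X i) = distr M borel (X 1)" if "i \<in> {1..k}" for i
      by (rule dX) (use that in simp)
  qed simp_all
  have "expectation (X 1) = max 0 (min 1 z)"
  proof -
    have "expectation (X 1) = (\<integral>\<omega>. indicat_real (U 1 -` {..<z} \<inter> space M) \<omega> \<partial>M)"
      by (intro Bochner_Integration.integral_cong) (auto simp: X_def indicator_def)
    also have "\<dots> = prob (U 1 -` {..<z} \<inter> space M)"
      using measurable_sets[OF U_measurable[of 1], of "{..<z}"] by simp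
    also have "\<dots> = measure lborel ({0..1} \<inter> {..<z})" by (rule prob_U) auto
    also have "\<dots> = max 0 (min 1 z)"
    proof -
      consider "z \<le> 0" | "0 < z" "z \<le> 1" | "1 < z" by linarith
      then show ?thesis
      proof cases
        case 1
        then have "{0..1} \<inter> {..<z} = {}" by auto
        then show ?thesis using 1 by simp
      next
        case 2
        then have "{0..1} \<inter> {..<z} = {0..<z}" by auto
        then show ?thesis using 2 by simp
      next
        case 3
        then have "{0..1} \<inter> {..<z} = {0..1}" by auto
        then show ?thesis using 3 by simp
      qed
    qed
    finally show ?thesis .
  qed
  moreover have "(\<Sum>i\<in>{1..k}. X i \<omega>) = real (count_below k (\<lambda>i. U i \<omega>) z)" for \<omega>
  proof -
    have "(\<Sum>i\<in>{1..k}. X i \<omega>) = (\<Sum>i\<in>{i \<in> {1..k}. U i \<omega> < z}. 1)"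
      by (rule sum.mono_neutral_cong_right) (auto simp: X_def indicator_def)
    then show ?thesis by (simp add: count_below_def)
  qed
  moreover have "prob {x \<in> space M. real k * \<delta> \<le> \<bar>(\<Sum>i = 1..k. X i x) - real (card {1..k}) * expectation (X 1)\<bar>}
     \<le> 2 * exp (-2 * (real k * \<delta>)\<^sup>2 / (real (card {1..k}) * (1 - 0)\<^sup>2))"
    using k \<delta> by (intro H.Hoeffding_ineq_abs_ge) auto
  moreover have "-2 * (real k * \<delta>)\<^sup>2 / (real k * (1 - 0)\<^sup>2) = - 2 * real k * \<delta>\<^sup>2"
    using k by (simp add: power2_eq_square)
  ultimately show ?thesis by simp
qed

text \<open>Let \<open>(x, y)\<close> be in \<open>K1\<close> and at distance at least \<open>\<epsilon>\<close>, in one coordinate, from every point of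
  \<open>K2\<close>. With probability above one half all counts at \<open>x\<close>, \<open>y\<close>, \<open>x \<plusminus> \<epsilon>\<close> and \<open>y \<plusminus> \<epsilon>\<close> are close to
  their means. On this event the tree sampled from \<open>K1\<close> contains an interval with ends
  near \<open>k x\<close> and \<open>k y\<close>, and the tree sampled from \<open>K2\<close> does not. The two laws
  would give such trees different probabilities.\<close>

lemma sample_prob_determines_subset:
  assumes K1: "K1 \<in> STree_inf" and K2: "K2 \<in> STree_inf"
    and eq: "\<And>k T. k \<ge> 1 \<Longrightarrow> T \<in> STree k \<Longrightarrow> sample_prob M U K1 k T = sample_prob M U K2 k T"
  shows "K1 \<subseteq> K2"
proof (rule ccontr)
  assume "\<not> K1 \<subseteq> K2"
  then obtain x y where xy: "(x, y) \<in> K1" "(x, y) \<notin> K2" by auto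
  have b: "0 \<le> x" "x \<le> y" "y \<le> 1" using K1 xy(1) unfolding STree_inf_def by blast+
  moreover have "x \<noteq> y" using K2 xy(2) b unfolding STree_inf_def by auto
  ultimately have lt: "x < y" by simp
  have "open (- K2)" using K2 unfolding STree_inf_def by (auto intro: compact_imp_closed)
  then obtain d where d: "0 < d" "ball (x, y) d \<subseteq> - K2" using xy(2) openE[of "- K2" "(x, y)"] by blast
  \<comment> \<open>Half of \<open>y - x\<close> leaves room for at least two sample points between \<open>x\<close> and \<open>y\<close>;
    with \<open>\<delta> = \<epsilon> / 2\<close> below, the windows at \<open>z\<close> and at \<open>z \<plusminus> \<epsilon>\<close> do not overlap.\<close>
  define \<epsilon> where "\<epsilon> = min (d / 2) ((y - x) / 2)"
  have \<epsilon>: "0 < \<epsilon>" "2 * \<epsilon> \<le> d" "2 * \<epsilon> \<le> y - x" using min.cobounded1[of "d / 2" "(y - x) / 2"] min.cobounded2[of "d / 2" "(y - x) / 2"] d(1) lt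
    unfolding \<epsilon>_def[symmetric] by (auto simp: \<epsilon>_def)
  have off: "\<epsilon> \<le> \<bar>x' - x\<bar> \<or> \<epsilon> \<le> \<bar>y' - y\<bar>" if "(x', y') \<in> K2" for x' y'
  proof (rule ccontr)
    assume "\<not> ?thesis"
    then have "l1_dist (x', y') (x, y) < d" using \<epsilon> unfolding l1_dist_def by simp
    then have "(x', y') \<in> ball (x, y) d" using dist_le_l1_dist[of "(x', y')" "(x, y)"] by (simp add: dist_commute)
    then show False using d(2) that by blast
  qed
  define \<delta> where "\<delta> = \<epsilon> / 2"
  define cl where "cl z = max 0 (min 1 z)" for z :: real
  define Z where "Z = {x, y, x - \<epsilon>, x + \<epsilon>, y - \<epsilon>, y + \<epsilon>}"
  have "(\<lambda>k. 12 * exp (- 2 * real k * \<delta>\<^sup>2)) \<longlonglongrightarrow> 0"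
  proof -
    have "0 < 2 * \<delta>\<^sup>2" unfolding \<delta>_def using \<epsilon> by simp
    then have "exp (- (2 * \<delta>\<^sup>2)) < 1" by simp
    then have "(\<lambda>k. 12 * exp (- (2 * \<delta>\<^sup>2)) ^ k) \<longlonglongrightarrow> 12 * 0"
      by (intro tendsto_mult tendsto_const LIMSEQ_realpow_zero) auto
    moreover have "exp (- (2 * \<delta>\<^sup>2)) ^ k = exp (- 2 * real k * \<delta>\<^sup>2)" for k
      by (simp add: exp_of_nat_mult[symmetric] mult_ac)
    ultimately show ?thesis by simp
  qed
  then have "\<forall>\<^sub>F k in sequentially. 12 * exp (- 2 * real k * \<delta>\<^sup>2) < 1 / 2" by (rule order_tendstoD) simp
  moreover have "\<forall>\<^sub>F k in sequentially. 4 / (y - x) \<le> real k"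
    by (intro eventually_sequentiallyI[of "nat \<lceil>4 / (y - x)\<rceil>"]) linarith
  moreover have "\<forall>\<^sub>F k in sequentially. (1::nat) \<le> k" by (rule eventually_ge_at_top)
  ultimately have "\<forall>\<^sub>F k in sequentially. 12 * exp (- 2 * real k * \<delta>\<^sup>2) < 1 / 2 \<and> 4 / (y - x) \<le> real k \<and> 1 \<le> k"
    by eventually_elim simp
  from eventually_happens'[OF sequentially_bot this] obtain k where
    k: "12 * exp (- 2 * real k * \<delta>\<^sup>2) < 1 / 2" "4 / (y - x) \<le> real k" "1 \<le> k" by blast
  define N where "N \<omega> z = real (count_below k (\<lambda>i. U i \<omega>) z)" for \<omega> z
  define bad where "bad z = {\<omega> \<in> space M. \<bar>N \<omega> z - real k * cl z\<bar> \<ge> real k * \<delta>}" for z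
  have Nm: "(\<lambda>\<omega>. N \<omega> z) \<in> borel_measurable M" for z
  proof -
    have "(\<lambda>\<omega>. count_below k (\<lambda>i. U i \<omega>) z) \<in> measurable M (count_space {0..k})"
      unfolding measurable_count_space_eq2[OF finite_atLeastAtMost]
    proof (intro conjI ballI)
      fix \<alpha> assume "\<alpha> \<in> {0..k}"
      show "(\<lambda>\<omega>. count_below k (\<lambda>i. U i \<omega>) z) -` {\<alpha>} \<inter> space M \<in> events"
        using measurable_count_below_eq[of k U M z \<alpha>] by (simp add: vimage_def Int_def conj_commute)
    qed (auto simp: count_below_le)
    then show ?thesis unfolding N_def by (rule measurable_compose) simp
  qed
  have bad_m: "bad z \<in> events" for z unfolding bad_def using Nm[of z] by measurable
  have finZ: "finite Z" "card Z \<le> 6"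
  proof -
    show "finite Z" unfolding Z_def by simp
    show "card Z \<le> 6"
      using card_length[of "[x, y, x - \<epsilon>, x + \<epsilon>, y - \<epsilon>, y + \<epsilon>]"] unfolding Z_def by simp
  qed
  define G where "G = space M - (\<Union>z\<in>Z. bad z)"
  have Gm: "G \<in> events" unfolding G_def using bad_m finZ by (intro sets.Diff sets.finite_UN) auto
  have "prob (\<Union>z\<in>Z. bad z) \<le> (\<Sum>z\<in>Z. prob (bad z))"
    using finZ bad_m by (intro finite_measure_subadditive_finite) auto
  also have "\<dots> \<le> (\<Sum>z\<in>Z. 2 * exp (- 2 * real k * \<delta>\<^sup>2))"
    unfolding bad_def N_def cl_def using k(3) \<epsilon>
    by (intro sum_mono count_below_concentration) (auto simp: \<delta>_def)
  also have "\<dots> \<le> 6 * (2 * exp (- 2 * real k * \<delta>\<^sup>2))"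
  proof -
    have "real (card Z) \<le> 6" using finZ(2) by simp
    then show ?thesis by (simp add: mult_right_mono)
  qed
  finally have "prob (\<Union>z\<in>Z. bad z) < 1 / 2" using k(1) by simp
  moreover have "prob G = 1 - prob (\<Union>z\<in>Z. bad z)"
    unfolding G_def using bad_m finZ by (intro prob_compl sets.finite_UN) auto
  ultimately have pG: "prob G > 1 / 2" by simp
  have conc: "\<bar>N \<omega> z - real k * cl z\<bar> < real k * \<delta>" if "\<omega> \<in> G" "z \<in> Z" for \<omega> z
    using that unfolding G_def bad_def by force
  define \<A> where "\<A> = {T. \<exists>\<alpha> \<beta>. {\<alpha> + 1..\<beta>} \<in> T \<and> \<alpha> + 1 < \<beta> \<and>
     \<bar>real \<alpha> - real k * x\<bar> < real k * \<delta> \<and> \<bar>real \<beta> - real k * y\<bar> < real k * \<delta>}"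
  have clx: "cl x = x" "cl y = y" unfolding cl_def using b by auto
  have k0: "0 < real k" using k(3) by simp
  have "AE \<omega> in M. U i \<omega> \<notin> {x, y}" if "i \<in> {1..k}" for i
    using that by (intro AE_U_notin_countable) auto
  then have "AE \<omega> in M. \<forall>i\<in>{1..k}. U i \<omega> \<notin> {x, y}" by (intro AE_finite_allI) auto
  then have ae1: "AE \<omega> in M. \<omega> \<in> G \<longrightarrow> tree_at K1 k \<omega> \<in> \<A>"
  proof eventually_elim
    case (elim \<omega>)
    show ?case
    proof
      assume G: "\<omega> \<in> G"
      let ?c = "count_below k (\<lambda>i. U i \<omega>)"
      have c: "\<bar>real (?c x) - real k * x\<bar> < real k * \<delta>" "\<bar>real (?c y) - real k * y\<bar> < real k * \<delta>"
        using conc[OF G, of x] conc[OF G, of y] unfolding N_def clx Z_def by auto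
      have "x \<notin> (\<lambda>i. U i \<omega>) ` {1..k}" "y \<notin> (\<lambda>i. U i \<omega>) ` {1..k}" using elim by auto
      then have "{?c x + 1..?c y} \<in> tree_at K1 k \<omega>"
        unfolding tree_at_def sample_tree_def using xy(1)
        by (intro UnI2 CollectI exI[of _ x] exI[of _ y]) simp
      moreover have "?c x + 1 < ?c y"
      proof -
        have "4 \<le> real k * (y - x)" using k(2) lt by (simp add: field_simps)
        moreover have "real k * (2 * \<epsilon>) \<le> real k * (y - x)" using \<epsilon>(3) k0 by (intro mult_left_mono) auto
        ultimately have "2 + real k * \<epsilon> \<le> real k * (y - x)" by (simp add: algebra_simps)
        moreover have "real k * \<delta> + real k * \<delta> = real k * \<epsilon>" unfolding \<delta>_def by simp
        moreover have "real k * (y - x) = real k * y - real k * x" by (rule right_diff_distrib)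
        ultimately have "real (?c x) + 2 < real (?c y)" using c by linarith
        then show ?thesis by simp
      qed
      ultimately show "tree_at K1 k \<omega> \<in> \<A>" unfolding \<A>_def using c by blast
    qed
  qed
  have not2: "tree_at K2 k \<omega> \<notin> \<A>" if G: "\<omega> \<in> G" for \<omega>
  proof
    assume "tree_at K2 k \<omega> \<in> \<A>"
    then obtain \<alpha> \<beta> where ab: "{\<alpha> + 1..\<beta>} \<in> sample_tree k K2 (\<lambda>i. U i \<omega>)" "\<alpha> + 1 < \<beta>"
      "\<bar>real \<alpha> - real k * x\<bar> < real k * \<delta>" "\<bar>real \<beta> - real k * y\<bar> < real k * \<delta>"
      unfolding \<A>_def tree_at_def by blast
    obtain x' y' where p: "(x', y') \<in> K2" "N \<omega> x' = real \<alpha>" "N \<omega> y' = real \<beta>"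
      using sample_tree_interval_ge2[OF ab(1) refl ab(2)] unfolding N_def by metis
    have b': "0 \<le> x'" "x' \<le> 1" "0 \<le> y'" "y' \<le> 1" using K2 p(1) unfolding STree_inf_def by force+
    have Nmono: "N \<omega> u \<le> N \<omega> v" if "u \<le> v" for u v
      unfolding N_def using count_below_mono[OF that] by simp
    have close: "\<bar>u - z\<bar> < \<epsilon>" if u: "0 \<le> u" "u \<le> 1" and Nu: "\<bar>N \<omega> u - real k * z\<bar> < real k * \<delta>"
        and z: "z - \<epsilon> \<in> Z" "z + \<epsilon> \<in> Z" for u z
    proof (rule ccontr)
      assume "\<not> ?thesis"
      have kd: "real k * \<delta> + real k * \<delta> = real k * \<epsilon>" unfolding \<delta>_def by simp
      have expand: "real k * (z - \<epsilon>) = real k * z - real k * \<epsilon>"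
        "real k * (z + \<epsilon>) = real k * z + real k * \<epsilon>" by (simp_all add: algebra_simps)
      from \<open>\<not> \<bar>u - z\<bar> < \<epsilon>\<close> consider "u \<le> z - \<epsilon>" | "z + \<epsilon> \<le> u" by linarith
      then show False
      proof cases
        case 1
        then have c: "cl (z - \<epsilon>) \<le> z - \<epsilon>" unfolding cl_def using u by auto
        have "N \<omega> u \<le> N \<omega> (z - \<epsilon>)" using Nmono 1 by blast
        also have "\<dots> < real k * cl (z - \<epsilon>) + real k * \<delta>" using conc[OF G z(1)] by linarith
        also have "\<dots> \<le> real k * (z - \<epsilon>) + real k * \<delta>" using c k0 by (simp add: mult_left_mono)
        finally have "N \<omega> u < real k * z - real k * \<epsilon> + real k * \<delta>" unfolding expand .
        moreover have "real k * z - real k * \<delta> < N \<omega> u" using Nu unfolding abs_less_iff by simp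
        ultimately have "real k * \<epsilon> < real k * \<delta> + real k * \<delta>" by linarith
        then show False using kd by simp
      next
        case 2
        then have c: "z + \<epsilon> \<le> cl (z + \<epsilon>)" unfolding cl_def using u by auto
        have "real k * (z + \<epsilon>) - real k * \<delta> \<le> real k * cl (z + \<epsilon>) - real k * \<delta>" using c k0 by (simp add: mult_left_mono)
        also have "\<dots> < N \<omega> (z + \<epsilon>)" using conc[OF G z(2)] by linarith
        also have "\<dots> \<le> N \<omega> u" using Nmono 2 by blast
        finally have "real k * z + real k * \<epsilon> - real k * \<delta> < N \<omega> u" unfolding expand .
        moreover have "N \<omega> u < real k * z + real k * \<delta>" using Nu unfolding abs_less_iff by simp
        ultimately have "real k * \<epsilon> < real k * \<delta> + real k * \<delta>" by linarith
        then show False using kd by simp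
      qed
    qed
    have "\<bar>x' - x\<bar> < \<epsilon>" by (rule close) (use b' ab p in \<open>auto simp: Z_def\<close>)
    moreover have "\<bar>y' - y\<bar> < \<epsilon>" by (rule close) (use b' ab p in \<open>auto simp: Z_def\<close>)
    ultimately show False using off[OF p(1)] by simp
  qed
  have "prob G \<le> prob {\<omega> \<in> space M. tree_at K1 k \<omega> \<in> \<A>}"
    using ae1 tree_at_sets by (intro finite_measure_mono_AE) (auto simp: G_def)
  also have "\<dots> = prob {\<omega> \<in> space M. tree_at K2 k \<omega> \<in> \<A>}"
    unfolding prob_tree_at_in[OF K1] prob_tree_at_in[OF K2] using eq k(3) by (intro sum.cong) auto
  also have "\<dots> \<le> prob (space M - G)"
    using not2 Gm by (intro finite_measure_mono) auto
  also have "\<dots> = 1 - prob G" using Gm by (rule prob_compl)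
  finally show False using pG by simp
qed

end

section \<open>Laws of erased-Schroeder tree processes\<close>

abbreviation path_fibre :: "nat \<Rightarrow> (nat set set \<times> nat) set" where
  "path_fibre n \<equiv> InSy n \<times> {1..n + 1}"

lemma topspace_path: "topspace path_topology = PiE {1..} path_fibre"
  unfolding path_topology_def by simp

lemma space_path_borel: "space path_borel = topspace path_topology"
  unfolding path_borel_def by (intro space_measure_of) (auto dest: openin_subset)

lemma open_in_path_borel: "openin path_topology V \<Longrightarrow> V \<in> sets path_borel"
  unfolding path_borel_def by (subst sets_measure_of) (auto dest: openin_subset)

lemma openin_coordinate:
  assumes "n \<ge> 1"
  shows "openin path_topology {\<omega> \<in> topspace path_topology. \<omega> n \<in> A}"
proof -
  have "continuous_map path_topology (discrete_topology (path_fibre n)) (\<lambda>\<omega>. \<omega> n)"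
    unfolding path_topology_def using assms by (intro continuous_map_product_projection) simp
  moreover have "openin (discrete_topology (path_fibre n)) (A \<inter> path_fibre n)" by simp
  ultimately have "openin path_topology {\<omega> \<in> topspace path_topology. \<omega> n \<in> A \<inter> path_fibre n}"
    by (rule openin_continuous_map_preimage)
  moreover have "{\<omega> \<in> topspace path_topology. \<omega> n \<in> A \<inter> path_fibre n} = {\<omega> \<in> topspace path_topology. \<omega> n \<in> A}"
    using assms unfolding topspace_path by (auto simp: PiE_iff)
  ultimately show ?thesis by simp
qed

definition cylinder :: "nat \<Rightarrow> path \<Rightarrow> path set" where
  "cylinder N c = {\<omega> \<in> topspace path_topology. \<forall>i\<in>{1..N}. \<omega> i = c i}"

lemma openin_cylinder: "openin path_topology (cylinder N c)"
proof (cases "N = 0")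
  case True
  then show ?thesis by (simp add: cylinder_def)
next
  case False
  then have "1 \<in> {1..N}" by simp
  then have "cylinder N c = (\<Inter>i\<in>{1..N}. {\<omega> \<in> topspace path_topology. \<omega> i \<in> {c i}})"
    unfolding cylinder_def by blast
  moreover have "openin path_topology (\<Inter>i\<in>{1..N}. {\<omega> \<in> topspace path_topology. \<omega> i \<in> {c i}})"
    using False by (intro openin_INT2 openin_coordinate) auto
  ultimately show ?thesis by simp
qed

text \<open>The factors are discrete, so fixing finitely many coordinates gives a neighbourhood base.\<close>

lemma open_contains_cylinder:
  assumes V: "openin path_topology V" and x: "x \<in> V"
  shows "\<exists>N. cylinder N x \<subseteq> V"
proof -
  obtain W where W: "finite {i \<in> {1..}. W i \<noteq> topspace (discrete_topology (path_fibre i))}"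
    "x \<in> PiE {1..} W" "PiE {1..} W \<subseteq> V"
    using V x unfolding path_topology_def openin_product_topology_alt by blast
  obtain N where N: "\<And>i. i \<in> {i \<in> {1..}. W i \<noteq> path_fibre i} \<Longrightarrow> i \<le> N"
    using finite_nat_set_iff_bounded_le[THEN iffD1, OF W(1)] by auto
  have "cylinder N x \<subseteq> PiE {1..} W"
  proof
    fix y assume y: "y \<in> cylinder N x"
    then have yt: "y \<in> PiE {1..} path_fibre" unfolding cylinder_def topspace_path by simp
    show "y \<in> PiE {1..} W"
    proof (rule PiE_I)
      fix i :: nat assume i: "i \<in> {1..}"
      show "y i \<in> W i"
      proof (cases "i \<le> N")
        case True
        then have "y i = x i" using y i unfolding cylinder_def by simp
        then show ?thesis using W(2) i by auto
      next
        case False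
        then have "W i = path_fibre i" using N[of i] i by auto
        then show ?thesis using yt i by auto
      qed
    qed (use yt in \<open>auto simp: PiE_iff extensional_def\<close>)
  qed
  then show ?thesis using W(3) by blast
qed

definition cylinders :: "path set set" where
  "cylinders = {cylinder N c |N c. True}"

lemma countable_point_cylinders: "countable (\<Union>N. cylinder N ` topspace path_topology)"
proof (rule countable_UN)
  fix N
  have "cylinder N ` topspace path_topology \<subseteq> cylinder N ` PiE {1..N} path_fibre"
  proof
    fix C assume "C \<in> cylinder N ` topspace path_topology"
    then obtain x where x: "x \<in> topspace path_topology" "C = cylinder N x" by blast
    have "C = cylinder N (restrict x {1..N})" unfolding x(2) cylinder_def by auto
    moreover have "restrict x {1..N} \<in> PiE {1..N} path_fibre"
      using x(1) unfolding topspace_path by (auto simp: PiE_iff)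
    ultimately show "C \<in> cylinder N ` PiE {1..N} path_fibre" by blast
  qed
  moreover have "finite (PiE {1..N} path_fibre)" by (intro finite_PiE) (auto simp: finite_InSy)
  ultimately have "finite (cylinder N ` topspace path_topology)"
    by (rule finite_subset[OF _ finite_imageI])
  then show "countable (cylinder N ` topspace path_topology)" by (rule countable_finite)
qed simp

lemma cylinders_Pow: "cylinders \<subseteq> Pow (topspace path_topology)"
  unfolding cylinders_def cylinder_def by auto

text \<open>Every open set is the union of the cylinders around its points that it contains, and there are only
  countably many nonempty cylinders, because each coordinate has finitely many values.\<close>

lemma sets_path_borel: "sets path_borel = sigma_sets (topspace path_topology) cylinders"
proof -
  have "V \<in> sigma_sets (topspace path_topology) cylinders" if V: "openin path_topology V" for V
  proof -
    let ?F = "{C \<in> (\<Union>N. cylinder N ` topspace path_topology). C \<subseteq> V}"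
    have "V = \<Union>?F"
    proof (intro subset_antisym subsetI)
      fix x assume x: "x \<in> V"
      then have xt: "x \<in> topspace path_topology" using openin_subset[OF V] by blast
      obtain N where "cylinder N x \<subseteq> V" using open_contains_cylinder[OF V x] by blast
      moreover have "x \<in> cylinder N x" using xt unfolding cylinder_def by simp
      ultimately show "x \<in> \<Union>?F" using xt by blast
    qed blast
    moreover have "\<Union>?F \<in> sigma_sets (topspace path_topology) cylinders"
    proof (rule sigma_sets_UNION)
      show "countable ?F" by (rule countable_subset[OF _ countable_point_cylinders]) blast
      fix C assume "C \<in> ?F"
      then have "C \<in> cylinders" unfolding cylinders_def by blast
      then show "C \<in> sigma_sets (topspace path_topology) cylinders" by (rule sigma_sets.Basic)
    qed
    ultimately show ?thesis by simp
  qed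
  then have "{V. openin path_topology V} \<subseteq> sigma_sets (topspace path_topology) cylinders" by blast
  moreover have "cylinders \<subseteq> sigma_sets (topspace path_topology) {V. openin path_topology V}"
    unfolding cylinders_def using openin_cylinder sigma_sets.Basic by blast
  moreover have "sets path_borel = sigma_sets (topspace path_topology) {V. openin path_topology V}"
    unfolding path_borel_def by (intro sets_measure_of) (auto dest: openin_subset)
  ultimately show ?thesis by (simp only:) (rule sigma_sets_eqI; blast)
qed

lemma empty_in_cylinders: "{} \<in> cylinders"
proof -
  \<comment> \<open>The value \<open>0\<close> is not allowed for the second component, so no path meets this condition.\<close>
  have "cylinder 1 (\<lambda>_. ({}, 0)) = {}"
    unfolding cylinder_def topspace_path by (force simp: PiE_iff)
  then show ?thesis unfolding cylinders_def by blast
qed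

lemma Int_stable_cylinders: "Int_stable cylinders"
proof (rule Int_stableI)
  have *: "cylinder N c \<inter> cylinder N' c' \<in> cylinders" if "N \<le> N'" for N N' c c'
  proof (cases "\<forall>i\<in>{1..N}. c i = c' i")
    case True
    then have "cylinder N c \<inter> cylinder N' c' = cylinder N' c'" using that unfolding cylinder_def by auto
    then show ?thesis unfolding cylinders_def by auto
  next
    case False
    then obtain i where i: "i \<in> {1..N}" "c i \<noteq> c' i" by blast
    then have "cylinder N c \<inter> cylinder N' c' = {}" using that unfolding cylinder_def by force
    then show ?thesis using empty_in_cylinders by simp
  qed
  fix a b assume "a \<in> cylinders" "b \<in> cylinders"
  then obtain N c N' c' where ab: "a = cylinder N c" "b = cylinder N' c'" unfolding cylinders_def by blast
  show "a \<inter> b \<in> cylinders"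
    using *[of N N' c c'] *[of N' N c' c] unfolding ab by (cases "N \<le> N'") (auto simp: Int_commute)
qed

lemma erased_processD:
  assumes "erased_process M T \<eta>" "n \<ge> 1"
  shows "T n \<in> measurable M (count_space (InSy n))" "\<eta> n \<in> measurable M (count_space {1..n + 1})"
    "AE \<omega> in M. T n \<omega> \<in> STree n \<and> \<eta> n \<omega> \<in> {1..n + 1}"
    "distr M (count_space {1..n + 1}) (\<eta> n) = uniform_count_measure {1..n + 1}"
    "prob_space.indep_set M {\<eta> n -` A \<inter> space M |A. A \<subseteq> {1..n + 1}}
       (sigma_sets (space M)
         (\<Union>m\<in>{n + 1..}. {(\<lambda>\<omega>. (T m \<omega>, \<eta> m \<omega>)) -` A \<inter> space M |A. A \<subseteq> path_fibre m}))"
    "AE \<omega> in M. T n \<omega> = erase (T (n + 1) \<omega>) (\<eta> n \<omega>)"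
  using assms unfolding erased_process_def by blast+

definition path_of :: "(nat \<Rightarrow> 'w \<Rightarrow> nat set set) \<Rightarrow> (nat \<Rightarrow> 'w \<Rightarrow> nat) \<Rightarrow> 'w \<Rightarrow> path" where
  "path_of T \<eta> \<omega> = (\<lambda>n\<in>{1..}. (T n \<omega>, \<eta> n \<omega>))"

lemma process_law_eq: "process_law M T \<eta> = distr M path_borel (path_of T \<eta>)"
  unfolding process_law_def path_of_def ..

lemma erased_process_values:
  assumes "erased_process M T \<eta>" "n \<ge> 1" "\<omega> \<in> space M"
  shows "T n \<omega> \<in> InSy n" "\<eta> n \<omega> \<in> {1..n + 1}"
  using measurable_space[OF erased_processD(1)[OF assms(1,2)] assms(3)]
    measurable_space[OF erased_processD(2)[OF assms(1,2)] assms(3)] by auto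

lemma erased_process_event:
  assumes P: "erased_process M T \<eta>" and n: "n \<ge> 1"
  shows "{\<omega> \<in> space M. (T n \<omega>, \<eta> n \<omega>) \<in> A} \<in> sets M"
proof -
  have "{\<omega> \<in> space M. (T n \<omega>, \<eta> n \<omega>) \<in> A}
     = (\<Union>p\<in>A \<inter> path_fibre n. (T n -` {fst p} \<inter> space M) \<inter> (\<eta> n -` {snd p} \<inter> space M))"
    using erased_process_values[OF P n] by force
  moreover have "finite (A \<inter> path_fibre n)" by (simp add: finite_InSy)
  moreover have "(T n -` {fst p} \<inter> space M) \<inter> (\<eta> n -` {snd p} \<inter> space M) \<in> sets M" if "p \<in> A \<inter> path_fibre n" for p
    using that by (intro sets.Int measurable_sets[OF erased_processD(1)[OF P n]]
        measurable_sets[OF erased_processD(2)[OF P n]]) auto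
  ultimately show ?thesis by (simp only:) (intro sets.finite_UN)
qed

lemma path_of_measurable:
  assumes P: "erased_process M T \<eta>"
  shows "path_of T \<eta> \<in> measurable M path_borel"
proof (rule measurable_sigma_sets[OF sets_path_borel cylinders_Pow])
  have top: "path_of T \<eta> \<omega> \<in> topspace path_topology" if "\<omega> \<in> space M" for \<omega>
    unfolding topspace_path path_of_def using erased_process_values[OF P _ that] by auto
  then show "path_of T \<eta> \<in> space M \<rightarrow> topspace path_topology" by blast
  fix C assume "C \<in> cylinders"
  then obtain N c where C: "C = cylinder N c" unfolding cylinders_def by blast
  have "path_of T \<eta> -` C \<inter> space M = {\<omega> \<in> space M. \<forall>i\<in>{1..N}. (T i \<omega>, \<eta> i \<omega>) \<in> {c i}}"
    unfolding C cylinder_def using top by (auto simp: path_of_def)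
  also have "\<dots> \<in> sets M"
    by (intro sets.sets_Collect_finite_All erased_process_event[OF P]) auto
  finally show "path_of T \<eta> -` C \<inter> space M \<in> sets M" .
qed

definition future_events ::
    "'w measure \<Rightarrow> (nat \<Rightarrow> 'w \<Rightarrow> nat set set) \<Rightarrow> (nat \<Rightarrow> 'w \<Rightarrow> nat) \<Rightarrow> nat \<Rightarrow> 'w set set" where
  "future_events M T \<eta> n = sigma_sets (space M)
     (\<Union>m\<in>{n + 1..}. {(\<lambda>\<omega>. (T m \<omega>, \<eta> m \<omega>)) -` A \<inter> space M |A. A \<subseteq> path_fibre m})"

lemma future_events_coordinate:
  assumes P: "erased_process M T \<eta>" and m: "n + 1 \<le> m"
  shows "{\<omega> \<in> space M. (T m \<omega>, \<eta> m \<omega>) \<in> A} \<in> future_events M T \<eta> n"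
proof -
  have "{\<omega> \<in> space M. (T m \<omega>, \<eta> m \<omega>) \<in> A} = (\<lambda>\<omega>. (T m \<omega>, \<eta> m \<omega>)) -` (A \<inter> path_fibre m) \<inter> space M"
    using erased_process_values[OF P, of m] m by auto
  then have "{\<omega> \<in> space M. (T m \<omega>, \<eta> m \<omega>) \<in> A}
      \<in> {(\<lambda>\<omega>. (T m \<omega>, \<eta> m \<omega>)) -` A \<inter> space M |A. A \<subseteq> path_fibre m}" by blast
  then show ?thesis unfolding future_events_def using m by (intro sigma_sets.Basic) auto
qed

text \<open>Backward induction: given the future, \<open>\<eta>\<^sub>j\<close> is uniform and \<open>T\<^sub>j\<close> is a function of \<open>\<eta>\<^sub>j\<close> and
  the next tree, so each step contributes the factor \<open>1 / (j + 1)\<close> or zero. The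
  recursion starts from the tree at \<open>N + 1\<close>, since \<open>\<eta>\<^sub>N\<close> need not be independent of \<open>T\<^sub>N\<close>.\<close>

lemma erased_process_cylinder_prob:
  fixes c :: path
  assumes P: "erased_process M T \<eta>" and j: "1 \<le> j" "j \<le> N + 1"
  shows "measure M {\<omega> \<in> space M. T (N + 1) \<omega> = t \<and> (\<forall>i\<in>{j..N}. (T i \<omega>, \<eta> i \<omega>) = c i)}
    = measure M {\<omega> \<in> space M. T (N + 1) \<omega> = t} *
      (\<Prod>i\<in>{j..N}. if erase (if i < N then fst (c (i + 1)) else t) (snd (c i)) = fst (c i) \<and> snd (c i) \<in> {1..i + 1}
         then 1 / real (i + 1) else 0)"
  using j(2,1)
proof (induction rule: inc_induct)
  case base
  then show ?case by simp
next
  case (step j)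
  interpret prob_space M using P unfolding erased_process_def by simp
  have j1: "1 \<le> j" "j \<le> N" using step by auto
  let ?t = "if j < N then fst (c (j + 1)) else t"
  let ?E = "{\<omega> \<in> space M. T (N + 1) \<omega> = t \<and> (\<forall>i\<in>{Suc j..N}. (T i \<omega>, \<eta> i \<omega>) = c i)}"
  let ?E' = "{\<omega> \<in> space M. T (N + 1) \<omega> = t \<and> (\<forall>i\<in>{j..N}. (T i \<omega>, \<eta> i \<omega>) = c i)}"
  let ?H = "{\<omega> \<in> space M. \<eta> j \<omega> = snd (c j)}"
  have E_fut: "?E \<in> future_events M T \<eta> j"
  proof -
    interpret F: sigma_algebra "space M" "future_events M T \<eta> j"
      unfolding future_events_def by (rule sigma_algebra_sigma_sets) auto
    have "?E = {\<omega> \<in> space M. (T (N + 1) \<omega>, \<eta> (N + 1) \<omega>) \<in> {t} \<times> UNIV}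
       \<inter> {\<omega> \<in> space M. \<forall>i\<in>{Suc j..N}. (T i \<omega>, \<eta> i \<omega>) \<in> {c i}}" by auto
    moreover have "{\<omega> \<in> space M. (T (N + 1) \<omega>, \<eta> (N + 1) \<omega>) \<in> {t} \<times> UNIV} \<in> future_events M T \<eta> j"
      using j1 by (intro future_events_coordinate[OF P]) simp
    moreover have "{\<omega> \<in> space M. \<forall>i\<in>{Suc j..N}. (T i \<omega>, \<eta> i \<omega>) \<in> {c i}} \<in> future_events M T \<eta> j"
      by (intro F.sets_Collect_finite_All future_events_coordinate[OF P]) auto
    ultimately show ?thesis by (simp only: F.Int)
  qed
  have ind: "indep_set {\<eta> j -` A \<inter> space M |A. A \<subseteq> {1..j + 1}} (future_events M T \<eta> j)"
    using erased_processD(5)[OF P j1(1)] unfolding future_events_def .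
  have E_ev: "?E \<in> events" using E_fut indep_setD_ev2[OF ind] by blast
  have E'_ev: "?E' \<in> events"
  proof -
    have "?E' = {\<omega> \<in> space M. (T (N + 1) \<omega>, \<eta> (N + 1) \<omega>) \<in> {t} \<times> UNIV}
       \<inter> {\<omega> \<in> space M. \<forall>i\<in>{j..N}. (T i \<omega>, \<eta> i \<omega>) \<in> {c i}}" by auto
    moreover have "\<dots> \<in> events"
      using j1 by (intro sets.Int sets.sets_Collect_finite_All erased_process_event[OF P]) auto
    ultimately show ?thesis by simp
  qed
  have split: "{j..N} = insert j {Suc j..N}" using j1 by auto
  have next_T: "T (j + 1) \<omega> = ?t" if "\<omega> \<in> ?E" for \<omega>
  proof (cases "j < N")
    case True
    then have "(T (j + 1) \<omega>, \<eta> (j + 1) \<omega>) = c (j + 1)" using that by auto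
    then show ?thesis using True by (metis fst_conv)
  next
    case False
    then have "j = N" using j1 by simp
    then show ?thesis using that by simp
  qed
  have IH: "prob ?E = prob {\<omega> \<in> space M. T (N + 1) \<omega> = t} *
      (\<Prod>i\<in>{Suc j..N}. if erase (if i < N then fst (c (i + 1)) else t) (snd (c i)) = fst (c i) \<and> snd (c i) \<in> {1..i + 1}
         then 1 / real (i + 1) else 0)"
    using step by simp
  have "prob ?E' = (if erase ?t (snd (c j)) = fst (c j) \<and> snd (c j) \<in> {1..j + 1} then 1 / real (j + 1) else 0) * prob ?E"
  proof (cases "erase ?t (snd (c j)) = fst (c j) \<and> snd (c j) \<in> {1..j + 1}")
    case True
    have H: "?H = \<eta> j -` {snd (c j)} \<inter> space M" by auto
    have "prob ?H = measure (distr M (count_space {1..j + 1}) (\<eta> j)) {snd (c j)}"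
      unfolding H using True by (intro measure_distr[symmetric] erased_processD(2)[OF P j1(1)]) auto
    also have "\<dots> = 1 / real (j + 1)"
      unfolding erased_processD(4)[OF P j1(1)] using True by (subst measure_uniform_count_measure) auto
    finally have pH: "prob ?H = 1 / real (j + 1)" .
    have H_ev: "?H \<in> {\<eta> j -` A \<inter> space M |A. A \<subseteq> {1..j + 1}}" unfolding H using True by blast
    have "prob ?E' = prob (?H \<inter> ?E)"
    proof (rule finite_measure_eq_AE)
      show "AE \<omega> in M. \<omega> \<in> ?E' \<longleftrightarrow> \<omega> \<in> ?H \<inter> ?E"
        using erased_processD(6)[OF P j1(1)]
      proof eventually_elim
        case (elim \<omega>)
        show ?case
        proof
          assume "\<omega> \<in> ?E'"
          then show "\<omega> \<in> ?H \<inter> ?E" unfolding split by (auto simp: prod_eq_iff)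
        next
          assume w: "\<omega> \<in> ?H \<inter> ?E"
          then have "T j \<omega> = fst (c j)" using elim next_T[of \<omega>] True by auto
          then have "(T j \<omega>, \<eta> j \<omega>) = c j" using w by (auto simp: prod_eq_iff)
          then show "\<omega> \<in> ?E'" unfolding split using w by auto
        qed
      qed
      show "?H \<inter> ?E \<in> events" using H_ev indep_setD_ev1[OF ind] E_ev by blast
    qed (rule E'_ev)
    also have "\<dots> = prob ?H * prob ?E" by (rule indep_setD[OF ind H_ev E_fut])
    finally show ?thesis using True pH by simp
  next
    case False
    have "prob ?E' = prob {}"
    proof (rule finite_measure_eq_AE)
      show "AE \<omega> in M. \<omega> \<in> ?E' \<longleftrightarrow> \<omega> \<in> {}"
        using erased_processD(6)[OF P j1(1)] erased_processD(3)[OF P j1(1)]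
      proof eventually_elim
        case (elim \<omega>)
        have False if w: "\<omega> \<in> ?E'"
        proof -
          have "\<omega> \<in> ?E" "(T j \<omega>, \<eta> j \<omega>) = c j" using w unfolding split by auto
          then have "T j \<omega> = fst (c j)" "\<eta> j \<omega> = snd (c j)" "T (j + 1) \<omega> = ?t"
            using next_T by (auto simp: prod_eq_iff)
          then show False using elim False by auto
        qed
        then show ?case by auto
      qed
    qed (use E'_ev in auto)
    then show ?thesis unfolding if_not_P[OF False] by simp
  qed
  then show ?case unfolding IH split by simp
qed

lemma process_law_unique:
  fixes M :: "'w measure" and M' :: "'v measure"
  assumes P: "erased_process M T \<eta>" and P': "erased_process M' T' \<eta>'"
    and eq: "\<And>k t. k \<ge> 1 \<Longrightarrow> t \<in> STree k \<Longrightarrow>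
      measure M {\<omega> \<in> space M. T k \<omega> = t} = measure M' {\<omega> \<in> space M'. T' k \<omega> = t}"
  shows "process_law M T \<eta> = process_law M' T' \<eta>'"
proof -
  have cyl: "measure (process_law M T \<eta>) (cylinder N c) = (\<Sum>t\<in>STree (N + 1).
      measure M {\<omega> \<in> space M. T (N + 1) \<omega> = t} *
      (\<Prod>i\<in>{1..N}. if erase (if i < N then fst (c (i + 1)) else t) (snd (c i)) = fst (c i) \<and> snd (c i) \<in> {1..i + 1}
         then 1 / real (i + 1) else 0))"
    if P: "erased_process M T \<eta>" for M :: "'x measure" and T \<eta> N c
  proof -
    interpret prob_space M using P unfolding erased_process_def by simp
    have fin: "finite (STree (N + 1))"
      by (rule finite_subset[OF _ finite_InSy[of "N + 1"]]) (auto simp: STree_def)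
    let ?E = "\<lambda>t. {\<omega> \<in> space M. T (N + 1) \<omega> = t \<and> (\<forall>i\<in>{1..N}. (T i \<omega>, \<eta> i \<omega>) = c i)}"
    let ?C = "path_of T \<eta> -` cylinder N c \<inter> space M"
    have C_ev: "?C \<in> events"
      by (rule measurable_sets[OF path_of_measurable[OF P] open_in_path_borel[OF openin_cylinder]])
    have C_iff: "\<omega> \<in> ?C \<longleftrightarrow> (\<forall>i\<in>{1..N}. (T i \<omega>, \<eta> i \<omega>) = c i)" if "\<omega> \<in> space M" for \<omega>
      using that measurable_space[OF path_of_measurable[OF P] that]
      unfolding space_path_borel cylinder_def by (auto simp: path_of_def)
    have E_eq: "?E t = ?C \<inter> {\<omega> \<in> space M. (T (N + 1) \<omega>, \<eta> (N + 1) \<omega>) \<in> {t} \<times> UNIV}" for t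
      using C_iff by auto
    have E_ev: "?E t \<in> events" for t
      unfolding E_eq by (intro sets.Int C_ev erased_process_event[OF P]) simp
    have "measure (process_law M T \<eta>) (cylinder N c) = prob ?C"
      unfolding process_law_eq
      by (rule measure_distr[OF path_of_measurable[OF P] open_in_path_borel[OF openin_cylinder]])
    also have "\<dots> = prob (\<Union>t\<in>STree (N + 1). ?E t)"
    proof (rule finite_measure_eq_AE)
      have "AE \<omega> in M. T (N + 1) \<omega> \<in> STree (N + 1) \<and> \<eta> (N + 1) \<omega> \<in> {1..N + 1 + 1}"
        by (rule erased_processD(3)[OF P]) simp
      then show "AE \<omega> in M. \<omega> \<in> ?C \<longleftrightarrow> \<omega> \<in> (\<Union>t\<in>STree (N + 1). ?E t)"
        using AE_space by eventually_elim (use C_iff in auto)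
      show "(\<Union>t\<in>STree (N + 1). ?E t) \<in> events" using fin E_ev by (intro sets.finite_UN) auto
    qed (rule C_ev)
    also have "\<dots> = (\<Sum>t\<in>STree (N + 1). prob (?E t))"
      using fin E_ev by (intro finite_measure_finite_Union) (auto simp: disjoint_family_on_def)
    finally show ?thesis using erased_process_cylinder_prob[OF P, of 1 N _ c] by simp
  qed
  have "prob_space M" "prob_space M'" using P P' unfolding erased_process_def by auto
  then have pr: "prob_space (process_law M T \<eta>)" "prob_space (process_law M' T' \<eta>')"
    unfolding process_law_eq
    by (intro prob_space.prob_space_distr path_of_measurable P P'; simp)+
  show ?thesis
  proof (rule measure_eqI_generator_eq[OF Int_stable_cylinders cylinders_Pow])
    fix X assume "X \<in> cylinders"
    then obtain N c where X: "X = cylinder N c" unfolding cylinders_def by blast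
    have "measure (process_law M T \<eta>) X = measure (process_law M' T' \<eta>') X"
      unfolding X cyl[OF P] cyl[OF P'] using eq by (intro sum.cong) auto
    then show "emeasure (process_law M T \<eta>) X = emeasure (process_law M' T' \<eta>') X"
      using pr by (simp add: finite_measure.emeasure_eq_measure prob_space.finite_measure)
  next
    show "range (\<lambda>_ :: nat. cylinder 0 (\<lambda>_. ({}, 0))) \<subseteq> cylinders" unfolding cylinders_def by auto
    show "(\<Union>i :: nat. cylinder 0 (\<lambda>_. ({}, 0))) = topspace path_topology" unfolding cylinder_def by simp
    show "emeasure (process_law M T \<eta>) (cylinder 0 (\<lambda>_. ({}, 0))) \<noteq> \<infinity>"
      using pr by (simp add: finite_measure.emeasure_eq_measure prob_space.finite_measure)
  qed (simp_all add: process_law_eq sets_path_borel)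
qed

lemma process_law_marginal:
  assumes P: "erased_process M T \<eta>" and k: "k \<ge> 1"
  shows "measure (process_law M T \<eta>) {\<omega> \<in> space (process_law M T \<eta>). fst (\<omega> k) = t}
    = measure M {\<omega> \<in> space M. T k \<omega> = t}"
proof -
  have eq: "{\<omega> \<in> space (process_law M T \<eta>). fst (\<omega> k) = t} = {\<omega> \<in> topspace path_topology. \<omega> k \<in> {t} \<times> UNIV}"
    unfolding process_law_eq by (auto simp: space_path_borel mem_Times_iff)
  have "measure (process_law M T \<eta>) {\<omega> \<in> topspace path_topology. \<omega> k \<in> {t} \<times> UNIV}
     = measure M (path_of T \<eta> -` {\<omega> \<in> topspace path_topology. \<omega> k \<in> {t} \<times> UNIV} \<inter> space M)"
    unfolding process_law_eq
    by (rule measure_distr[OF path_of_measurable[OF P] open_in_path_borel[OF openin_coordinate[OF k]]])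
  also have "path_of T \<eta> -` {\<omega> \<in> topspace path_topology. \<omega> k \<in> {t} \<times> UNIV} \<inter> space M = {\<omega> \<in> space M. T k \<omega> = t}"
    using measurable_space[OF path_of_measurable[OF P]] k
    unfolding space_path_borel by (auto simp: path_of_def)
  finally show ?thesis unfolding eq .
qed

text \<open>The coordinate process on the path space is a version whose sample space consists of paths, as
  the set of erased laws demands.\<close>

lemma erased_process_canonical:
  assumes P: "erased_process M T \<eta>"
  defines "\<mu> \<equiv> process_law M T \<eta>"
  shows "erased_process \<mu> (\<lambda>n \<omega>. fst (\<omega> n)) (\<lambda>n \<omega>. snd (\<omega> n))"
proof -
  interpret prob_space M using P unfolding erased_process_def by simp
  let ?Z = "path_of T \<eta>" and ?T = "\<lambda>n (\<omega> :: path). fst (\<omega> n)" and ?h = "\<lambda>n (\<omega> :: path). snd (\<omega> n)"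
  have Z: "?Z \<in> measurable M path_borel" by (rule path_of_measurable[OF P])
  have \<mu>: "\<mu> = distr M path_borel ?Z" unfolding \<mu>_def process_law_eq ..
  have sp: "space \<mu> = topspace path_topology" unfolding \<mu> by (simp add: space_path_borel)
  have st: "sets \<mu> = sets path_borel" unfolding \<mu> by simp
  have Zv: "?Z \<omega> n = (T n \<omega>, \<eta> n \<omega>)" if "n \<ge> 1" for n \<omega> using that by (simp add: path_of_def)
  have Zsp: "?Z \<omega> \<in> topspace path_topology" if "\<omega> \<in> space M" for \<omega>
    using measurable_space[OF Z that] by (simp add: space_path_borel)
  have fib: "\<omega> n \<in> path_fibre n" if "\<omega> \<in> topspace path_topology" "n \<ge> 1" for \<omega> n
    using that unfolding topspace_path by auto
  have coord: "{\<omega> \<in> topspace path_topology. \<omega> n \<in> A} \<in> sets \<mu>" if "n \<ge> 1" for n A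
    unfolding st by (rule open_in_path_borel[OF openin_coordinate[OF that]])
  have mT: "?T n \<in> measurable \<mu> (count_space (InSy n))" if n: "n \<ge> 1" for n
    unfolding measurable_count_space_eq2[OF finite_InSy]
  proof (intro conjI ballI)
    show "?T n \<in> space \<mu> \<rightarrow> InSy n" using fib[OF _ n] unfolding sp by (auto simp: mem_Times_iff)
    fix t
    have "?T n -` {t} \<inter> space \<mu> = {\<omega> \<in> topspace path_topology. \<omega> n \<in> {t} \<times> UNIV}"
      unfolding sp by (auto simp: mem_Times_iff)
    then show "?T n -` {t} \<inter> space \<mu> \<in> sets \<mu>" using coord[OF n] by simp
  qed
  have mh: "?h n \<in> measurable \<mu> (count_space {1..n + 1})" if n: "n \<ge> 1" for n
    unfolding measurable_count_space_eq2[OF finite_atLeastAtMost]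
  proof (intro conjI ballI)
    show "?h n \<in> space \<mu> \<rightarrow> {1..n + 1}" using fib[OF _ n] unfolding sp by (auto simp: mem_Times_iff)
    fix e
    have "?h n -` {e} \<inter> space \<mu> = {\<omega> \<in> topspace path_topology. \<omega> n \<in> UNIV \<times> {e}}"
      unfolding sp by (auto simp: mem_Times_iff)
    then show "?h n -` {e} \<inter> space \<mu> \<in> sets \<mu>" using coord[OF n] by simp
  qed
  have ae1: "AE \<omega> in \<mu>. ?T n \<omega> \<in> STree n \<and> ?h n \<omega> \<in> {1..n + 1}" if n: "n \<ge> 1" for n
  proof -
    have "(AE \<omega> in \<mu>. \<omega> n \<in> STree n \<times> {1..n + 1}) \<longleftrightarrow> (AE \<omega> in M. ?Z \<omega> n \<in> STree n \<times> {1..n + 1})"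
      unfolding \<mu> using coord[OF n] by (intro AE_distr_iff[OF Z]) (simp add: st space_path_borel)
    moreover have "AE \<omega> in M. ?Z \<omega> n \<in> STree n \<times> {1..n + 1}"
      using erased_processD(3)[OF P n] by eventually_elim (auto simp: Zv[OF n])
    ultimately show ?thesis by (simp add: mem_Times_iff)
  qed
  have ae2: "AE \<omega> in \<mu>. ?T n \<omega> = erase (?T (n + 1) \<omega>) (?h n \<omega>)" if n: "n \<ge> 1" for n
  proof -
    let ?S = "{\<omega> \<in> topspace path_topology. ?T n \<omega> = erase (?T (n + 1) \<omega>) (?h n \<omega>)}"
    have "?S = (\<Union>p\<in>path_fibre (n + 1). {\<omega> \<in> topspace path_topology. \<omega> (n + 1) \<in> {p}}
        \<inter> {\<omega> \<in> topspace path_topology. \<omega> n \<in> {q. fst q = erase (fst p) (snd q)}})"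
      using fib[of _ "n + 1"] by auto
    moreover have "finite (path_fibre (n + 1))" by (simp add: finite_InSy)
    moreover have "{\<omega> \<in> topspace path_topology. \<omega> (n + 1) \<in> {p}}
        \<inter> {\<omega> \<in> topspace path_topology. \<omega> n \<in> {q. fst q = erase (fst p) (snd q)}} \<in> sets \<mu>" for p
      using n by (intro sets.Int coord) auto
    ultimately have "?S \<in> sets \<mu>" by (simp only:) (intro sets.finite_UN)
    then have "(AE \<omega> in \<mu>. ?T n \<omega> = erase (?T (n + 1) \<omega>) (?h n \<omega>)) \<longleftrightarrow>
       (AE \<omega> in M. ?T n (?Z \<omega>) = erase (?T (n + 1) (?Z \<omega>)) (?h n (?Z \<omega>)))"
      unfolding \<mu> by (intro AE_distr_iff[OF Z]) (simp add: st space_path_borel)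
    moreover have "AE \<omega> in M. ?T n (?Z \<omega>) = erase (?T (n + 1) (?Z \<omega>)) (?h n (?Z \<omega>))"
      using erased_processD(6)[OF P n] by (rule eventually_mono) (use n in \<open>simp add: Zv\<close>)
    ultimately show ?thesis by simp
  qed
  have law: "distr \<mu> (count_space {1..n + 1}) (?h n) = uniform_count_measure {1..n + 1}" if n: "n \<ge> 1" for n
  proof -
    have "distr \<mu> (count_space {1..n + 1}) (?h n) = distr M (count_space {1..n + 1}) (?h n \<circ> ?Z)"
      unfolding \<mu> using mh[OF n] by (intro distr_distr Z) (simp add: \<mu>)
    also have "\<dots> = distr M (count_space {1..n + 1}) (\<eta> n)"
      by (rule distr_cong) (auto simp: Zv[OF n])
    finally show ?thesis using erased_processD(4)[OF P n] by simp
  qed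
  interpret \<mu>: prob_space \<mu> unfolding \<mu> by (rule prob_space_distr[OF Z])
  have ind: "\<mu>.indep_set {?h n -` A \<inter> space \<mu> |A. A \<subseteq> {1..n + 1}} (future_events \<mu> ?T ?h n)" if n: "n \<ge> 1" for n
    unfolding \<mu>.indep_sets2_eq
  proof (intro conjI ballI)
    have indM: "indep_set {\<eta> n -` A \<inter> space M |A. A \<subseteq> {1..n + 1}} (future_events M T \<eta> n)"
      using erased_processD(5)[OF P n] unfolding future_events_def .
    show sub1: "{?h n -` A \<inter> space \<mu> |A. A \<subseteq> {1..n + 1}} \<subseteq> \<mu>.events"
      using measurable_sets[OF mh[OF n]] by auto
    have gen: "(\<lambda>\<omega>. (?T m \<omega>, ?h m \<omega>)) -` A \<inter> space \<mu> = {\<omega> \<in> topspace path_topology. \<omega> m \<in> A}" for m A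
      unfolding sp by auto
    show sub2: "future_events \<mu> ?T ?h n \<subseteq> \<mu>.events"
      unfolding future_events_def gen
      by (rule sets.sigma_sets_subset) (use coord n in auto)
    have pull: "?Z -` b \<inter> space M \<in> future_events M T \<eta> n" if "b \<in> future_events \<mu> ?T ?h n" for b
      using that unfolding future_events_def
    proof (induction rule: sigma_sets.induct)
      case (Basic a)
      then obtain m A where m: "n + 1 \<le> m" "a = {\<omega> \<in> topspace path_topology. \<omega> m \<in> A}"
        unfolding gen by auto
      have "?Z -` a \<inter> space M = {\<omega> \<in> space M. (T m \<omega>, \<eta> m \<omega>) \<in> A}"
        unfolding m(2) using Zsp Zv[of m] m(1) by auto
      then show ?case using future_events_coordinate[OF P m(1)] unfolding future_events_def by simp
    next
      case Empty
      then show ?case by (simp add: sigma_sets.Empty)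
    next
      case (Compl a)
      have "?Z -` (space \<mu> - a) \<inter> space M = space M - (?Z -` a \<inter> space M)" using Zsp unfolding sp by auto
      then show ?case using Compl by (simp add: sigma_sets.Compl)
    next
      case (Union a)
      have eq: "?Z -` (\<Union>i. a i) \<inter> space M = (\<Union>i. ?Z -` a i \<inter> space M)" by auto
      show ?case unfolding eq by (rule sigma_sets.Union) (rule Union(2))
    qed
    fix a b assume a: "a \<in> {?h n -` A \<inter> space \<mu> |A. A \<subseteq> {1..n + 1}}" and b: "b \<in> future_events \<mu> ?T ?h n"
    have pull_a: "?Z -` a \<inter> space M \<in> {\<eta> n -` A \<inter> space M |A. A \<subseteq> {1..n + 1}}"
    proof -
      obtain A where A: "A \<subseteq> {1..n + 1}" "a = ?h n -` A \<inter> space \<mu>" using a by blast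
      then have "?Z -` a \<inter> space M = \<eta> n -` A \<inter> space M" using Zsp Zv[OF n] unfolding sp by auto
      then show ?thesis using A by blast
    qed
    have ab: "a \<in> sets path_borel" "b \<in> sets path_borel" using sub1 sub2 a b st by auto
    have "measure \<mu> (a \<inter> b) = prob ((?Z -` a \<inter> space M) \<inter> (?Z -` b \<inter> space M))"
      unfolding \<mu> using ab by (subst measure_distr[OF Z]) (auto intro: arg_cong[of _ _ prob])
    also have "\<dots> = prob (?Z -` a \<inter> space M) * prob (?Z -` b \<inter> space M)"
      by (rule indep_setD[OF indM pull_a pull[OF b]])
    also have "\<dots> = measure \<mu> a * measure \<mu> b"
      unfolding \<mu> using ab by (simp add: measure_distr[OF Z])
    finally show "measure \<mu> (a \<inter> b) = measure \<mu> a * measure \<mu> b" .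
  qed
  show ?thesis unfolding erased_process_def
    using \<mu>.prob_space_axioms mT mh ae1 ae2 law ind unfolding future_events_def by blast
qed

lemma process_law_canonical:
  assumes P: "erased_process M T \<eta>"
  shows "process_law (process_law M T \<eta>) (\<lambda>n \<omega>. fst (\<omega> n)) (\<lambda>n \<omega>. snd (\<omega> n)) = process_law M T \<eta>"
proof -
  have "process_law (process_law M T \<eta>) (\<lambda>n \<omega>. fst (\<omega> n)) (\<lambda>n \<omega>. snd (\<omega> n))
     = distr (process_law M T \<eta>) (process_law M T \<eta>) (\<lambda>\<omega>. \<omega>)"
    unfolding process_law_eq
  proof (rule distr_cong)
    fix \<omega> assume "\<omega> \<in> space (distr M path_borel (path_of T \<eta>))"
    then have "\<omega> \<in> PiE {1..} path_fibre" by (simp add: space_path_borel topspace_path)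
    then show "path_of (\<lambda>n \<omega>. fst (\<omega> n)) (\<lambda>n \<omega>. snd (\<omega> n)) \<omega> = \<omega>"
      unfolding path_of_def by (auto simp: PiE_iff extensional_def fun_eq_iff)
  qed simp_all
  then show ?thesis by simp
qed

lemma process_law_in_erased_laws:
  assumes P: "erased_process M T \<eta>"
  shows "process_law M T \<eta> \<in> erased_laws"
  unfolding erased_laws_def mem_Collect_eq
  using process_law_canonical[OF P, symmetric] erased_process_canonical[OF P] by blast

section \<open>Exchangeability and the process of sampled trees\<close>

lemma exists_unique_rank:
  fixes x :: "nat \<Rightarrow> real"
  assumes inj: "inj_on x {1..m}" and e: "e \<in> {1..m}"
  shows "\<exists>!i. i \<in> {1..m} \<and> card {l \<in> {1..m}. x l \<le> x i} = e"
proof -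
  define r where "r i = card {l \<in> {1..m}. x l \<le> x i}" for i
  have less: "r i < r j" if "i \<in> {1..m}" "j \<in> {1..m}" "x i < x j" for i j
    unfolding r_def
  proof (rule psubset_card_mono)
    have "{l \<in> {1..m}. x l \<le> x i} \<subseteq> {l \<in> {1..m}. x l \<le> x j}" using that by force
    moreover have "j \<in> {l \<in> {1..m}. x l \<le> x j}" "j \<notin> {l \<in> {1..m}. x l \<le> x i}" using that by auto
    ultimately show "{l \<in> {1..m}. x l \<le> x i} \<subset> {l \<in> {1..m}. x l \<le> x j}" by blast
  qed simp
  have "inj_on r {1..m}"
  proof (rule inj_onI, rule ccontr)
    fix i j assume ij: "i \<in> {1..m}" "j \<in> {1..m}" "r i = r j" "i \<noteq> j"
    then have "x i \<noteq> x j" using inj by (auto dest: inj_onD)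
    then show False using less[of i j] less[of j i] ij by linarith
  qed
  moreover have "r ` {1..m} \<subseteq> {1..m}"
  proof
    fix v assume "v \<in> r ` {1..m}"
    then obtain i where i: "i \<in> {1..m}" "v = r i" by blast
    have "0 < r i" unfolding r_def card_gt_0_iff using i(1) by auto
    moreover have "r i \<le> card {1..m}" unfolding r_def by (rule card_mono) auto
    ultimately show "v \<in> {1..m}" using i by simp
  qed
  ultimately have "r ` {1..m} = {1..m}" by (intro endo_inj_surj) auto
  then have "e \<in> r ` {1..m}" using e by simp
  then obtain i where "i \<in> {1..m}" "r i = e" by blast
  then show ?thesis using \<open>inj_on r {1..m}\<close> unfolding r_def inj_on_def by blast
qed

lemma card_permute:
  assumes "\<pi> permutes {1..k}"
  shows "card {i \<in> {1..k}. P (x (\<pi> i))} = card {i \<in> {1..k}. P (x i)}"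
proof (rule bij_betw_same_card[of \<pi>], rule bij_betw_imageI)
  show "inj_on \<pi> {i \<in> {1..k}. P (x (\<pi> i))}" using permutes_inj_on[OF assms] by blast
  show "\<pi> ` {i \<in> {1..k}. P (x (\<pi> i))} = {i \<in> {1..k}. P (x i)}"
  proof (intro subset_antisym subsetI)
    fix j assume j: "j \<in> {i \<in> {1..k}. P (x i)}"
    then obtain i where "i \<in> {1..k}" "j = \<pi> i" using permutes_image[OF assms] by blast
    then show "j \<in> \<pi> ` {i \<in> {1..k}. P (x (\<pi> i))}" using j by blast
  next
    fix j assume "j \<in> \<pi> ` {i \<in> {1..k}. P (x (\<pi> i))}"
    then show "j \<in> {i \<in> {1..k}. P (x i)}" using permutes_in_image[OF assms] by auto
  qed
qed

lemma sample_tree_permute: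
  assumes "\<pi> permutes {1..k}"
  shows "sample_tree k K (\<lambda>i. x (\<pi> i)) = sample_tree k K x"
proof -
  have "(\<lambda>i. x (\<pi> i)) ` {1..k} = x ` {1..k}"
    using permutes_image[OF assms] by (metis image_image)
  moreover have "count_below k (\<lambda>i. x (\<pi> i)) z = count_below k x z" for z
    unfolding count_below_def by (rule card_permute[OF assms])
  ultimately show ?thesis unfolding sample_tree_def by simp
qed

lemma count_below_cong: "(\<And>i. i \<in> {1..k} \<Longrightarrow> x i = y i) \<Longrightarrow> count_below k x z = count_below k y z"
  unfolding count_below_def by (rule arg_cong[of _ _ card]) auto

lemma sample_tree_cong:
  assumes "\<And>i. i \<in> {1..k} \<Longrightarrow> x i = y i"
  shows "sample_tree k K x = sample_tree k K y"
proof -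
  have "x ` {1..k} = y ` {1..k}" using assms by (rule image_cong[OF refl])
  moreover have "count_below k x z = count_below k y z" for z using assms by (rule count_below_cong)
  ultimately show ?thesis unfolding sample_tree_def by simp
qed

lemma rank_last_cong:
  assumes "\<And>i. i \<in> {1..n + 1} \<Longrightarrow> x i = y i"
  shows "rank_last n x = rank_last n y"
  unfolding rank_last_def using assms by (intro arg_cong[of _ _ card]) auto

lemma measurable_rank:
  fixes X :: "nat \<Rightarrow> 'x \<Rightarrow> real"
  assumes X: "\<And>i. i \<in> {1..m} \<Longrightarrow> X i \<in> borel_measurable N" and j: "j \<in> {1..m}"
  shows "{\<omega> \<in> space N. card {l \<in> {1..m}. X l \<omega> \<le> X j \<omega>} = e} \<in> sets N"
proof -
  have "(\<Sum>l\<in>{1..m}. indicat_real {0..} (X j \<omega> - X l \<omega>)) = real (card {l \<in> {1..m}. X l \<omega> \<le> X j \<omega>})" for \<omega>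
  proof -
    have "(\<Sum>l\<in>{1..m}. indicat_real {0..} (X j \<omega> - X l \<omega>)) = (\<Sum>l\<in>{l \<in> {1..m}. X l \<omega> \<le> X j \<omega>}. 1)"
      by (rule sum.mono_neutral_cong_right) (auto simp: indicator_def)
    then show ?thesis by simp
  qed
  then have "{\<omega> \<in> space N. card {l \<in> {1..m}. X l \<omega> \<le> X j \<omega>} = e}
      = {\<omega> \<in> space N. (\<Sum>l\<in>{1..m}. indicat_real {0..} (X j \<omega> - X l \<omega>)) = real e}" by simp
  moreover have "(\<lambda>\<omega>. \<Sum>l\<in>{1..m}. indicat_real {0..} (X j \<omega> - X l \<omega>)) \<in> borel_measurable N"
  proof (intro borel_measurable_sum)
    fix l assume l: "l \<in> {1..m}"
    have "(\<lambda>\<omega>. X j \<omega> - X l \<omega>) \<in> borel_measurable N" using X[OF j] X[OF l] by measurable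
    then show "(\<lambda>\<omega>. indicat_real {0..} (X j \<omega> - X l \<omega>)) \<in> borel_measurable N"
      by (rule measurable_compose) simp
  qed
  then have "{\<omega> \<in> space N. (\<Sum>l\<in>{1..m}. indicat_real {0..} (X j \<omega> - X l \<omega>)) = real e} \<in> sets N"
    by measurable
  ultimately show ?thesis by simp
qed

lemma rank_last_range: "rank_last n x \<in> {1..n + 1}"
proof -
  have "0 < rank_last n x" unfolding rank_last_def card_gt_0_iff by auto
  moreover have "rank_last n x \<le> card {1..n + 1}" unfolding rank_last_def by (rule card_mono) auto
  ultimately show ?thesis by simp
qed

lemma measurable_rank_last:
  fixes X :: "nat \<Rightarrow> 'x \<Rightarrow> real"
  assumes X: "\<And>i. i \<in> {1..n + 1} \<Longrightarrow> X i \<in> borel_measurable N"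
  shows "(\<lambda>\<omega>. rank_last n (\<lambda>i. X i \<omega>)) \<in> measurable N (count_space {1..n + 1})"
  unfolding measurable_count_space_eq2[OF finite_atLeastAtMost]
proof (intro conjI ballI)
  fix e
  have "(\<lambda>\<omega>. rank_last n (\<lambda>i. X i \<omega>)) -` {e} \<inter> space N
     = {\<omega> \<in> space N. card {l \<in> {1..n + 1}. X l \<omega> \<le> X (n + 1) \<omega>} = e}"
    unfolding rank_last_def by auto
  then show "(\<lambda>\<omega>. rank_last n (\<lambda>i. X i \<omega>)) -` {e} \<inter> space N \<in> sets N"
    using measurable_rank[of "n + 1" X N "n + 1" e] X by simp
qed (use rank_last_range in blast)

context iid_uniform
begin

definition eta :: "nat \<Rightarrow> 'w \<Rightarrow> nat" where
  "eta n \<omega> = rank_last n (\<lambda>i. U i \<omega>)"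

abbreviation seq_space :: "(nat \<Rightarrow> real) measure" where
  "seq_space \<equiv> PiM {1..} (\<lambda>_. borel)"

definition seq_of :: "'w \<Rightarrow> nat \<Rightarrow> real" where
  "seq_of \<omega> = (\<lambda>i\<in>{1..}. U i \<omega>)"

definition permute_seq :: "(nat \<Rightarrow> nat) \<Rightarrow> (nat \<Rightarrow> real) \<Rightarrow> nat \<Rightarrow> real" where
  "permute_seq \<pi> x = (\<lambda>i\<in>{1..}. x (\<pi> i))"

lemma seq_of_measurable: "seq_of \<in> measurable M seq_space"
  unfolding seq_of_def by (intro measurable_restrict U_measurable) simp

lemma distr_seq_of: "distr M seq_space seq_of = PiM {1..} (\<lambda>_. uniform_measure lborel {0..1})"
proof -
  have "distr M seq_space seq_of = PiM {1..} (\<lambda>i. distr M borel (U i))"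
    unfolding seq_of_def
    by (rule indep_vars_iff_distr_eq_PiM'[THEN iffD1, OF _ _ indep]) auto
  also have "\<dots> = PiM {1..} (\<lambda>_. uniform_measure lborel {0..1})"
    by (rule PiM_cong) (auto simp: unif)
  finally show ?thesis .
qed

lemma seq_coordinate_measurable: "i \<ge> 1 \<Longrightarrow> (\<lambda>x. x i) \<in> borel_measurable seq_space"
  by (rule measurable_component_singleton) simp

lemma permute_seq_measurable:
  assumes "\<pi> permutes {1..m}"
  shows "permute_seq \<pi> \<in> measurable seq_space seq_space"
  unfolding permute_seq_def
proof (rule measurable_restrict)
  fix i :: nat assume "i \<in> {1..}"
  then have "\<pi> i \<ge> 1" using permutes_in_image[OF assms, of i] permutes_not_in[OF assms, of i]
    by (cases "i \<in> {1..m}") auto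
  then show "(\<lambda>x. x (\<pi> i)) \<in> borel_measurable seq_space" by (rule seq_coordinate_measurable)
qed

lemma prob_permute_seq:
  assumes \<pi>: "\<pi> permutes {1..m}" and E: "E \<in> sets seq_space"
  shows "prob {\<omega> \<in> space M. permute_seq \<pi> (seq_of \<omega>) \<in> E} = prob {\<omega> \<in> space M. seq_of \<omega> \<in> E}"
proof -
  let ?D = "uniform_measure lborel {0..1::real}"
  have D: "prob_space ?D" by (rule prob_space_uniform_measure) auto
  have ge: "\<pi> i \<ge> 1" if "i \<ge> 1" for i
    using that permutes_in_image[OF \<pi>, of i] permutes_not_in[OF \<pi>, of i] by (cases "i \<in> {1..m}") auto
  have "distr (PiM {1..} (\<lambda>_. ?D)) (PiM {1..} (\<lambda>_. ?D)) (permute_seq \<pi>) = PiM {1..} (\<lambda>_. ?D)"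
    unfolding permute_seq_def
    using distr_PiM_reindex[of "{1..}" "\<lambda>_. ?D" \<pi> "{1..}"] D permutes_inj_on[OF \<pi>] ge by auto
  moreover have "distr (PiM {1..} (\<lambda>_. ?D)) (PiM {1..} (\<lambda>_. ?D)) (permute_seq \<pi>)
      = distr (PiM {1..} (\<lambda>_. ?D)) seq_space (permute_seq \<pi>)"
    by (rule distr_cong) (auto intro!: sets_PiM_cong)
  ultimately have "distr (distr M seq_space seq_of) seq_space (permute_seq \<pi>) = distr M seq_space seq_of"
    unfolding distr_seq_of by simp
  then have eq: "distr M seq_space (permute_seq \<pi> \<circ> seq_of) = distr M seq_space seq_of"
    using distr_distr[OF permute_seq_measurable[OF \<pi>] seq_of_measurable] by simp
  have "prob {\<omega> \<in> space M. permute_seq \<pi> (seq_of \<omega>) \<in> E} = measure (distr M seq_space (permute_seq \<pi> \<circ> seq_of)) E"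
    using measurable_comp[OF seq_of_measurable permute_seq_measurable[OF \<pi>]] E
    by (subst measure_distr) (auto intro!: arg_cong[of _ _ prob])
  also have "\<dots> = prob {\<omega> \<in> space M. seq_of \<omega> \<in> E}"
    unfolding eq using seq_of_measurable E by (subst measure_distr) (auto intro!: arg_cong[of _ _ prob])
  finally show ?thesis .
qed

definition symmetric_sets :: "nat \<Rightarrow> (nat \<Rightarrow> real) set set" where
  "symmetric_sets m = {E \<in> sets seq_space. \<forall>\<pi>. \<pi> permutes {1..m} \<longrightarrow>
     (\<forall>x\<in>space seq_space. permute_seq \<pi> x \<in> E \<longleftrightarrow> x \<in> E)}"

text \<open>Let \<open>R i\<close> be the event that the \<open>i\<close>-th variable has rank \<open>e\<close> among the first \<open>n + 1\<close>. A transposition shows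
  that all \<open>R i\<close> have the same probability jointly with the symmetric event \<open>E\<close>, and almost surely exactly one
  of the \<open>n + 1\<close> events \<open>R i\<close> occurs.\<close>

lemma rank_uniform_given_symmetric:
  assumes E: "E \<in> symmetric_sets (n + 1)" and e: "e \<in> {1..n + 1}"
  shows "prob {\<omega> \<in> space M. eta n \<omega> = e \<and> seq_of \<omega> \<in> E} = prob {\<omega> \<in> space M. seq_of \<omega> \<in> E} / real (n + 1)"
proof -
  have Es: "E \<in> sets seq_space" using E unfolding symmetric_sets_def by simp
  define R where "R i = {x \<in> space seq_space. card {l \<in> {1..n + 1}. x l \<le> x i} = e}" for i
  have R: "R i \<in> sets seq_space" if "i \<in> {1..n + 1}" for i
    unfolding R_def by (rule measurable_rank[where X = "\<lambda>i x. x i"], rule seq_coordinate_measurable) (use that in auto)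
  have sp: "seq_of \<omega> \<in> space seq_space" if "\<omega> \<in> space M" for \<omega> using measurable_space[OF seq_of_measurable that] .
  have same: "prob {\<omega> \<in> space M. seq_of \<omega> \<in> R i \<inter> E} = prob {\<omega> \<in> space M. seq_of \<omega> \<in> R (n + 1) \<inter> E}"
    if i: "i \<in> {1..n + 1}" for i
  proof -
    define \<pi> where "\<pi> = Transposition.transpose i (n + 1)"
    have \<pi>: "\<pi> permutes {1..n + 1}" unfolding \<pi>_def using i by (intro permutes_swap_id) auto
    have "permute_seq \<pi> x \<in> R (n + 1) \<inter> E \<longleftrightarrow> x \<in> R i \<inter> E" if x: "x \<in> space seq_space" for x
    proof -
      have px: "permute_seq \<pi> x \<in> space seq_space" using measurable_space[OF permute_seq_measurable[OF \<pi>] x] .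
      have "card {l \<in> {1..n + 1}. permute_seq \<pi> x l \<le> permute_seq \<pi> x (n + 1)}
          = card {l \<in> {1..n + 1}. x (\<pi> l) \<le> x i}"
        unfolding permute_seq_def \<pi>_def by (rule arg_cong[of _ _ card]) auto
      also have "\<dots> = card {l \<in> {1..n + 1}. x l \<le> x i}" by (rule card_permute[OF \<pi>])
      finally have "permute_seq \<pi> x \<in> R (n + 1) \<longleftrightarrow> x \<in> R i" unfolding R_def using x px by simp
      moreover have "permute_seq \<pi> x \<in> E \<longleftrightarrow> x \<in> E" using E \<pi> x unfolding symmetric_sets_def by blast
      ultimately show ?thesis by blast
    qed
    then have eq: "{\<omega> \<in> space M. seq_of \<omega> \<in> R i \<inter> E} = {\<omega> \<in> space M. permute_seq \<pi> (seq_of \<omega>) \<in> R (n + 1) \<inter> E}"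
      using sp by blast
    have "R (n + 1) \<inter> E \<in> sets seq_space" using R Es by (intro sets.Int) auto
    then show ?thesis unfolding eq by (rule prob_permute_seq[OF \<pi>])
  qed
  have ev: "{\<omega> \<in> space M. seq_of \<omega> \<in> F} \<in> events" if "F \<in> sets seq_space" for F
    using measurable_sets[OF seq_of_measurable that] by (simp add: vimage_def Int_def conj_commute)
  define G where "G = {\<omega> \<in> space M. inj_on (\<lambda>i. U i \<omega>) {1..n + 1}}"
  have "G = {\<omega> \<in> space M. \<forall>i\<in>{1..n + 1}. \<forall>j\<in>{1..n + 1}. i \<noteq> j \<longrightarrow> U i \<omega> \<noteq> U j \<omega>}"
    unfolding G_def inj_on_def by blast
  moreover have "{\<omega> \<in> space M. i \<noteq> j \<longrightarrow> U i \<omega> \<noteq> U j \<omega>} \<in> events" if "i \<in> {1..n + 1}" "j \<in> {1..n + 1}" for i j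
  proof -
    have [measurable]: "U i \<in> borel_measurable M" "U j \<in> borel_measurable M" using that by auto
    show ?thesis by measurable
  qed
  then have "{\<omega> \<in> space M. \<forall>i\<in>{1..n + 1}. \<forall>j\<in>{1..n + 1}. i \<noteq> j \<longrightarrow> U i \<omega> \<noteq> U j \<omega>} \<in> events"
    by (intro sets.sets_Collect_finite_All) auto
  ultimately have G: "G \<in> events" by simp
  have aeG: "AE \<omega> in M. \<omega> \<in> G" using AE_inj[of "n + 1"] AE_space unfolding G_def by eventually_elim simp
  let ?B = "\<lambda>i. {\<omega> \<in> space M. seq_of \<omega> \<in> R i \<inter> E} \<inter> G"
  have B: "?B i \<in> events" if "i \<in> {1..n + 1}" for i
    using ev[of "R i \<inter> E"] R[OF that] Es G by (intro sets.Int) auto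
  have Ri: "seq_of \<omega> \<in> R i \<longleftrightarrow> card {l \<in> {1..n + 1}. U l \<omega> \<le> U i \<omega>} = e" if "\<omega> \<in> space M" "i \<in> {1..n + 1}" for \<omega> i
  proof -
    have "{l \<in> {1..n + 1}. seq_of \<omega> l \<le> seq_of \<omega> i} = {l \<in> {1..n + 1}. U l \<omega> \<le> U i \<omega>}"
      using that(2) unfolding seq_of_def by auto
    then show ?thesis unfolding R_def using sp[OF that(1)] by simp
  qed
  have "prob {\<omega> \<in> space M. seq_of \<omega> \<in> E} = prob (\<Union>i\<in>{1..n + 1}. ?B i)"
  proof (rule finite_measure_eq_AE)
    show "AE \<omega> in M. \<omega> \<in> {\<omega> \<in> space M. seq_of \<omega> \<in> E} \<longleftrightarrow> \<omega> \<in> (\<Union>i\<in>{1..n + 1}. ?B i)"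
      using aeG
    proof eventually_elim
      case (elim \<omega>)
      then have w: "\<omega> \<in> space M" "inj_on (\<lambda>i. U i \<omega>) {1..n + 1}" unfolding G_def by auto
      obtain i where "i \<in> {1..n + 1}" "card {l \<in> {1..n + 1}. U l \<omega> \<le> U i \<omega>} = e"
        using exists_unique_rank[OF w(2) e] by blast
      then have "i \<in> {1..n + 1}" "seq_of \<omega> \<in> R i" using Ri[OF w(1)] by auto
      then show ?case using elim w(1) by blast
    qed
    show "(\<Union>i\<in>{1..n + 1}. ?B i) \<in> events" using B by (intro sets.finite_UN) auto
  qed (rule ev[OF Es])
  also have "\<dots> = (\<Sum>i\<in>{1..n + 1}. prob (?B i))"
  proof (rule finite_measure_finite_Union)
    show "disjoint_family_on ?B {1..n + 1}"
      unfolding disjoint_family_on_def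
    proof (intro ballI impI, rule ccontr)
      fix i j assume ij: "i \<in> {1..n + 1}" "j \<in> {1..n + 1}" "i \<noteq> j" "?B i \<inter> ?B j \<noteq> {}"
      then obtain \<omega> where w: "\<omega> \<in> space M" "inj_on (\<lambda>i. U i \<omega>) {1..n + 1}" "seq_of \<omega> \<in> R i" "seq_of \<omega> \<in> R j"
        unfolding G_def by blast
      then show False using exists_unique_rank[OF w(2) e] ij Ri[OF w(1)] by blast
    qed
  qed (use B in auto)
  also have "\<dots> = (\<Sum>i\<in>{1..n + 1}. prob {\<omega> \<in> space M. seq_of \<omega> \<in> R (n + 1) \<inter> E})"
  proof (rule sum.cong[OF refl])
    fix i assume i: "i \<in> {1..n + 1}"
    have "prob (?B i) = prob {\<omega> \<in> space M. seq_of \<omega> \<in> R i \<inter> E}"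
    proof (rule finite_measure_eq_AE)
      show "AE \<omega> in M. \<omega> \<in> ?B i \<longleftrightarrow> \<omega> \<in> {\<omega> \<in> space M. seq_of \<omega> \<in> R i \<inter> E}"
        using aeG by eventually_elim blast
      show "{\<omega> \<in> space M. seq_of \<omega> \<in> R i \<inter> E} \<in> events" using R[OF i] Es by (intro ev sets.Int)
    qed (rule B[OF i])
    then show "prob (?B i) = prob {\<omega> \<in> space M. seq_of \<omega> \<in> R (n + 1) \<inter> E}" using same[OF i] by simp
  qed
  also have "\<dots> = real (n + 1) * prob {\<omega> \<in> space M. seq_of \<omega> \<in> R (n + 1) \<inter> E}" by simp
  also have "{\<omega> \<in> space M. seq_of \<omega> \<in> R (n + 1) \<inter> E} = {\<omega> \<in> space M. eta n \<omega> = e \<and> seq_of \<omega> \<in> E}"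
    using Ri[of _ "n + 1"] unfolding eta_def rank_last_def by auto
  finally show ?thesis by (simp add: field_simps)
qed

lemma tree_at_seq_of: "tree_at K m \<omega> = sample_tree m K (seq_of \<omega>)"
  unfolding tree_at_def by (rule sample_tree_cong) (simp add: seq_of_def)

lemma eta_seq_of: "eta m \<omega> = rank_last m (seq_of \<omega>)"
  unfolding eta_def by (rule rank_last_cong) (simp add: seq_of_def)

text \<open>For \<open>m > n\<close> the tree at \<open>m\<close> and the rank of the variable with index \<open>m + 1\<close> depend on the first
  \<open>n + 1\<close> variables only through their set.\<close>

lemma future_event_symmetric:
  assumes m: "n + 1 \<le> m" and A: "A \<subseteq> path_fibre m"
  shows "{x \<in> space seq_space. (sample_tree m K x, rank_last m x) \<in> A} \<in> symmetric_sets (n + 1)"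
proof -
  have T: "(\<lambda>x. sample_tree m K (\<lambda>i. x i)) \<in> measurable seq_space (count_space (InSy m))"
    by (rule measurable_sample_tree, rule seq_coordinate_measurable) simp
  have h: "(\<lambda>x. rank_last m (\<lambda>i. x i)) \<in> measurable seq_space (count_space {1..m + 1})"
    by (rule measurable_rank_last, rule seq_coordinate_measurable) simp
  have "{x \<in> space seq_space. (sample_tree m K x, rank_last m x) \<in> A} =
    (\<Union>p\<in>A. ((\<lambda>x. sample_tree m K (\<lambda>i. x i)) -` {fst p} \<inter> space seq_space)
      \<inter> ((\<lambda>x. rank_last m (\<lambda>i. x i)) -` {snd p} \<inter> space seq_space))" by force
  moreover have "finite A" by (rule finite_subset[OF A]) (simp add: finite_InSy)
  moreover have "((\<lambda>x. sample_tree m K (\<lambda>i. x i)) -` {fst p} \<inter> space seq_space)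
      \<inter> ((\<lambda>x. rank_last m (\<lambda>i. x i)) -` {snd p} \<inter> space seq_space) \<in> sets seq_space" if "p \<in> A" for p
    using that A by (intro sets.Int measurable_sets[OF T] measurable_sets[OF h]) auto
  ultimately have "{x \<in> space seq_space. (sample_tree m K x, rank_last m x) \<in> A} \<in> sets seq_space"
    by (simp only:) (intro sets.finite_UN)
  moreover have "sample_tree m K (permute_seq \<pi> x) = sample_tree m K x \<and> rank_last m (permute_seq \<pi> x) = rank_last m x"
    if \<pi>: "\<pi> permutes {1..n + 1}" for \<pi> x
  proof
    have \<pi>m: "\<pi> permutes {1..m}" and \<pi>m': "\<pi> permutes {1..m + 1}" using m by (auto intro: permutes_subset[OF \<pi>])
    have "sample_tree m K (permute_seq \<pi> x) = sample_tree m K (\<lambda>i. x (\<pi> i))"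
      by (rule sample_tree_cong) (simp add: permute_seq_def)
    then show "sample_tree m K (permute_seq \<pi> x) = sample_tree m K x" using sample_tree_permute[OF \<pi>m] by simp
    have fix_last: "\<pi> (m + 1) = m + 1" using permutes_not_in[OF \<pi>] m by simp
    have "rank_last m (permute_seq \<pi> x) = rank_last m (\<lambda>i. x (\<pi> i))"
      by (rule rank_last_cong) (simp add: permute_seq_def)
    then show "rank_last m (permute_seq \<pi> x) = rank_last m x"
      unfolding rank_last_def fix_last
      using card_permute[OF \<pi>m', of "\<lambda>v. v \<le> x (m + 1)" x] by simp
  qed
  moreover have "permute_seq \<pi> x \<in> space seq_space" if "\<pi> permutes {1..n + 1}" "x \<in> space seq_space" for \<pi> x
    using measurable_space[OF permute_seq_measurable[OF that(1)] that(2)] .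
  ultimately show ?thesis unfolding symmetric_sets_def by simp
qed

lemma future_events_symmetric:
  assumes "b \<in> future_events M (tree_at K) eta n"
  shows "\<exists>E\<in>symmetric_sets (n + 1). b = {\<omega> \<in> space M. seq_of \<omega> \<in> E}"
  using assms unfolding future_events_def
proof (induction rule: sigma_sets.induct)
  case (Basic a)
  then obtain m A where m: "n + 1 \<le> m" "A \<subseteq> path_fibre m"
    "a = (\<lambda>\<omega>. (tree_at K m \<omega>, eta m \<omega>)) -` A \<inter> space M" by auto
  have "a = {\<omega> \<in> space M. seq_of \<omega> \<in> {x \<in> space seq_space. (sample_tree m K x, rank_last m x) \<in> A}}"
    unfolding m(3) using measurable_space[OF seq_of_measurable] by (auto simp: tree_at_seq_of eta_seq_of)
  then show ?case using future_event_symmetric[OF m(1,2), of K] by blast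
next
  case Empty
  have "{} \<in> symmetric_sets (n + 1)" unfolding symmetric_sets_def by simp
  then show ?case by blast
next
  case (Compl a)
  then obtain E where E: "E \<in> symmetric_sets (n + 1)" "a = {\<omega> \<in> space M. seq_of \<omega> \<in> E}" by blast
  have "permute_seq \<pi> x \<in> space seq_space" if "\<pi> permutes {1..n + 1}" "x \<in> space seq_space" for \<pi> x
    using measurable_space[OF permute_seq_measurable[OF that(1)] that(2)] .
  then have "space seq_space - E \<in> symmetric_sets (n + 1)"
    using E(1) unfolding symmetric_sets_def by auto
  moreover have "space M - a = {\<omega> \<in> space M. seq_of \<omega> \<in> space seq_space - E}"
    unfolding E(2) using measurable_space[OF seq_of_measurable] by auto
  ultimately show ?case by blast
next
  case (Union a)
  then obtain E where E: "\<And>i. E i \<in> symmetric_sets (n + 1)" "\<And>i. a i = {\<omega> \<in> space M. seq_of \<omega> \<in> E i}" by metis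
  have "(\<Union>i. E i) \<in> symmetric_sets (n + 1)" using E(1) unfolding symmetric_sets_def by auto
  moreover have "(\<Union>i. a i) = {\<omega> \<in> space M. seq_of \<omega> \<in> (\<Union>i. E i)}" unfolding E(2) by auto
  ultimately show ?case by blast
qed

lemma eta_measurable: "eta n \<in> measurable M (count_space {1..n + 1})"
  unfolding eta_def by (rule measurable_rank_last) (simp add: U_measurable)

lemma prob_eta_in:
  assumes E: "E \<in> symmetric_sets (n + 1)" and A: "A \<subseteq> {1..n + 1}"
  shows "prob {\<omega> \<in> space M. eta n \<omega> \<in> A \<and> seq_of \<omega> \<in> E}
    = real (card A) / real (n + 1) * prob {\<omega> \<in> space M. seq_of \<omega> \<in> E}"
proof -
  have fin: "finite A" by (rule finite_subset[OF A]) simp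
  have Es: "{\<omega> \<in> space M. seq_of \<omega> \<in> E} \<in> events"
    using measurable_sets[OF seq_of_measurable, of E] E unfolding symmetric_sets_def
    by (simp add: vimage_def Int_def conj_commute)
  have he: "{\<omega> \<in> space M. eta n \<omega> = e} \<in> events" if "e \<in> A" for e
    using measurable_sets[OF eta_measurable, of "{e}" n] that A by (auto simp: vimage_def Int_def conj_commute)
  have "{\<omega> \<in> space M. eta n \<omega> \<in> A \<and> seq_of \<omega> \<in> E} = (\<Union>e\<in>A. {\<omega> \<in> space M. eta n \<omega> = e \<and> seq_of \<omega> \<in> E})" by auto
  also have "prob \<dots> = (\<Sum>e\<in>A. prob {\<omega> \<in> space M. eta n \<omega> = e \<and> seq_of \<omega> \<in> E})"
  proof (rule finite_measure_finite_Union[OF fin])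
    have "{\<omega> \<in> space M. eta n \<omega> = e \<and> seq_of \<omega> \<in> E} = {\<omega> \<in> space M. eta n \<omega> = e} \<inter> {\<omega> \<in> space M. seq_of \<omega> \<in> E}" for e by auto
    then show "(\<lambda>e. {\<omega> \<in> space M. eta n \<omega> = e \<and> seq_of \<omega> \<in> E}) ` A \<subseteq> events" using Es he by auto
    show "disjoint_family_on (\<lambda>e. {\<omega> \<in> space M. eta n \<omega> = e \<and> seq_of \<omega> \<in> E}) A"
      unfolding disjoint_family_on_def by auto
  qed
  also have "\<dots> = (\<Sum>e\<in>A. prob {\<omega> \<in> space M. seq_of \<omega> \<in> E} / real (n + 1))"
    using rank_uniform_given_symmetric[OF E] A by (intro sum.cong) auto
  finally show ?thesis by simp
qed

lemma space_symmetric: "space seq_space \<in> symmetric_sets m"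
  unfolding symmetric_sets_def using measurable_space[OF permute_seq_measurable] by auto

lemma prob_eta:
  assumes "A \<subseteq> {1..n + 1}"
  shows "prob (eta n -` A \<inter> space M) = real (card A) / real (n + 1)"
proof -
  have "{\<omega> \<in> space M. eta n \<omega> \<in> A \<and> seq_of \<omega> \<in> space seq_space} = eta n -` A \<inter> space M"
    "{\<omega> \<in> space M. seq_of \<omega> \<in> space seq_space} = space M"
    using measurable_space[OF seq_of_measurable] by auto
  then show ?thesis using prob_eta_in[OF space_symmetric assms] by (simp add: prob_space)
qed

theorem erased_process_tree_at:
  assumes K: "K \<in> STree_inf"
  shows "erased_process M (tree_at K) eta"
  unfolding erased_process_def
proof (intro conjI allI impI)
  show "prob_space M" by (rule prob_space_axioms)
  fix n :: nat assume n: "1 \<le> n"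
  show "tree_at K n \<in> measurable M (count_space (InSy n))" by (rule tree_at_measurable)
  show hm: "eta n \<in> measurable M (count_space {1..n + 1})" by (rule eta_measurable)
  have hr: "eta n \<omega> \<in> {1..n + 1}" for \<omega> unfolding eta_def by (rule rank_last_range)
  show "AE \<omega> in M. tree_at K n \<omega> \<in> STree n \<and> eta n \<omega> \<in> {1..n + 1}"
    using AE_tree_at_STree[OF K, of n] by eventually_elim (use hr in blast)
  show "distr M (count_space {1..n + 1}) (eta n) = uniform_count_measure {1..n + 1}"
  proof (rule measure_eqI_finite[of _ "{1..n + 1}"])
    fix e assume e: "e \<in> {1..n + 1}"
    have "emeasure (distr M (count_space {1..n + 1}) (eta n)) {e} = emeasure M (eta n -` {e} \<inter> space M)"
      using e by (intro emeasure_distr hm) auto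
    also have "\<dots> = ennreal (1 / real (n + 1))"
      using prob_eta[of "{e}" n] e by (simp add: emeasure_eq_measure)
    also have "\<dots> = emeasure (uniform_count_measure {1..n + 1}) {e}"
      using e by (subst emeasure_uniform_count_measure) auto
    finally show "emeasure (distr M (count_space {1..n + 1}) (eta n)) {e} = emeasure (uniform_count_measure {1..n + 1}) {e}" .
  qed (auto simp: sets_uniform_count_measure)
  have "indep_set {eta n -` A \<inter> space M |A. A \<subseteq> {1..n + 1}} (future_events M (tree_at K) eta n)"
    unfolding indep_sets2_eq
  proof (intro conjI ballI)
    show "{eta n -` A \<inter> space M |A. A \<subseteq> {1..n + 1}} \<subseteq> events" using measurable_sets[OF hm] by auto
    show "future_events M (tree_at K) eta n \<subseteq> events"
    proof
      fix b assume "b \<in> future_events M (tree_at K) eta n"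
      then obtain E where "E \<in> symmetric_sets (n + 1)" "b = {\<omega> \<in> space M. seq_of \<omega> \<in> E}"
        using future_events_symmetric by blast
      then show "b \<in> events" using measurable_sets[OF seq_of_measurable, of E] unfolding symmetric_sets_def
        by (simp add: vimage_def Int_def conj_commute)
    qed
    fix a b assume a: "a \<in> {eta n -` A \<inter> space M |A. A \<subseteq> {1..n + 1}}" and "b \<in> future_events M (tree_at K) eta n"
    then obtain E where E: "E \<in> symmetric_sets (n + 1)" "b = {\<omega> \<in> space M. seq_of \<omega> \<in> E}"
      using future_events_symmetric by blast
    obtain A where A: "A \<subseteq> {1..n + 1}" "a = eta n -` A \<inter> space M" using a by blast
    have "a \<inter> b = {\<omega> \<in> space M. eta n \<omega> \<in> A \<and> seq_of \<omega> \<in> E}" unfolding A(2) E(2) by auto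
    then show "prob (a \<inter> b) = prob a * prob b"
      using prob_eta_in[OF E(1) A(1)] prob_eta[OF A(1)] unfolding A(2) E(2) by simp
  qed
  then show "indep_set {eta n -` A \<inter> space M |A. A \<subseteq> {1..n + 1}}
       (sigma_sets (space M)
         (\<Union>m\<in>{n + 1..}. {(\<lambda>\<omega>. (tree_at K m \<omega>, eta m \<omega>)) -` A \<inter> space M |A. A \<subseteq> InSy m \<times> {1..m + 1}}))"
    unfolding future_events_def .
  have sub: "K \<subseteq> {(x, y). 0 \<le> x \<and> x \<le> y \<and> y \<le> 1}" using K unfolding STree_inf_def by blast
  show "AE \<omega> in M. tree_at K n \<omega> = erase (tree_at K (n + 1) \<omega>) (eta n \<omega>)"
    using AE_generic_sample[OF K, of "n + 1"]
  proof (rule eventually_mono)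
    fix \<omega> assume "generic_sample (n + 1) K (\<lambda>i. U i \<omega>)"
    then show "tree_at K n \<omega> = erase (tree_at K (n + 1) \<omega>) (eta n \<omega>)"
      unfolding tree_at_def eta_def generic_sample_def by (intro erase_sample_tree[OF sub]) auto
  qed
qed

end

section \<open>The Martin boundary\<close>

context iid_uniform
begin

lemma limitin_imp_sample_prob_tendsto:
  assumes "\<And>n. Kn n \<in> STree_inf" "limitin continuum_trees.mtopology Kn K sequentially"
  shows "(\<lambda>n. sample_prob M U (Kn n) k T) \<longlonglongrightarrow> sample_prob M U K k T"
  by (rule sample_prob_tendsto[OF assms(1) _ limitin_imp_kuratowski_lim[OF assms]])
    (rule continuum_trees.limitin_mspace[OF assms(2)])

lemma sample_prob_inj:
  assumes "K1 \<in> STree_inf" "K2 \<in> STree_inf"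
    and "\<And>k T. k \<ge> 1 \<Longrightarrow> T \<in> STree k \<Longrightarrow> sample_prob M U K1 k T = sample_prob M U K2 k T"
  shows "K1 = K2"
proof (rule subset_antisym)
  show "K1 \<subseteq> K2" by (rule sample_prob_determines_subset[OF assms(1,2)]) (rule assms(3))
  show "K2 \<subseteq> K1" by (rule sample_prob_determines_subset[OF assms(2,1)]) (rule assms(3)[symmetric])
qed

text \<open>A subsequence of the drawn trees converges to some \<open>K\<close>; the densities have a limit along the
  whole sequence, so the subsequence determines it.\<close>

lemma gamma_limit_exists:
  assumes conv: "gamma_convergent m S"
  shows "\<exists>K\<in>STree_inf. \<forall>k\<ge>1. \<forall>T\<in>STree k.
    (\<lambda>n. gamma_density k T (m n) (S n)) \<longlonglongrightarrow> sample_prob M U K k T"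
proof -
  have S: "m n \<ge> 1 \<and> S n \<in> STree (m n)" for n using conv unfolding gamma_convergent_def by blast
  have m: "filterlim m at_top sequentially" using conv unfolding gamma_convergent_def by blast
  define \<sigma> where "\<sigma> n = tree_points (m n) (S n)" for n
  have \<sigma>: "\<sigma> n \<in> STree_inf" for n unfolding \<sigma>_def using S tree_points_STree_inf by blast
  obtain K r where K: "strict_mono r" "K \<in> STree_inf" "kuratowski_lim (\<sigma> \<circ> r) K"
    using STree_inf_subsequence[of \<sigma>] \<sigma> by blast
  have "(\<lambda>n. gamma_density k T (m n) (S n)) \<longlonglongrightarrow> sample_prob M U K k T" if k: "k \<ge> 1" and T: "T \<in> STree k" for k T
  proof -
    have "convergent (\<lambda>n. gamma_density k T (m n) (S n))" using conv k T unfolding gamma_convergent_def by blast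
    then obtain L where L: "(\<lambda>n. gamma_density k T (m n) (S n)) \<longlonglongrightarrow> L" unfolding convergent_def by blast
    have "(\<lambda>n. sample_prob M U ((\<sigma> \<circ> r) n) k T) \<longlonglongrightarrow> sample_prob M U K k T"
      by (rule sample_prob_tendsto[OF _ K(2,3)]) (simp add: \<sigma>)
    moreover have "(\<lambda>n. sample_prob M U (\<sigma> n) k T - gamma_density k T (m n) (S n)) \<longlonglongrightarrow> 0"
      unfolding \<sigma>_def by (rule sample_prob_minus_gamma_tendsto[OF S m k])
    from LIMSEQ_subseq_LIMSEQ[OF this K(1)]
    have "(\<lambda>n. sample_prob M U (\<sigma> (r n)) k T - gamma_density k T (m (r n)) (S (r n))) \<longlonglongrightarrow> 0"
      by (simp add: comp_def)
    ultimately have "(\<lambda>n. sample_prob M U (\<sigma> (r n)) k T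
        - (sample_prob M U (\<sigma> (r n)) k T - gamma_density k T (m (r n)) (S (r n)))) \<longlonglongrightarrow> sample_prob M U K k T - 0"
      by (intro tendsto_diff) (simp_all add: comp_def)
    then have "(\<lambda>n. gamma_density k T (m (r n)) (S (r n))) \<longlonglongrightarrow> sample_prob M U K k T" by simp
    moreover have "(\<lambda>n. gamma_density k T (m (r n)) (S (r n))) \<longlonglongrightarrow> L"
      using LIMSEQ_subseq_LIMSEQ[OF L K(1)] by (simp add: comp_def)
    ultimately have "L = sample_prob M U K k T" by (rule LIMSEQ_unique[rotated])
    then show ?thesis using L by simp
  qed
  then show ?thesis using K(2) by blast
qed

lemma discretise_gamma_tendsto:
  assumes K: "K \<in> STree_inf" and k: "k \<ge> 1"
  shows "(\<lambda>n. gamma_density k T (n + 1) (discretise (n + 1) K)) \<longlonglongrightarrow> sample_prob M U K k T"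
proof -
  let ?P = "\<lambda>n. tree_points (n + 1) (discretise (n + 1) K)"
  have D: "n + 1 \<ge> 1 \<and> discretise (n + 1) K \<in> STree (n + 1)" for n
    using discretise_STree[OF K] by simp
  have P: "?P n \<in> STree_inf" for n using D[of n] tree_points_STree_inf by blast
  have up: "filterlim (\<lambda>n :: nat. n + 1) at_top sequentially"
    by (rule filterlim_at_top_mono[OF filterlim_ident]) simp
  have "limitin continuum_trees.mtopology ?P K sequentially"
    unfolding continuum_trees.limitin_metric
  proof (intro conjI K allI impI)
    fix e :: real assume "0 < e"
    have "(\<lambda>n. 2 / real (n + 1)) \<longlonglongrightarrow> 0" by (rule filterlim_compose[OF lim_const_over_n up])
    then have "\<forall>\<^sub>F n in sequentially. 2 / real (n + 1) < e" using \<open>0 < e\<close> by (rule order_tendstoD)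
    then show "\<forall>\<^sub>F n in sequentially. ?P n \<in> STree_inf \<and> hausdorff_dist (?P n) K < e"
    proof (rule eventually_mono)
      fix n assume "2 / real (n + 1) < e"
      moreover have "hausdorff_dist (?P n) K \<le> 2 / real (n + 1)"
        by (rule hausdorff_dist_discretise[OF K]) simp
      ultimately show "?P n \<in> STree_inf \<and> hausdorff_dist (?P n) K < e" using P by simp
    qed
  qed
  then have "(\<lambda>n. sample_prob M U (?P n) k T) \<longlonglongrightarrow> sample_prob M U K k T"
    by (intro limitin_imp_sample_prob_tendsto P)
  moreover have "(\<lambda>n. sample_prob M U (?P n) k T - gamma_density k T (n + 1) (discretise (n + 1) K)) \<longlonglongrightarrow> 0"
    by (rule sample_prob_minus_gamma_tendsto[OF D up k])
  ultimately have "(\<lambda>n. sample_prob M U (?P n) k T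
      - (sample_prob M U (?P n) k T - gamma_density k T (n + 1) (discretise (n + 1) K))) \<longlonglongrightarrow> sample_prob M U K k T - 0"
    by (rule tendsto_diff)
  then show ?thesis by simp
qed

lemma discretise_gamma_convergent:
  assumes K: "K \<in> STree_inf"
  shows "gamma_convergent (\<lambda>n. n + 1) (\<lambda>n. discretise (n + 1) K)"
  unfolding gamma_convergent_def
proof (intro conjI allI impI ballI)
  show "filterlim (\<lambda>n :: nat. n + 1) at_top sequentially"
    by (rule filterlim_at_top_mono[OF filterlim_ident]) simp
  show "convergent (\<lambda>n. gamma_density k T (n + 1) (discretise (n + 1) K))" if "k \<ge> 1" for k T
    using discretise_gamma_tendsto[OF K that] by (rule convergentI)
qed (use discretise_STree[OF K] in auto)

definition tree_law :: "(real \<times> real) set \<Rightarrow> path measure" where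
  "tree_law K = process_law M (tree_at K) eta"

lemma tree_law_marginal:
  assumes K: "K \<in> STree_inf" and k: "k \<ge> 1"
  shows "measure (tree_law K) {\<omega> \<in> space (tree_law K). fst (\<omega> k) = T} = sample_prob M U K k T"
  unfolding tree_law_def process_law_marginal[OF erased_process_tree_at[OF K] k]
  by (rule sample_prob_eq[OF K, symmetric])

lemma tree_law_is_tree_law:
  assumes K: "K \<in> STree_inf"
  shows "is_tree_law M U K (tree_law K)"
  unfolding is_tree_law_def
proof (intro conjI allI impI ballI)
  show "tree_law K \<in> erased_laws"
    unfolding tree_law_def by (rule process_law_in_erased_laws[OF erased_process_tree_at[OF K]])
qed (rule tree_law_marginal[OF K])

lemma erased_law_eq_tree_law:
  assumes K: "K \<in> STree_inf" and P: "erased_process N T \<eta>"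
    and eq: "\<And>k t. k \<ge> 1 \<Longrightarrow> t \<in> STree k \<Longrightarrow> measure N {\<omega> \<in> space N. T k \<omega> = t} = sample_prob M U K k t"
  shows "process_law N T \<eta> = tree_law K"
  unfolding tree_law_def
  by (rule process_law_unique[OF P erased_process_tree_at[OF K]]) (simp add: eq sample_prob_eq[OF K])

lemma is_tree_law_unique:
  assumes K: "K \<in> STree_inf" and \<mu>: "is_tree_law M U K \<mu>"
  shows "\<mu> = tree_law K"
proof -
  obtain N T \<eta> where N: "\<mu> = process_law N T \<eta>" "erased_process (N :: path measure) T \<eta>"
    using \<mu> unfolding is_tree_law_def erased_laws_def by blast
  show ?thesis unfolding N(1)
  proof (rule erased_law_eq_tree_law[OF K N(2)])
    fix k t assume k: "k \<ge> (1 :: nat)" and t: "t \<in> STree k"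
    show "measure N {\<omega> \<in> space N. T k \<omega> = t} = sample_prob M U K k t"
      using \<mu> k t process_law_marginal[OF N(2) k, of t] unfolding is_tree_law_def N(1) by simp
  qed
qed

lemma ex1_is_tree_law: "K \<in> STree_inf \<Longrightarrow> \<exists>!\<mu>. is_tree_law M U K \<mu>"
  using tree_law_is_tree_law is_tree_law_unique by blast

lemma the_tree_law: "K \<in> STree_inf \<Longrightarrow> (THE \<mu>. is_tree_law M U K \<mu>) = tree_law K"
  using tree_law_is_tree_law is_tree_law_unique by (intro the_equality) auto

lemma martin_boundary_eq: "martin_boundary = tree_law ` STree_inf"
proof (intro subset_antisym subsetI)
  fix \<mu> assume "\<mu> \<in> martin_boundary"
  then obtain N :: "path measure" and T \<eta> m S where N: "\<mu> = process_law N T \<eta>" "erased_process N T \<eta>"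
    "gamma_convergent m S"
    and lim: "\<And>k t. k \<ge> 1 \<Longrightarrow> t \<in> STree k \<Longrightarrow>
      (\<lambda>n. gamma_density k t (m n) (S n)) \<longlonglongrightarrow> measure N {\<omega> \<in> space N. T k \<omega> = t}"
    unfolding martin_boundary_def by blast
  obtain K where K: "K \<in> STree_inf" "\<And>k t. k \<ge> 1 \<Longrightarrow> t \<in> STree k \<Longrightarrow>
      (\<lambda>n. gamma_density k t (m n) (S n)) \<longlonglongrightarrow> sample_prob M U K k t"
    using gamma_limit_exists[OF N(3)] by blast
  have "\<mu> = tree_law K" unfolding N(1)
    by (rule erased_law_eq_tree_law[OF K(1) N(2)]) (rule LIMSEQ_unique[OF lim K(2)])
  then show "\<mu> \<in> tree_law ` STree_inf" using K(1) by blast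
next
  fix \<mu> assume "\<mu> \<in> tree_law ` STree_inf"
  then obtain K where K: "K \<in> STree_inf" "\<mu> = tree_law K" by blast
  note P = erased_process_tree_at[OF K(1)]
  let ?T = "\<lambda>n (\<omega> :: path). fst (\<omega> n)" and ?h = "\<lambda>n (\<omega> :: path). snd (\<omega> n)"
  have 1: "erased_process \<mu> ?T ?h" unfolding K(2) tree_law_def by (rule erased_process_canonical[OF P])
  have 2: "\<mu> = process_law \<mu> ?T ?h" unfolding K(2) tree_law_def by (rule process_law_canonical[OF P, symmetric])
  have 3: "gamma_convergent (\<lambda>n. n + 1) (\<lambda>n. discretise (n + 1) K)" by (rule discretise_gamma_convergent[OF K(1)])
  have 4: "(\<lambda>n. gamma_density k t (n + 1) (discretise (n + 1) K)) \<longlonglongrightarrow> measure \<mu> {\<omega> \<in> space \<mu>. ?T k \<omega> = t}"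
    if k: "k \<ge> 1" for k t
  proof -
    have "measure \<mu> {\<omega> \<in> space \<mu>. ?T k \<omega> = t} = sample_prob M U K k t"
      unfolding K(2) by (rule tree_law_marginal[OF K(1) k])
    then show ?thesis using discretise_gamma_tendsto[OF K(1) k, of t] by simp
  qed
  show "\<mu> \<in> martin_boundary" unfolding martin_boundary_def mem_Collect_eq
    using 1 2 3 4 by blast
qed

lemma tree_law_inj: "inj_on tree_law STree_inf"
proof (rule inj_onI)
  fix K1 K2 assume K: "K1 \<in> STree_inf" "K2 \<in> STree_inf" and eq: "tree_law K1 = tree_law K2"
  show "K1 = K2"
  proof (rule sample_prob_inj[OF K])
    fix k T assume k: "k \<ge> (1 :: nat)"
    show "sample_prob M U K1 k T = sample_prob M U K2 k T"
      unfolding tree_law_marginal[OF K(1) k, symmetric] tree_law_marginal[OF K(2) k, symmetric] eq ..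
  qed
qed

lemma tree_law_path_probs: "K \<in> STree_inf \<Longrightarrow> tree_law K \<in> path_probs"
  unfolding path_probs_def tree_law_def process_law_eq
  using prob_space_distr[OF path_of_measurable[OF erased_process_tree_at]] by simp

text \<open>Convergence in the path space concerns finitely many coordinates at a time, and each of them is
  almost surely eventually constant.\<close>

lemma AE_path_limitin:
  assumes Kn: "\<And>n. Kn n \<in> STree_inf" and K: "K \<in> STree_inf" and lim: "kuratowski_lim Kn K"
  shows "AE \<omega> in M. limitin path_topology (\<lambda>n. path_of (tree_at (Kn n)) eta \<omega>) (path_of (tree_at K) eta \<omega>) sequentially"
proof -
  have "AE \<omega> in M. \<forall>k. \<forall>\<^sub>F n in sequentially. tree_at (Kn n) k \<omega> = tree_at K k \<omega>"
    unfolding AE_all_countable using AE_eventually_tree_at[OF assms] by blast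
  then show ?thesis
    using AE_space
  proof eventually_elim
    case (elim \<omega>)
    have top: "path_of (tree_at L) eta \<omega> \<in> topspace path_topology" if "L \<in> STree_inf" for L
      using measurable_space[OF path_of_measurable[OF erased_process_tree_at[OF that]] elim(2)]
      by (simp add: space_path_borel)
    show ?case unfolding limitin_def
    proof (intro conjI allI impI top K)
      fix V assume V: "openin path_topology V \<and> path_of (tree_at K) eta \<omega> \<in> V"
      then obtain N where N: "cylinder N (path_of (tree_at K) eta \<omega>) \<subseteq> V" using open_contains_cylinder by blast
      have "\<forall>\<^sub>F n in sequentially. \<forall>i\<in>{1..N}. tree_at (Kn n) i \<omega> = tree_at K i \<omega>"
        using elim(1) by (intro eventually_ball_finite) auto
      then show "\<forall>\<^sub>F n in sequentially. path_of (tree_at (Kn n)) eta \<omega> \<in> V"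
      proof (rule eventually_mono)
        fix n assume "\<forall>i\<in>{1..N}. tree_at (Kn n) i \<omega> = tree_at K i \<omega>"
        then have "path_of (tree_at (Kn n)) eta \<omega> \<in> cylinder N (path_of (tree_at K) eta \<omega>)"
          unfolding cylinder_def using top[OF Kn] by (auto simp: path_of_def)
        then show "path_of (tree_at (Kn n)) eta \<omega> \<in> V" using N by blast
      qed
    qed
  qed
qed

lemma continuous_path_borel_measurable:
  assumes f: "continuous_map path_topology euclideanreal f"
  shows "f \<in> borel_measurable path_borel"
proof (rule borel_measurableI)
  fix V :: "real set" assume "open V"
  then have "openin path_topology {\<omega> \<in> topspace path_topology. f \<omega> \<in> V}"
    using openin_continuous_map_preimage[OF f] by simp
  moreover have "f -` V \<inter> space path_borel = {\<omega> \<in> topspace path_topology. f \<omega> \<in> V}"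
    by (auto simp: space_path_borel)
  ultimately show "f -` V \<inter> space path_borel \<in> sets path_borel" using open_in_path_borel by simp
qed

lemma integral_tree_law_tendsto:
  assumes Kn: "\<And>n. Kn n \<in> STree_inf" and K: "K \<in> STree_inf" and lim: "kuratowski_lim Kn K"
    and f: "continuous_map path_topology euclideanreal f" and bd: "bounded (f ` topspace path_topology)"
  shows "(\<lambda>n. LINT \<omega>|tree_law (Kn n). f \<omega>) \<longlonglongrightarrow> (LINT \<omega>|tree_law K. f \<omega>)"
proof -
  note fm = continuous_path_borel_measurable[OF f]
  have Z: "path_of (tree_at L) eta \<in> measurable M path_borel" if "L \<in> STree_inf" for L
    by (rule path_of_measurable[OF erased_process_tree_at[OF that]])
  have int: "(LINT \<omega>|tree_law L. f \<omega>) = (LINT \<omega>|M. f (path_of (tree_at L) eta \<omega>))" if "L \<in> STree_inf" for L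
    unfolding tree_law_def process_law_eq by (rule integral_distr[OF Z[OF that] fm])
  obtain B where B: "\<And>\<omega>. \<omega> \<in> topspace path_topology \<Longrightarrow> \<bar>f \<omega>\<bar> \<le> B"
    using bd unfolding bounded_real by auto
  have "(\<lambda>n. LINT \<omega>|M. f (path_of (tree_at (Kn n)) eta \<omega>)) \<longlonglongrightarrow> (LINT \<omega>|M. f (path_of (tree_at K) eta \<omega>))"
  proof (rule integral_dominated_convergence[where w = "\<lambda>_. B"])
    show "(\<lambda>\<omega>. f (path_of (tree_at K) eta \<omega>)) \<in> borel_measurable M"
      by (rule measurable_compose[OF Z[OF K] fm])
    show "(\<lambda>\<omega>. f (path_of (tree_at (Kn n)) eta \<omega>)) \<in> borel_measurable M" for n
      by (rule measurable_compose[OF Z[OF Kn] fm])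
    show "AE \<omega> in M. (\<lambda>n. f (path_of (tree_at (Kn n)) eta \<omega>)) \<longlonglongrightarrow> f (path_of (tree_at K) eta \<omega>)"
      using AE_path_limitin[OF Kn K lim]
    proof (rule eventually_mono)
      fix \<omega> assume "limitin path_topology (\<lambda>n. path_of (tree_at (Kn n)) eta \<omega>) (path_of (tree_at K) eta \<omega>) sequentially"
      from continuous_map_limit[OF f this]
      show "(\<lambda>n. f (path_of (tree_at (Kn n)) eta \<omega>)) \<longlonglongrightarrow> f (path_of (tree_at K) eta \<omega>)"
        by (simp add: comp_def)
    qed
    show "AE \<omega> in M. norm (f (path_of (tree_at (Kn n)) eta \<omega>)) \<le> B" for n
      using AE_space
    proof (rule eventually_mono)
      fix \<omega> assume "\<omega> \<in> space M"
      then have "path_of (tree_at (Kn n)) eta \<omega> \<in> topspace path_topology"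
        using measurable_space[OF Z[OF Kn]] by (simp add: space_path_borel)
      then show "norm (f (path_of (tree_at (Kn n)) eta \<omega>)) \<le> B" using B by simp
    qed
  qed simp
  then show ?thesis by (simp only: int[OF Kn] int[OF K])
qed

lemma topspace_STree_inf [simp]: "topspace STree_inf_topology = STree_inf"
  unfolding STree_inf_topology_def by simp

text \<open>The topology on continuum trees is metric, so the preimage of a basic weakly open set can be
  tested on sequences.\<close>

lemma continuous_map_tree_law: "continuous_map STree_inf_topology weak_topology tree_law"
  unfolding weak_topology_def
proof (rule continuous_on_generated_topo)
  fix W assume "W \<in> {{\<mu> \<in> path_probs. (LINT \<omega>|\<mu>. f \<omega>) \<in> V} |f V.
        continuous_map path_topology euclideanreal f \<and> bounded (f ` topspace path_topology) \<and> open V}"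
  then obtain f V where W: "W = {\<mu> \<in> path_probs. (LINT \<omega>|\<mu>. f \<omega>) \<in> V}"
    and f: "continuous_map path_topology euclideanreal f" "bounded (f ` topspace path_topology)" and V: "open V"
    by blast
  let ?C = "{K \<in> STree_inf. (LINT \<omega>|tree_law K. f \<omega>) \<notin> V}"
  have "closedin continuum_trees.mtopology ?C"
    unfolding continuum_trees.metric_closedin_iff_sequentially_closed
  proof (intro conjI allI impI)
    fix \<sigma> K assume a: "range \<sigma> \<subseteq> ?C \<and> limitin continuum_trees.mtopology \<sigma> K sequentially"
    then have \<sigma>: "\<sigma> n \<in> STree_inf" "(LINT \<omega>|tree_law (\<sigma> n). f \<omega>) \<notin> V" for n by auto
    have K: "K \<in> STree_inf" using a continuum_trees.limitin_mspace by blast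
    have lim: "(\<lambda>n. LINT \<omega>|tree_law (\<sigma> n). f \<omega>) \<longlonglongrightarrow> (LINT \<omega>|tree_law K. f \<omega>)"
      using a by (intro integral_tree_law_tendsto[OF \<sigma>(1) K _ f] limitin_imp_kuratowski_lim \<sigma>(1)) blast
    have "(LINT \<omega>|tree_law K. f \<omega>) \<notin> V"
    proof
      assume "(LINT \<omega>|tree_law K. f \<omega>) \<in> V"
      from eventually_happens'[OF sequentially_bot topological_tendstoD[OF lim V this]]
      show False using \<sigma>(2) by blast
    qed
    then show "K \<in> ?C" using K by blast
  qed blast
  then have "openin STree_inf_topology (STree_inf - ?C)"
    unfolding STree_inf_topology_def closedin_def by simp
  moreover have "tree_law -` W \<inter> topspace STree_inf_topology = STree_inf - ?C"
    unfolding W using tree_law_path_probs by auto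
  ultimately show "openin STree_inf_topology (tree_law -` W \<inter> topspace STree_inf_topology)" by simp
next
  let ?B = "{{\<mu> \<in> path_probs. (LINT \<omega>|\<mu>. f \<omega>) \<in> V} |f V.
        continuous_map path_topology euclideanreal f \<and> bounded (f ` topspace path_topology) \<and> open V}"
  have "path_probs \<in> ?B"
    by (rule CollectI, rule exI[of _ "\<lambda>_. 0"], rule exI[of _ UNIV]) (auto simp: image_constant_conv)
  then have "path_probs \<subseteq> \<Union>?B" by (rule Union_upper)
  moreover have "tree_law ` topspace STree_inf_topology \<subseteq> path_probs" using tree_law_path_probs by auto
  ultimately show "tree_law ` topspace STree_inf_topology \<subseteq> \<Union>?B" by (rule subset_trans[rotated])
qed

lemma topspace_martin_boundary: "topspace martin_boundary_topology = martin_boundary"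
proof -
  have "tree_law ` STree_inf \<subseteq> topspace weak_topology"
    using continuous_map_image_subset_topspace[OF continuous_map_tree_law] by simp
  then show ?thesis unfolding martin_boundary_topology_def martin_boundary_eq by auto
qed

text \<open>Different laws differ in the probability of some cylinder, whose indicator is a
  continuous function on paths.\<close>

lemma Hausdorff_martin_boundary: "Hausdorff_space martin_boundary_topology"
  unfolding Hausdorff_space_def
proof (intro allI impI)
  fix \<mu> \<nu> assume a: "\<mu> \<in> topspace martin_boundary_topology \<and> \<nu> \<in> topspace martin_boundary_topology \<and> \<mu> \<noteq> \<nu>"
  then obtain K L where K: "K \<in> STree_inf" "\<mu> = tree_law K" and L: "L \<in> STree_inf" "\<nu> = tree_law L"
    unfolding topspace_martin_boundary martin_boundary_eq by blast
  have "K \<noteq> L" using a K L by blast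
  then obtain k T where k: "k \<ge> 1" "T \<in> STree k" "sample_prob M U K k T \<noteq> sample_prob M U L k T"
    using sample_prob_inj[OF K(1) L(1)] by blast
  define C where "C = {\<omega> \<in> topspace path_topology. \<omega> k \<in> {T} \<times> UNIV}"
  define f where "f = indicat_real C"
  have f: "continuous_map path_topology euclideanreal f"
    unfolding continuous_map_def
  proof (intro conjI allI impI)
    fix V :: "real set"
    have eq: "{\<omega> \<in> topspace path_topology. f \<omega> \<in> V}
        = {\<omega> \<in> topspace path_topology. \<omega> k \<in> {p. (if fst p = T then 1 else 0) \<in> V}}"
      unfolding f_def C_def indicator_def by (auto simp: mem_Times_iff)
    show "openin path_topology {\<omega> \<in> topspace path_topology. f \<omega> \<in> V}"
      unfolding eq by (rule openin_coordinate[OF k(1)])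
  qed simp
  have bd: "bounded (f ` topspace path_topology)"
    unfolding bounded_real f_def by (intro exI[of _ 1]) (auto simp: indicator_def)
  have C: "C \<in> sets path_borel" unfolding C_def by (rule open_in_path_borel[OF openin_coordinate[OF k(1)]])
  have val: "(LINT \<omega>|tree_law J. f \<omega>) = sample_prob M U J k T" if J: "J \<in> STree_inf" for J
  proof -
    have "space (tree_law J) = topspace path_topology" "sets (tree_law J) = sets path_borel"
      unfolding tree_law_def process_law_eq by (simp_all add: space_path_borel)
    then have "(LINT \<omega>|tree_law J. f \<omega>) = measure (tree_law J) (C \<inter> space (tree_law J))"
      unfolding f_def by simp
    also have "C \<inter> space (tree_law J) = {\<omega> \<in> space (tree_law J). fst (\<omega> k) = T}"
      using \<open>space (tree_law J) = _\<close> unfolding C_def by (auto simp: mem_Times_iff)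
    also have "measure (tree_law J) \<dots> = sample_prob M U J k T" by (rule tree_law_marginal[OF J k(1)])
    finally show ?thesis .
  qed
  obtain V W where VW: "open V" "open W" "sample_prob M U K k T \<in> V" "sample_prob M U L k T \<in> W" "V \<inter> W = {}"
    using hausdorff[OF k(3)] by blast
  define E where "E V = {\<mu> \<in> path_probs. (LINT \<omega>|\<mu>. f \<omega>) \<in> V}" for V
  have E: "openin martin_boundary_topology (martin_boundary \<inter> E V)" if "open V" for V
  proof -
    have "openin weak_topology (E V)"
      unfolding weak_topology_def by (rule topology_generated_by_Basis) (use f bd that in \<open>auto simp: E_def\<close>)
    then show ?thesis unfolding martin_boundary_topology_def by (rule openin_subtopology_Int2)
  qed
  have "\<mu> \<in> martin_boundary \<inter> E V" "\<nu> \<in> martin_boundary \<inter> E W"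
    unfolding E_def martin_boundary_eq using K L VW val tree_law_path_probs by auto
  moreover have "disjnt (martin_boundary \<inter> E V) (martin_boundary \<inter> E W)"
    unfolding disjnt_def E_def using VW(5) by blast
  ultimately show "\<exists>V W. openin martin_boundary_topology V \<and> openin martin_boundary_topology W
      \<and> \<mu> \<in> V \<and> \<nu> \<in> W \<and> disjnt V W"
    using E[OF VW(1)] E[OF VW(2)] by blast
qed

lemma homeomorphic_map_tree_law: "homeomorphic_map STree_inf_topology martin_boundary_topology tree_law"
proof (rule continuous_imp_homeomorphic_map)
  show "continuous_map STree_inf_topology martin_boundary_topology tree_law"
    unfolding martin_boundary_topology_def
    by (rule continuous_map_into_subtopology[OF continuous_map_tree_law]) (auto simp: martin_boundary_eq)
  show "compact_space STree_inf_topology" by (rule compact_space_STree_inf)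
  show "Hausdorff_space martin_boundary_topology" by (rule Hausdorff_martin_boundary)
  show "tree_law ` topspace STree_inf_topology = topspace martin_boundary_topology"
    by (simp add: topspace_martin_boundary martin_boundary_eq)
  show "inj_on tree_law (topspace STree_inf_topology)" using tree_law_inj by simp
qed

end

theorem corollary5p15:
  fixes M :: "'w measure" and U :: "nat \<Rightarrow> 'w \<Rightarrow> real"
  assumes "prob_space M"
    and "prob_space.indep_vars M (\<lambda>_. borel) U {1..}"
    and "\<And>i. i \<ge> 1 \<Longrightarrow> distr M borel (U i) = uniform_measure lborel {0..1}"
  shows "(\<forall>m S. gamma_convergent m S \<longrightarrow>
            (\<exists>!K. K \<in> STree_inf \<and>
               (\<forall>k\<ge>1. \<forall>T\<in>STree k.
                  (\<lambda>n. gamma_density k T (m n) (S n)) \<longlonglongrightarrow> sample_prob M U K k T)))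
       \<and> (\<forall>K\<in>STree_inf. \<exists>!\<mu>. is_tree_law M U K \<mu>)
       \<and> homeomorphic_map STree_inf_topology martin_boundary_topology
            (\<lambda>K. THE \<mu>. is_tree_law M U K \<mu>)"
proof -
  interpret prob_space M by (rule assms(1))
  interpret iid_uniform M U
    by unfold_locales (rule assms(2), rule assms(3))
  have "\<exists>!K. K \<in> STree_inf \<and> (\<forall>k\<ge>1. \<forall>T\<in>STree k.
      (\<lambda>n. gamma_density k T (m n) (S n)) \<longlonglongrightarrow> sample_prob M U K k T)"
    if conv: "gamma_convergent m S" for m S
  proof -
    obtain K where K: "K \<in> STree_inf" "\<forall>k\<ge>1. \<forall>T\<in>STree k.
        (\<lambda>n. gamma_density k T (m n) (S n)) \<longlonglongrightarrow> sample_prob M U K k T"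
      using gamma_limit_exists[OF conv] by blast
    show ?thesis
    proof (rule ex1I[of _ K])
      fix L assume L: "L \<in> STree_inf \<and> (\<forall>k\<ge>1. \<forall>T\<in>STree k.
        (\<lambda>n. gamma_density k T (m n) (S n)) \<longlonglongrightarrow> sample_prob M U L k T)"
      show "L = K"
      proof (rule sample_prob_inj)
        fix k T assume "k \<ge> (1 :: nat)" "T \<in> STree k"
        then show "sample_prob M U L k T = sample_prob M U K k T"
          using L K(2) LIMSEQ_unique by blast
      qed (use L K in auto)
    qed (use K in blast)
  qed
  moreover have "homeomorphic_map STree_inf_topology martin_boundary_topology (\<lambda>K. THE \<mu>. is_tree_law M U K \<mu>)"
    by (rule homeomorphic_map_eq[OF homeomorphic_map_tree_law]) (simp add: the_tree_law)
  ultimately show ?thesis using ex1_is_tree_law by blast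
qed

end
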